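(* Let $\alpha$ be the parameter of a family of very simple increasing trees, let $L(\mathcal{T}_n)$ be the label of the centroid (the one nearest to the root) in a random tree of size $n$, and let $\mathcal{L}$ be its limiting random variable (defined in the context). For every integer $m\ge1$, the limit as $n\to\infty$ of the $m$th factorial moment $E_n(L^{\underline{m}})$ is $$E(\mathcal{L}^{\underline{m}})=\frac{4m^2+2\alpha m+\alpha-2}{m+1}\,\alpha^{\overline{m-1}}.$$ In particular, the limits of the mean and the variance of $L(\mathcal{T}_n)$ are $E(\mathcal{L})=1+\frac32\alpha$ and $V(\mathcal{L})=-\frac{7}{12}\alpha^2+\frac{19}{6}\alpha$.
   Context: Notation: $x^{\underline{m}}=x(x-1)\cdots(x-m+1)$ and $x^{\overline{m}}=x(x+1)\cdots(x+m-1)$ are the falling and rising factorials ($x^{\overline{0}}=1$); $V$ denotes variance. $I_x(a,b)=\frac{1}{B(a,b)}\int_0^xt^{a-1}(1-t)^{b-1}\,dt$ is the regularised incomplete beta function, with $B(a,b)=\Gamma(a)\Gamma(b)/\Gamma(a+b)$. For real $x$ and an integer $r\ge0$, $\binom{x}{r}=x^{\underline{r}}/r!$. Random trees. An increasing tree of size $n$ is a rooted tree with $n$ nodes labelled $1,\dots,n$ such that labels increase along every path leading away from the root (so the root has label $1$). A family of very simple increasing trees is given by real constants $c_1>0$ and $c_2$; put $\alpha=1+c_2/c_1>0$. The admissible cases are: $c_2=0$, $\alpha=1$ (general recursive trees); $c_2<0$, $0<\alpha<1$ (general plane-oriented trees); $c_2>0$, $\alpha=d/(d-1)$ with an integer $d\ge2$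 (general $d$-ary increasing trees). A plane (i.e. ordered) increasing tree $T$ has weight $\omega(T)=\prod_v\phi_{\mathrm{outdeg}(v)}$, where $\sum_i\phi_iu^i=\phi(u)$ with $\phi(u)=\exp(c_1u)$ if $c_2=0$ and $\phi(u)=(1+c_2u)^{1+c_1/c_2}$ otherwise; a random tree $\mathcal{T}_n$ of size $n$ is drawn with probability proportional to its weight. Equivalently (ignoring the order of children), the random tree is produced by the growth process which starts with the root $1$ and, for $i=2,\dots,n$, attaches node $i$ as a child to an existing node of current out-degree $k$ with probability $\frac{\alpha-(\alpha-1)k}{i+\alpha-2}$. $E_n$ denotes expectation for a random tree of size $n$. Centroid. A centroid of a tree is a node minimising the sum of distances to all other nodes; equivalently, each branch at the node (maximal subtree not containing it) contains at most half of the nodes of the tree. Every tree has one centroid or two adjacent centroids; "the centroid" means the one nearest to the root. $L=L(T)$ is the label of the centroid. Limit variable. $\mathcal{L}$ takes values in the positive integers, with $$P(\mathcal{L}=k)=-\frac{1}{\alpha-1}I_{1/2}(k,\alpha)+\left(1+\frac{\alpha}{\alpha-1}\right)\binom{\alpha+k-2}{k-1}2^{-(\alpha+k-1)}$$ for $\alpha\neq1$, and $P(\mathcal{L}=k)=2^{-(k-1)}-\sum_{j\ge k}2^{-j}/j$ for $\alpha=1$ ($k\ge1$). *)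

theory Defs
  imports "HOL-Probability.Probability" "HOL-Computational_Algebra.Formal_Power_Series"
begin

section \<open>Plane increasing trees\<close>

datatype plane_tree = Node (root: nat) (subtrees: "plane_tree list")

primrec labels :: "plane_tree \<Rightarrow> nat list" where
  "labels (Node a ts) = a # concat (map labels ts)"

fun increasing :: "plane_tree \<Rightarrow> bool" where
  "increasing (Node a ts) \<longleftrightarrow> (\<forall>t\<in>set ts. a < root t \<and> increasing t)"

definition increasing_trees :: "nat \<Rightarrow> plane_tree set" where
  "increasing_trees n = {T. distinct (labels T) \<and> set (labels T) = {1..n} \<and> increasing T}"


section \<open>Very simple increasing trees\<close>

definition tree_alpha :: "real \<Rightarrow> real \<Rightarrow> real" where
  "tree_alpha c1 c2 = 1 + c2 / c1"

definition very_simple_family :: "real \<Rightarrow> real \<Rightarrow> bool" where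
  "very_simple_family c1 c2 \<longleftrightarrow>
     c1 > 0 \<and> tree_alpha c1 c2 > 0 \<and>
     (c2 = 0 \<or> c2 < 0 \<or>
      (c2 > 0 \<and> (\<exists>d::nat. d \<ge> 2 \<and> tree_alpha c1 c2 = real d / (real d - 1))))"

text \<open>
  The degree-weight generating function, as a formal power series in \<open>u\<close>:
  \<open>exp (c1 u)\<close> if \<open>c2 = 0\<close>, and \<open>(1 + c2 u)\<close> to the power \<open>1 + c1 / c2\<close> otherwise.
\<close>
definition weight_gf :: "real \<Rightarrow> real \<Rightarrow> real fps" where
  "weight_gf c1 c2 =
     (if c2 = 0 then fps_exp c1
      else fps_compose (fps_binomial (1 + c1 / c2)) (fps_const c2 * fps_X))"

primrec tree_weight :: "real fps \<Rightarrow> plane_tree \<Rightarrow> real" where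
  "tree_weight \<phi> (Node a ts) = fps_nth \<phi> (length ts) * prod_list (map (tree_weight \<phi>) ts)"

text \<open>Only meaningful for \<open>n \<ge> 1\<close>, as there is no tree of size \<open>0\<close>.\<close>
definition random_tree :: "real \<Rightarrow> real \<Rightarrow> nat \<Rightarrow> plane_tree pmf" where
  "random_tree c1 c2 n = embed_pmf (\<lambda>T.
     if T \<in> increasing_trees n
     then tree_weight (weight_gf c1 c2) T /
          (\<Sum>T'\<in>increasing_trees n. tree_weight (weight_gf c1 c2) T')
     else 0)"


section \<open>The centroid\<close>

fun edges :: "plane_tree \<Rightarrow> (nat \<times> nat) set" where
  "edges (Node a ts) = (\<Union>t\<in>set ts. insert (a, root t) (edges t))"

text \<open>Nodes are identified with their labels.\<close>
definition tree_dist :: "plane_tree \<Rightarrow> nat \<Rightarrow> nat \<Rightarrow> nat" where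
  "tree_dist T u v = (LEAST k. (u, v) \<in> (edges T \<union> (edges T)\<inverse>) ^^ k)"

definition is_centroid :: "plane_tree \<Rightarrow> nat \<Rightarrow> bool" where
  "is_centroid T v \<longleftrightarrow>
     v \<in> set (labels T) \<and>
     (\<forall>w\<in>set (labels T).
        (\<Sum>u\<in>set (labels T). tree_dist T v u) \<le> (\<Sum>u\<in>set (labels T). tree_dist T w u))"

definition centroid_label :: "plane_tree \<Rightarrow> nat" where
  "centroid_label T = (ARG_MIN (tree_dist T (root T)) v. is_centroid T v)"


section \<open>The limiting distribution\<close>

definition inc_beta :: "real \<Rightarrow> real \<Rightarrow> real \<Rightarrow> real" where
  "inc_beta x a b =
     1 / Beta a b * integral {0..x} (\<lambda>t. t powr (a - 1) * (1 - t) powr (b - 1))"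

definition limit_prob :: "real \<Rightarrow> nat \<Rightarrow> real" where
  "limit_prob \<alpha> k =
     (if k = 0 then 0
      else if \<alpha> = 1 then (1 / 2) ^ (k - 1) - (\<Sum>\<^sub>\<infinity>j\<in>{k..}. (1 / 2) ^ j / real j)
      else - (1 / (\<alpha> - 1)) * inc_beta (1 / 2) (real k) \<alpha>
           + (1 + \<alpha> / (\<alpha> - 1)) * ((\<alpha> + real k - 2) gchoose (k - 1))
             * 2 powr (- (\<alpha> + real k - 1)))"

definition limit_label :: "real \<Rightarrow> nat pmf" where
  "limit_label \<alpha> = embed_pmf (limit_prob \<alpha>)"


section \<open>Factorial moments\<close>

definition falling_factorial :: "real \<Rightarrow> nat \<Rightarrow> real" where
  "falling_factorial x m = (\<Prod>i<m. x - real i)"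

end

theory Submission
  imports Defs "HOL-Real_Asymp.Real_Asymp"
begin

text \<open>
  The centroid nearest to the root is the last node \<open>k\<close> on the path of heavy nodes that starts in the
  root, where a node is heavy if more than half of all nodes are its descendants
  (\<open>last_heavy_arg_min\<close>). As two heavy siblings cannot exist, the centroid has label \<open>k\<close> iff \<open>k\<close> is
  heavy and none of its children is, so
  \<open>P(L = k) = P(k heavy) - (\<Sum>j>k. P(j is a heavy child of k))\<close>.

  Counting trees by weight and removing the leaf with the largest label shows that the edge set of a
  random tree performs the growth process: a node of outdegree \<open>d\<close> attracts the next node with
  probability proportional to \<open>\<alpha> - (\<alpha> - 1) * d\<close> (\<open>weighted_sum_Suc\<close>). Hence the size of the
  subtree at \<open>j\<close> is a Polya urn that starts with weight \<open>\<alpha>\<close> against \<open>j - 1\<close>, and it is independent of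
  the parent of \<open>j\<close>, which was chosen before. Both laws are explicit (\<open>expect_size_law\<close>,
  \<open>expect_parent\<close>).

  The distribution functions of these urn laws for consecutive \<open>j\<close> differ by a single product
  (\<open>cdf_size_law_Suc\<close>), which makes \<open>1 - P(j heavy)\<close> a sum of \<open>j - 1\<close> terms that converge to negative binomial
  probabilities with parameters \<open>\<alpha>\<close> and \<open>1/2\<close> (\<open>cdf_step_tendsto\<close>). So in the limit \<open>j\<close> is heavy with probability
  \<open>P(N \<ge> j - 1)\<close>, where \<open>N\<close> has that negative binomial distribution; this is also the incomplete beta
  function at \<open>1/2\<close> (\<open>inc_beta_half\<close>). The rising factorials of the urn weight are martingales up to a
  deterministic factor, and Markov's inequality bounds \<open>P(j heavy)\<close> by a constant times \<open>j\<close> to the power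
  \<open>-r\<close>, for every \<open>r\<close> and uniformly in \<open>n\<close> (\<open>heavy_prob_power_bound\<close>). Tannery's theorem then turns the
  convergence of the individual probabilities into convergence of \<open>P(L = k)\<close> and of all moments
  (\<open>label_prob_tendsto\<close>, \<open>expect_centre_tendsto\<close>).

  The limit of \<open>P(L = k)\<close> involves an infinite sum over the possible children \<open>j\<close>. For \<open>\<alpha> \<noteq> 1\<close> it telescopes to the
  closed form of the limiting distribution (\<open>parent_sum\<close>), for \<open>\<alpha> = 1\<close> it is the stated logarithmic tail
  (\<open>label_limit_1\<close>). The factorial moments of the limit follow by summation by parts from the factorial
  moments of \<open>N\<close>, which are the rising factorials of \<open>\<alpha>\<close>.
\<close>

section \<open>Increasing trees as edge sets\<close>

definition outdegree :: "(nat \<times> nat) set \<Rightarrow> nat \<Rightarrow> nat" where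
  "outdegree E v = card (E `` {v})"

text \<open>
  Only the edges of a tree matter for the label of its centroid, so the order of the children is dropped.
  The rule \<open>grow\<close> mirrors one step of the growth process, whence properties of these trees are proved by
  following the process.
\<close>
inductive recursive_tree :: "nat \<Rightarrow> (nat \<times> nat) set \<Rightarrow> bool" where
  single: "recursive_tree (Suc 0) {}"
| grow: "recursive_tree n E \<Longrightarrow> v \<in> {1..n} \<Longrightarrow> recursive_tree (Suc n) (insert (v, Suc n) E)"

definition descendants :: "(nat \<times> nat) set \<Rightarrow> nat \<Rightarrow> nat set" where
  "descendants E v = E\<^sup>* `` {v}"

lemma recursive_tree_pos: "recursive_tree n E \<Longrightarrow> 1 \<le> n"
  by (induction rule: recursive_tree.induct) auto

lemma recursive_tree_edge:
  "recursive_tree n E \<Longrightarrow> (a, b) \<in> E \<Longrightarrow> 1 \<le> a \<and> a < b \<and> b \<le> n"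
  by (induction rule: recursive_tree.induct) auto

lemma recursive_tree_finite: "recursive_tree n E \<Longrightarrow> finite E"
  by (induction rule: recursive_tree.induct) auto

lemma recursive_tree_unique_parent:
  "recursive_tree n E \<Longrightarrow> (a, b) \<in> E \<Longrightarrow> (a', b) \<in> E \<Longrightarrow> a = a'"
  by (induction rule: recursive_tree.induct) (auto dest: recursive_tree_edge)

lemma recursive_tree_parent:
  "recursive_tree n E \<Longrightarrow> b \<in> {2..n} \<Longrightarrow> \<exists>a. (a, b) \<in> E"
proof (induction rule: recursive_tree.induct)
  case (grow n E v)
  then show ?case by (cases "b = Suc n") auto
qed auto

lemma descendants_self: "v \<in> descendants E v"
  by (simp add: descendants_def)

lemma descendants_subset:
  assumes "recursive_tree n E" "v \<in> {1..n}"
  shows "descendants E v \<subseteq> {v..n}"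
proof
  fix u assume "u \<in> descendants E v"
  then have "(v, u) \<in> E\<^sup>*" by (simp add: descendants_def)
  then show "u \<in> {v..n}"
  proof (induction rule: rtrancl_induct)
    case (step y z)
    then show ?case using recursive_tree_edge[OF assms(1) step.hyps(2)] by auto
  qed (use assms in auto)
qed

lemma descendants_root:
  "recursive_tree n E \<Longrightarrow> descendants E 1 = {1..n}"
proof (induction rule: recursive_tree.induct)
  case single
  then show ?case by (simp add: descendants_def)
next
  case (grow n E v)
  have "v \<in> descendants E 1" using grow by simp
  then have "(1, v) \<in> (insert (v, Suc n) E)\<^sup>*"
    using rtrancl_mono[of E "insert (v, Suc n) E"] by (auto simp: descendants_def)
  then have "Suc n \<in> descendants (insert (v, Suc n) E) 1"
    using rtrancl_into_rtrancl[of 1 v "insert (v, Suc n) E" "Suc n"] by (simp add: descendants_def)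
  moreover have "descendants E 1 \<subseteq> descendants (insert (v, Suc n) E) 1"
    using rtrancl_mono[of E "insert (v, Suc n) E"] by (auto simp: descendants_def)
  moreover have "descendants (insert (v, Suc n) E) 1 \<subseteq> {1..Suc n}"
    using descendants_subset[OF recursive_tree.grow[OF grow.hyps], of 1] by simp
  ultimately show ?case using grow.IH by (auto simp: le_Suc_eq)
qed

text \<open>
  A label that has not been used yet has no outgoing edges.
\<close>
lemma outside_rtrancl:
  assumes "recursive_tree n E" "(Suc n, u) \<in> E\<^sup>*"
  shows "u = Suc n"
  using assms(2)
proof (cases rule: converse_rtranclE)
  case (step z)
  then have "Suc n \<le> n" using recursive_tree_edge[OF assms(1)] by (meson order_trans less_imp_le)
  then show ?thesis by simp
qed simp

lemma descendants_grow:
  assumes "recursive_tree n E" "v \<in> {1..n}"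
  shows "descendants (insert (v, Suc n) E) j =
    (if v \<in> descendants E j then insert (Suc n) (descendants E j) else descendants E j)"
proof -
  have "(Suc n, u) \<in> E\<^sup>* \<longleftrightarrow> u = Suc n" for u
    using outside_rtrancl[OF assms(1), of u] by auto
  then have "u \<in> descendants (insert (v, Suc n) E) j \<longleftrightarrow>
      u \<in> descendants E j \<or> v \<in> descendants E j \<and> u = Suc n" for u
    by (simp add: descendants_def rtrancl_insert)
  then show ?thesis by (simp add: set_eq_iff) blast
qed

lemma descendants_new:
  assumes "recursive_tree n E" "v \<in> {1..n}"
  shows "descendants (insert (v, Suc n) E) (Suc n) = {Suc n}"
proof -
  have "(Suc n, u) \<in> E\<^sup>* \<longleftrightarrow> u = Suc n" for u
    using outside_rtrancl[OF assms(1), of u] by auto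
  then show ?thesis
    unfolding descendants_grow[OF assms] using assms(2) by (auto simp: descendants_def)
qed

lemma finite_descendants: "recursive_tree n E \<Longrightarrow> v \<in> {1..n} \<Longrightarrow> finite (descendants E v)"
  by (rule finite_subset[OF descendants_subset]) auto

lemma outdegree_grow:
  assumes "recursive_tree n E" 
  shows "outdegree (insert (v, Suc n) E) u = (if u = v then Suc (outdegree E u) else outdegree E u)"
proof -
  have "finite (E `` {u})" "Suc n \<notin> E `` {u}"
    using recursive_tree_finite[OF assms] recursive_tree_edge[OF assms, of u "Suc n"] by auto
  then have "card (insert (Suc n) (E `` {u})) = Suc (card (E `` {u}))"
    by (rule card_insert_disjoint)
  moreover have "insert (v, Suc n) E `` {u} = (if u = v then insert (Suc n) (E `` {u}) else E `` {u})"
    by auto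
  ultimately show ?thesis unfolding outdegree_def by (cases "u = v") simp_all
qed

lemma outdegree_new:
  assumes "recursive_tree n E" "u \<ge> n" shows "outdegree E u = 0"
proof -
  have "(u, w) \<notin> E" for w
    using recursive_tree_edge[OF assms(1), of u w] assms(2) by auto
  then have "E `` {u} = {}" by blast
  then show ?thesis by (simp add: outdegree_def)
qed

text \<open>
  Every node of the subtree at \<open>j\<close> except \<open>j\<close> itself is the end of exactly one edge that starts in the
  subtree. This is what makes the total attraction of a subtree a function of its size alone.
\<close>
lemma sum_outdegree_descendants:
  "recursive_tree n E \<Longrightarrow> j \<in> {1..n} \<Longrightarrow>
     Suc (\<Sum>v\<in>descendants E j. outdegree E v) = card (descendants E j)"
proof (induction arbitrary: j rule: recursive_tree.induct)
  case single
  then show ?case by (simp add: descendants_def outdegree_def)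
next
  case (grow n E v)
  note new = outdegree_new[OF grow.hyps(1), of "Suc n"]
  show ?case
  proof (cases "j = Suc n")
    case True
    from grow.hyps(2) have "v \<noteq> Suc n" by simp
    then show ?thesis unfolding True
      by (simp add: descendants_new[OF grow.hyps] outdegree_grow[OF grow.hyps(1)] new)
  next
    case False
    with grow.prems have j: "j \<in> {1..n}" by auto
    note fin = finite_descendants[OF grow.hyps(1) j]
    have nin: "Suc n \<notin> descendants E j"
      using descendants_subset[OF grow.hyps(1) j] by auto
    have "(\<Sum>w\<in>descendants E j. if w = v then Suc (outdegree E w) else outdegree E w)
       = (\<Sum>w\<in>descendants E j. outdegree E w + (if w = v then 1 else 0))"
      by (intro sum.cong) auto
    also have "\<dots> = (\<Sum>w\<in>descendants E j. outdegree E w) + (if v \<in> descendants E j then 1 else 0)"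
      using fin by (simp add: sum.distrib)
    finally have sum: "(\<Sum>w\<in>descendants E j. outdegree (insert (v, Suc n) E) w)
        = (\<Sum>w\<in>descendants E j. outdegree E w) + (if v \<in> descendants E j then 1 else 0)"
      by (simp only: outdegree_grow[OF grow.hyps(1)])
    have "outdegree (insert (v, Suc n) E) (Suc n) = 0"
      using grow.hyps(2) new by (simp add: outdegree_grow[OF grow.hyps(1)])
    then show ?thesis
      using grow.IH[OF j] fin nin sum by (simp add: descendants_grow[OF grow.hyps])
  qed
qed

section \<open>Distance sums in a tree\<close>

text \<open>
  The distance for an arbitrary relation; it is used for the symmetric closure of the edge set of a tree.
\<close>
definition graph_dist :: "('a \<times> 'a) set \<Rightarrow> 'a \<Rightarrow> 'a \<Rightarrow> nat" where
  "graph_dist R u v = (LEAST k. (u, v) \<in> R ^^ k)"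

lemma graph_dist_le: "(u, v) \<in> R ^^ k \<Longrightarrow> graph_dist R u v \<le> k"
  unfolding graph_dist_def by (rule Least_le)

lemma graph_dist_walk: "(u, v) \<in> R\<^sup>* \<Longrightarrow> (u, v) \<in> R ^^ graph_dist R u v"
  unfolding graph_dist_def rtrancl_power by (rule LeastI_ex)

lemma graph_dist_sym:
  assumes "sym R" shows "graph_dist R u v = graph_dist R v u"
proof -
  have "sym (R ^^ k)" for k
  proof (induction k)
    case (Suc k)
    have "(R ^^ Suc k)\<inverse> = R\<inverse> O (R ^^ k)\<inverse>" by (simp add: converse_relcomp)
    also have "\<dots> = R ^^ Suc k"
      using assms Suc by (simp add: sym_conv_converse_eq relpow_commute)
    finally show ?case by (simp add: sym_conv_converse_eq)
  qed (auto simp: sym_def)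
  then have "(u, v) \<in> R ^^ k \<longleftrightarrow> (v, u) \<in> R ^^ k" for k by (auto simp: sym_def)
  then show ?thesis by (simp add: graph_dist_def)
qed

lemma walk_through_cut:
  assumes cut: "\<And>x y. (x, y) \<in> R \<Longrightarrow> x \<notin> B \<Longrightarrow> y \<in> B \<Longrightarrow> y = j"
    and "(x, u) \<in> R ^^ m" "x \<notin> B" "u \<in> B"
  shows "\<exists>l<m. (j, u) \<in> R ^^ l"
  using assms(2-)
proof (induction m arbitrary: x)
  case (Suc m)
  then obtain y where y: "(x, y) \<in> R" "(y, u) \<in> R ^^ m" by (meson relpow_Suc_E2)
  show ?case
  proof (cases "y \<in> B")
    case True
    with cut[OF y(1)] Suc.prems y(2) show ?thesis by blast
  next
    case False
    with Suc.IH[OF y(2)] Suc.prems show ?thesis using less_SucI by blast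
  qed
qed auto

text \<open>
  If every edge into \<open>B\<close> ends in \<open>j\<close>, then a walk into \<open>B\<close> has to pass through \<open>j\<close>, so the edge from \<open>k\<close>
  to \<open>j\<close> is the first step of a shortest walk. For a tree edge this applies to the descendants of the
  child as well as to their complement.
\<close>
lemma graph_dist_across_cut:
  assumes cut: "\<And>x y. (x, y) \<in> R \<Longrightarrow> x \<notin> B \<Longrightarrow> y \<in> B \<Longrightarrow> y = j"
    and "(k, j) \<in> R" "k \<notin> B" "u \<in> B" "(k, u) \<in> R\<^sup>*" "(j, u) \<in> R\<^sup>*"
  shows "graph_dist R k u = Suc (graph_dist R j u)"
proof (rule antisym)
  have "(k, u) \<in> R ^^ Suc (graph_dist R j u)"
    using graph_dist_walk[OF assms(6)] assms(2) by (meson relpow_Suc_I2)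
  then show "graph_dist R k u \<le> Suc (graph_dist R j u)" by (rule graph_dist_le)
next
  obtain l where "l < graph_dist R k u" "(j, u) \<in> R ^^ l"
    using walk_through_cut[OF _ graph_dist_walk[OF assms(5)] assms(3,4), where j = j] cut by blast
  then show "Suc (graph_dist R j u) \<le> graph_dist R k u" using graph_dist_le[of j u l R] by simp
qed

definition total_distance :: "nat \<Rightarrow> (nat \<times> nat) set \<Rightarrow> nat \<Rightarrow> nat" where
  "total_distance n E v = (\<Sum>u\<in>{1..n}. graph_dist (E \<union> E\<inverse>) v u)"

lemma recursive_tree_connected:
  assumes "recursive_tree n E" "u \<in> {1..n}" "v \<in> {1..n}"
  shows "(u, v) \<in> (E \<union> E\<inverse>)\<^sup>*"
proof -
  have *: "(1, w) \<in> (E \<union> E\<inverse>)\<^sup>*" if "w \<in> {1..n}" for w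
    using descendants_root[OF assms(1)] that rtrancl_mono[of E "E \<union> E\<inverse>"]
    by (auto simp: descendants_def)
  moreover have "sym ((E \<union> E\<inverse>)\<^sup>*)" by (intro sym_rtrancl) (auto simp: sym_def)
  ultimately show ?thesis using assms(2,3) by (meson rtrancl_trans symE)
qed

lemma graph_dist_child:
  assumes T: "recursive_tree n E" and e: "(k, j) \<in> E" and u: "u \<in> {1..n}"
  defines "R \<equiv> E \<union> E\<inverse>"
  shows "u \<in> descendants E j \<Longrightarrow> graph_dist R k u = Suc (graph_dist R j u)"
    and "u \<notin> descendants E j \<Longrightarrow> graph_dist R j u = Suc (graph_dist R k u)"
proof -
  note kj = recursive_tree_edge[OF T e]
  have conn: "(k, u) \<in> R\<^sup>*" "(j, u) \<in> R\<^sup>*"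
    using recursive_tree_connected[OF T] kj u by (auto simp: R_def)
  have k: "k \<notin> descendants E j"
    using descendants_subset[OF T, of j] kj by auto
  have cut: "(x = k \<and> y = j)" if h: "(x, y) \<in> R" "x \<notin> descendants E j" "y \<in> descendants E j" for x y
  proof -
    have "(x, y) \<in> E"
    proof (rule ccontr)
      assume "(x, y) \<notin> E"
      then have "(y, x) \<in> E" using h by (auto simp: R_def)
      then show False using h by (auto simp: descendants_def intro: rtrancl_into_rtrancl)
    qed
    moreover have "y = j"
    proof (rule ccontr)
      assume "y \<noteq> j"
      then obtain z where "(j, z) \<in> E\<^sup>*" "(z, y) \<in> E"
        using h(3) by (auto simp: descendants_def elim: rtranclE)
      then have "x \<in> descendants E j"
        using recursive_tree_unique_parent[OF T \<open>(x, y) \<in> E\<close>, of z] by (simp add: descendants_def)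
      then show False using h by simp
    qed
    ultimately show ?thesis using recursive_tree_unique_parent[OF T e, of x] by simp
  qed
  show "graph_dist R k u = Suc (graph_dist R j u)" if "u \<in> descendants E j"
    by (rule graph_dist_across_cut[where B = "descendants E j"])
       (use cut e k that conn in \<open>auto simp: R_def\<close>)
  show "graph_dist R j u = Suc (graph_dist R k u)" if "u \<notin> descendants E j"
  proof (rule graph_dist_across_cut[where B = "- descendants E j"])
    fix x y assume "(x, y) \<in> R" "x \<notin> - descendants E j" "y \<in> - descendants E j"
    then show "y = k" using cut[of y x] by (auto simp: R_def)
  qed (use e that conn descendants_self in \<open>auto simp: R_def\<close>)
qed

text \<open>
  Moving from \<open>k\<close> to its child \<open>j\<close> brings the descendants of \<open>j\<close> one step closer and takes all other nodes
  one step further away.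
\<close>
lemma total_distance_child:
  assumes T: "recursive_tree n E" and e: "(k, j) \<in> E"
  shows "total_distance n E j + 2 * card (descendants E j) = total_distance n E k + n"
proof -
  note kj = recursive_tree_edge[OF T e]
  let ?B = "descendants E j" and ?R = "E \<union> E\<inverse>"
  have B: "?B \<subseteq> {1..n}" using descendants_subset[OF T, of j] kj by auto
  note fin = finite_subset[OF B]
  have split: "(\<Sum>u\<in>{1..n}. f u) = (\<Sum>u\<in>?B. f u) + (\<Sum>u\<in>{1..n} - ?B. f u)" for f :: "nat \<Rightarrow> nat"
    using sum.subset_diff[OF B, of f] by simp
  have "total_distance n E k = (\<Sum>u\<in>?B. Suc (graph_dist ?R j u)) + (\<Sum>u\<in>{1..n} - ?B. graph_dist ?R k u)"
    unfolding total_distance_def split using graph_dist_child(1)[OF T e] B by (auto intro!: sum.cong)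
  moreover have "total_distance n E j = (\<Sum>u\<in>?B. graph_dist ?R j u) + (\<Sum>u\<in>{1..n} - ?B. Suc (graph_dist ?R k u))"
    unfolding total_distance_def split using graph_dist_child(2)[OF T e] B by (auto intro!: sum.cong)
  moreover have "card ({1..n} - ?B) + card ?B = n"
    using card_Diff_subset[OF fin B] card_mono[OF _ B] by simp
  ultimately show ?thesis by (simp add: sum.distrib sum_Suc)
qed

section \<open>The centroid is the last heavy node\<close>

definition heavy :: "nat \<Rightarrow> (nat \<times> nat) set \<Rightarrow> nat \<Rightarrow> bool" where
  "heavy n E v \<longleftrightarrow> n < 2 * card (descendants E v)"

definition last_heavy :: "nat \<Rightarrow> (nat \<times> nat) set \<Rightarrow> nat \<Rightarrow> bool" where
  "last_heavy n E v \<longleftrightarrow> v \<in> {1..n} \<and> heavy n E v \<and> (\<forall>w. (v, w) \<in> E \<longrightarrow> \<not> heavy n E w)"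

text \<open>
  Two sets that each contain more than half of the nodes cannot be disjoint.
\<close>
lemma heavy_intersect:
  assumes T: "recursive_tree n E" and "v \<in> {1..n}" "w \<in> {1..n}" "heavy n E v" "heavy n E w"
  shows "descendants E v \<inter> descendants E w \<noteq> {}"
proof
  assume "descendants E v \<inter> descendants E w = {}"
  then have "card (descendants E v) + card (descendants E w) = card (descendants E v \<union> descendants E w)"
    using finite_descendants[OF T] assms by (simp add: card_Un_disjoint)
  also have "\<dots> \<le> card {1..n}"
    using descendants_subset[OF T, of v] descendants_subset[OF T, of w] assms by (intro card_mono) auto
  finally show False using assms by (simp add: heavy_def)
qed

lemma common_descendant_comparable:
  assumes T: "recursive_tree n E" and "(v, u) \<in> E\<^sup>*" "(w, u) \<in> E\<^sup>*"
  shows "(v, w) \<in> E\<^sup>* \<or> (w, v) \<in> E\<^sup>*"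
  using assms(2,3)
proof (induction rule: rtrancl_induct)
  case (step y z)
  from step.prems have "w = z \<or> (w, y) \<in> E\<^sup>*"
  proof (cases rule: rtranclE)
    case (step y')
    then show ?thesis using recursive_tree_unique_parent[OF T \<open>(y, z) \<in> E\<close>, of y'] by simp
  qed simp
  then show ?case
  proof
    assume "w = z"
    then show ?thesis using step.hyps rtrancl_into_rtrancl[of v y E z] by simp
  qed (rule step.IH)
qed simp

lemma heavy_antimono:
  assumes T: "recursive_tree n E" and "v \<in> {1..n}" "(v, w) \<in> E\<^sup>*" "heavy n E w"
  shows "heavy n E v"
proof -
  have "descendants E w \<subseteq> descendants E v"
    using assms(3) by (auto simp: descendants_def intro: rtrancl_trans)
  then have "card (descendants E w) \<le> card (descendants E v)"
    using finite_descendants[OF T assms(2)] by (rule card_mono[rotated])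
  then show ?thesis using assms(4) by (simp add: heavy_def)
qed

lemma last_heavy_above:
  assumes T: "recursive_tree n E" and v: "last_heavy n E v" and vw: "(v, w) \<in> E\<^sup>*" and w: "heavy n E w"
  shows "v = w"
  using vw
proof (cases rule: converse_rtranclE)
  case (step y)
  have "y \<in> {1..n}" using recursive_tree_edge[OF T step(1)] by auto
  then have "heavy n E y" using heavy_antimono[OF T _ step(2) w] by simp
  then show ?thesis using v step(1) by (auto simp: last_heavy_def)
qed

text \<open>
  Two heavy nodes have a common descendant and hence are comparable, and all nodes between two comparable
  heavy nodes are heavy.
\<close>
lemma last_heavy_unique:
  assumes T: "recursive_tree n E" and v: "last_heavy n E v" and w: "last_heavy n E w"
  shows "v = w"
proof -
  obtain u where "(v, u) \<in> E\<^sup>*" "(w, u) \<in> E\<^sup>*"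
    using heavy_intersect[OF T, of v w] v w by (auto simp: last_heavy_def descendants_def)
  then have "(v, w) \<in> E\<^sup>* \<or> (w, v) \<in> E\<^sup>*" by (rule common_descendant_comparable[OF T])
  then show ?thesis
    using last_heavy_above[OF T] v w by (auto simp: last_heavy_def)
qed

definition minimal_distance :: "nat \<Rightarrow> (nat \<times> nat) set \<Rightarrow> nat \<Rightarrow> bool" where
  "minimal_distance n E v \<longleftrightarrow> v \<in> {1..n} \<and> (\<forall>w\<in>{1..n}. total_distance n E v \<le> total_distance n E w)"

text \<open>
  By the formula for the change of the distance sum along an edge, a minimiser has no heavy child, and a
  minimiser \<open>v\<close> that is not heavy contains exactly half of the nodes in its subtree. In the latter case the
  parent is a minimiser too, and it is heavy because its subtree is larger.
\<close>
lemma minimal_distance_cases: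
  assumes T: "recursive_tree n E" and v: "minimal_distance n E v"
  shows "last_heavy n E v \<or> (\<exists>c. (c, v) \<in> E \<and> last_heavy n E c \<and> minimal_distance n E c)"
proof -
  have vn: "v \<in> {1..n}" using v by (simp add: minimal_distance_def)
  have light_child: "\<not> heavy n E w" if "minimal_distance n E u" "(u, w) \<in> E" for u w
  proof -
    have "w \<in> {1..n}" using recursive_tree_edge[OF T that(2)] by auto
    then have "total_distance n E u \<le> total_distance n E w" using that by (auto simp: minimal_distance_def)
    then show ?thesis using total_distance_child[OF T that(2)] by (auto simp: heavy_def)
  qed
  show ?thesis
  proof (cases "heavy n E v")
    case True
    then show ?thesis using light_child[OF v] vn by (auto simp: last_heavy_def)
  next
    case False
    have "heavy n E 1"
      using recursive_tree_pos[OF T] descendants_root[OF T] by (simp add: heavy_def)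
    with False vn have "v \<in> {2..n}" by (cases "v = 1") auto
    then obtain c where c: "(c, v) \<in> E" using recursive_tree_parent[OF T] by blast
    have cn: "c \<in> {1..n}" using recursive_tree_edge[OF T c] by auto
    have eq: "total_distance n E v + 2 * card (descendants E v) = total_distance n E c + n"
      by (rule total_distance_child[OF T c])
    moreover have "total_distance n E v \<le> total_distance n E c" using v cn by (simp add: minimal_distance_def)
    ultimately have half: "2 * card (descendants E v) = n" "total_distance n E v = total_distance n E c"
      using False by (auto simp: heavy_def)
    \<comment> \<open>The two distance sums agree, so \<open>c\<close> is a minimiser as well.\<close>
    have cmin: "minimal_distance n E c" using v half cn by (simp add: minimal_distance_def)
    have "descendants E v \<subset> descendants E c"
    proof
      show "descendants E v \<subseteq> descendants E c"
        using c by (auto simp: descendants_def intro: converse_rtrancl_into_rtrancl)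
      have "c \<notin> descendants E v"
        using descendants_subset[OF T vn] recursive_tree_edge[OF T c] by auto
      then show "descendants E v \<noteq> descendants E c" using descendants_self[of c E] by auto
    qed
    then have "card (descendants E v) < card (descendants E c)"
      by (intro psubset_card_mono finite_descendants[OF T cn])
    then have "heavy n E c" using half by (simp add: heavy_def)
    then show ?thesis using light_child[OF cmin] c cn cmin by (auto simp: last_heavy_def)
  qed
qed

text \<open>
  The only minimiser other than the last heavy node is a child of it, which is further away from the root.
\<close>
lemma last_heavy_arg_min:
  assumes T: "recursive_tree n E"
  shows "last_heavy n E (ARG_MIN (graph_dist (E \<union> E\<inverse>) 1) v. minimal_distance n E v)"
proof -
  let ?d = "graph_dist (E \<union> E\<inverse>) 1"
  have "\<exists>v. v \<in> {1..n} \<and> (\<forall>w. w \<in> {1..n} \<longrightarrow> total_distance n E v \<le> total_distance n E w)"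
    by (rule ex_has_least_nat[of "\<lambda>v. v \<in> {1..n}" 1]) (use recursive_tree_pos[OF T] in auto)
  then obtain v where "minimal_distance n E v" unfolding minimal_distance_def by blast
  with minimal_distance_cases[OF T] obtain c where c: "minimal_distance n E c" "last_heavy n E c" by blast
  have unique: "c' = c" if "minimal_distance n E c'" "?d c' \<le> ?d c" for c'
    using minimal_distance_cases[OF T that(1)]
  proof
    assume "last_heavy n E c'"
    then show ?thesis using last_heavy_unique[OF T _ c(2)] by blast
  next
    assume "\<exists>a. (a, c') \<in> E \<and> last_heavy n E a \<and> minimal_distance n E a"
    then have e: "(c, c') \<in> E" using last_heavy_unique[OF T _ c(2)] by blast
    have "1 \<notin> descendants E c'"
      using recursive_tree_edge[OF T e] descendants_subset[OF T, of c'] by auto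
    then have "graph_dist (E \<union> E\<inverse>) c' 1 = Suc (graph_dist (E \<union> E\<inverse>) c 1)"
      using graph_dist_child(2)[OF T e, of 1] recursive_tree_pos[OF T] by simp
    moreover have "sym (E \<union> E\<inverse>)" by (auto simp: sym_def)
    ultimately have "?d c' = Suc (?d c)" by (simp add: graph_dist_sym)
    with that show ?thesis by simp
  qed
  have "(ARG_MIN ?d v. minimal_distance n E v) = c"
  proof (rule unique)
    show "minimal_distance n E (ARG_MIN ?d v. minimal_distance n E v)"
      using arg_min_natI[of "minimal_distance n E" c ?d] c by simp
    show "?d (ARG_MIN ?d v. minimal_distance n E v) \<le> ?d c"
      using arg_min_nat_le[of "minimal_distance n E" c ?d] c by simp
  qed
  then show ?thesis using c by simp
qed

section \<open>Growing a plane increasing tree by one leaf\<close>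

text \<open>
  All forests that arise by inserting a leaf \<open>x\<close>. Every position is generated once: in front of the first
  tree, inside the forest below its root, or further to the right.
\<close>
function leaf_insertions :: "nat \<Rightarrow> plane_tree list \<Rightarrow> plane_tree list list" where
  "leaf_insertions x [] = [[Node x []]]"
| "leaf_insertions x (Node a us # ts) =
     (Node x [] # Node a us # ts)
     # map (\<lambda>us'. Node a us' # ts) (leaf_insertions x us)
     @ map (\<lambda>ts'. Node a us # ts') (leaf_insertions x ts)"
  by pat_completeness auto
termination
  by (relation "Wellfounded.measure (\<lambda>(x, ts). size_list size ts)") auto

text \<open>
  A left inverse of the insertion of a leaf, which shows that different forests have disjoint sets of
  insertions.
\<close>
fun delete_node :: "nat \<Rightarrow> plane_tree list \<Rightarrow> plane_tree list" where
  "delete_node x [] = []"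
| "delete_node x (Node a us # ts) =
     (if a = x then ts else Node a (delete_node x us) # delete_node x ts)"

abbreviation forest_labels :: "plane_tree list \<Rightarrow> nat list" where
  "forest_labels ts \<equiv> concat (map labels ts)"

lemma forest_cases [case_names Nil Cons]:
  obtains "ts = []" | a us ts' where "ts = Node a us # ts'"
  by (cases ts) (simp, metis plane_tree.exhaust)

text \<open>
  Plane forests viewed as binary trees by the first-child next-sibling encoding.
\<close>
lemma forest_induct [case_names Nil Cons]:
  assumes "P []" and "\<And>a us ts. P us \<Longrightarrow> P ts \<Longrightarrow> P (Node a us # ts)"
  shows "P ts"
  by (rule leaf_insertions.induct[of "\<lambda>_. P" 0 ts]) (use assms in auto)

lemma labels_neq_Nil [simp]: "labels t \<noteq> []"
  by (cases t) auto

lemma delete_node_absent: "x \<notin> set (forest_labels ts) \<Longrightarrow> delete_node x ts = ts"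
  by (induction x ts rule: delete_node.induct) auto

lemma mset_labels_leaf_insertions:
  "ts' \<in> set (leaf_insertions x ts) \<Longrightarrow>
     mset (forest_labels ts') = add_mset x (mset (forest_labels ts))"
  by (induction x ts arbitrary: ts' rule: leaf_insertions.induct) auto

lemma set_labels_leaf_insertions:
  "ts' \<in> set (leaf_insertions x ts) \<Longrightarrow>
     set (forest_labels ts') = insert x (set (forest_labels ts))"
  using mset_labels_leaf_insertions[of ts' x ts]
  by (metis set_mset_mset set_mset_add_mset_insert)

lemma delete_node_leaf_insertions:
  "x \<notin> set (forest_labels ts) \<Longrightarrow> ts' \<in> set (leaf_insertions x ts) \<Longrightarrow> delete_node x ts' = ts"
  by (induction x ts arbitrary: ts' rule: leaf_insertions.induct)
     (auto simp: delete_node_absent)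

lemma distinct_leaf_insertions:
  "x \<notin> set (forest_labels ts) \<Longrightarrow> distinct (leaf_insertions x ts)"
proof (induction x ts rule: leaf_insertions.induct)
  case (2 x a us ts)
  have "us \<notin> set (leaf_insertions x us)"
    using set_labels_leaf_insertions[of us x us] 2 by auto
  then show ?case
    using 2 by (auto simp: distinct_map inj_on_def)
qed simp

definition increasing_below :: "nat \<Rightarrow> plane_tree list \<Rightarrow> bool" where
  "increasing_below a ts \<longleftrightarrow> (\<forall>t\<in>set ts. a < root t \<and> increasing t)"

lemma increasing_below_simps [simp]:
  "increasing_below b []"
  "increasing_below b (Node a us # ts) \<longleftrightarrow> b < a \<and> increasing_below a us \<and> increasing_below b ts"
  by (auto simp: increasing_below_def)

lemma increasing_Node: "increasing (Node a ts) \<longleftrightarrow> increasing_below a ts"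
  by (simp add: increasing_below_def)

lemma increasing_below_labels:
  "increasing_below a ts \<Longrightarrow> y \<in> set (forest_labels ts) \<Longrightarrow> a < y"
proof (induction ts arbitrary: a rule: forest_induct)
  case (Cons b us ts)
  then have "y = b \<or> y \<in> set (forest_labels us) \<or> y \<in> set (forest_labels ts)"
    and "a < b" "increasing_below b us" "increasing_below a ts" by auto
  then show ?case using Cons.IH[of b] Cons.IH[of a] by (meson less_trans)
qed simp

text \<open>
  A new leaf whose label exceeds all others neither destroys nor creates violations of the order.
\<close>
lemma increasing_below_leaf_insertions:
  "ts' \<in> set (leaf_insertions x ts) \<Longrightarrow> \<forall>y\<in>set (forest_labels ts). y < x \<Longrightarrow> a < x \<Longrightarrow>
     increasing_below a ts' \<longleftrightarrow> increasing_below a ts"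
proof (induction x ts arbitrary: ts' a rule: leaf_insertions.induct)
  case (2 x b us ts)
  then show ?case by auto
qed auto

text \<open>
  The node with the largest label of an increasing forest is a leaf, so it can be removed.
\<close>
lemma leaf_insertions_exhaust:
  assumes "increasing_below a ts'" "distinct (forest_labels ts')"
    and "x \<in> set (forest_labels ts')" "\<forall>y\<in>set (forest_labels ts'). y \<le> x"
  shows "\<exists>ts. ts' \<in> set (leaf_insertions x ts)"
  using assms
proof (induction x ts' arbitrary: a rule: delete_node.induct)
  case (2 x b us ts)
  show ?case
  proof (cases "b = x")
    case True
    have "us = []"
    proof (rule ccontr)
      assume "us \<noteq> []"
      then obtain t where "t \<in> set us" by (cases us) auto
      then have "hd (labels t) \<in> set (forest_labels us)" by (auto intro!: bexI[of _ t])
      then obtain y where "y \<in> set (forest_labels us)" ..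
      then show False
        using 2(3,6) True increasing_below_labels[of b us y] by (auto dest!: bspec[of _ _ y])
    qed
    then have "Node b us # ts \<in> set (leaf_insertions x ts)"
      using True by (cases ts rule: forest_cases) auto
    then show ?thesis by blast
  next
    case False
    consider "x \<in> set (forest_labels us)" | "x \<in> set (forest_labels ts)"
      using False 2(5) by auto
    then show ?thesis
    proof cases
      case 1
      then obtain us0 where "us \<in> set (leaf_insertions x us0)"
        using 2(1)[OF False, of b] 2(3-6) by auto
      then have "Node b us # ts \<in> set (leaf_insertions x (Node b us0 # ts))" by simp
      then show ?thesis by blast
    next
      case 2
      then obtain ts0 where "ts \<in> set (leaf_insertions x ts0)"
        using "2.IH"(2)[OF False, of a] "2.prems" by auto
      then have "Node b us # ts \<in> set (leaf_insertions x (Node b us # ts0))" by simp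
      then show ?thesis by blast
    qed
  qed
qed simp

definition tree_insertions :: "nat \<Rightarrow> plane_tree \<Rightarrow> plane_tree list" where
  "tree_insertions x T = map (Node (root T)) (leaf_insertions x (subtrees T))"

lemma labels_tree_insertions:
  "T' \<in> set (tree_insertions x T) \<Longrightarrow> mset (labels T') = add_mset x (mset (labels T))"
  by (cases T) (auto simp: tree_insertions_def dest: mset_labels_leaf_insertions)

lemma increasing_trees_1: "increasing_trees (Suc 0) = {Node 1 []}"
proof -
  have "T = Node 1 []" if "distinct (labels T)" "set (labels T) = {1}" for T
  proof (cases T)
    case (Node a ts)
    have "length (labels T) = 1"
      using that distinct_card[of "labels T"] by simp
    then have "forest_labels ts = []" using Node by simp
    then show ?thesis using Node that by (cases ts) auto
  qed
  then show ?thesis by (auto simp: increasing_trees_def)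
qed

lemma increasing_trees_Suc:
  assumes "n \<ge> 1"
  shows "increasing_trees (Suc n) = (\<Union>T\<in>increasing_trees n. set (tree_insertions (Suc n) T))"
proof (intro equalityI subsetI)
  fix T' assume T': "T' \<in> increasing_trees (Suc n)"
  obtain a ts' where eq: "T' = Node a ts'" by (cases T')
  have inc: "increasing_below a ts'" and dist: "distinct (a # forest_labels ts')"
    and lab: "insert a (set (forest_labels ts')) = {1..Suc n}"
    using T' by (auto simp: increasing_trees_def eq increasing_Node simp del: increasing.simps)
  have "a \<noteq> Suc n"
  proof
    assume a: "a = Suc n"
    have "1 \<in> insert a (set (forest_labels ts'))" using lab by auto
    with a assms have "a < 1" using increasing_below_labels[OF inc, of 1] by auto
    then show False using a by simp
  qed
  with lab have x: "Suc n \<in> set (forest_labels ts')" 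
    by (metis (no_types) atLeastAtMost_iff insertE le_add1 le_refl plus_1_eq_Suc)
  have "\<forall>y\<in>insert a (set (forest_labels ts')). y \<le> Suc n" unfolding lab by simp
  then have "\<forall>y\<in>set (forest_labels ts'). y \<le> Suc n" by blast
  with x inc dist obtain ts where ts: "ts' \<in> set (leaf_insertions (Suc n) ts)"
    using leaf_insertions_exhaust[of a ts' "Suc n"] by auto
  have m: "mset (forest_labels ts') = add_mset (Suc n) (mset (forest_labels ts))"
    using ts by (rule mset_labels_leaf_insertions)
  have d: "Suc n \<notin> set (forest_labels ts) \<and> distinct (forest_labels ts)"
    using m dist mset_eq_imp_distinct_iff[of "forest_labels ts'" "Suc n # forest_labels ts"] by simp
  have s: "set (forest_labels ts') = insert (Suc n) (set (forest_labels ts))"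
    using ts by (rule set_labels_leaf_insertions)
  have "{1..Suc n} = insert (Suc n) {1..n}" by auto
  then have l: "insert a (set (forest_labels ts)) = {1..n}"
    using lab[unfolded s] d \<open>a \<noteq> Suc n\<close> by (auto simp del: set_concat)
  have "\<forall>y\<in>insert a (set (forest_labels ts)). y < Suc n" unfolding l by simp
  then have "\<forall>y\<in>set (forest_labels ts). y < Suc n" and "a < Suc n" by blast+
  then have "increasing_below a ts"
    using increasing_below_leaf_insertions[OF ts] inc by blast
  then have "Node a ts \<in> increasing_trees n"
    using d l s dist by (auto simp: increasing_trees_def increasing_Node simp del: increasing.simps)
  moreover have "T' \<in> set (tree_insertions (Suc n) (Node a ts))"
    using ts by (simp add: tree_insertions_def eq)
  ultimately show "T' \<in> (\<Union>T\<in>increasing_trees n. set (tree_insertions (Suc n) T))" by blast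
next
  fix T' assume "T' \<in> (\<Union>T\<in>increasing_trees n. set (tree_insertions (Suc n) T))"
  then obtain T where T: "T \<in> increasing_trees n" and T': "T' \<in> set (tree_insertions (Suc n) T)" by blast
  have m: "mset (labels T') = mset (Suc n # labels T)"
    using labels_tree_insertions[OF T'] by simp
  obtain a ts where eq: "T = Node a ts" by (cases T)
  have "{1..Suc n} = insert (Suc n) {1..n}" by auto
  then have "distinct (labels T')" "set (labels T') = {1..Suc n}"
    using T mset_eq_imp_distinct_iff[OF m] mset_eq_setD[OF m]
    by (auto simp: increasing_trees_def)
  moreover have "increasing T'"
  proof -
    have "set (labels T) = {1..n}" using T by (simp add: increasing_trees_def)
    then have "insert a (set (forest_labels ts)) = {1..n}" by (simp add: eq)
    then have "\<forall>y\<in>insert a (set (forest_labels ts)). y < Suc n" by simp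
    then have "\<forall>y\<in>set (forest_labels ts). y < Suc n" "a < Suc n" by blast+
    then show ?thesis
      using T T' increasing_below_leaf_insertions
      by (auto simp: tree_insertions_def eq increasing_Node increasing_trees_def simp del: increasing.simps)
  qed
  ultimately show "T' \<in> increasing_trees (Suc n)" by (simp add: increasing_trees_def)
qed

lemma finite_increasing_trees: "n \<ge> 1 \<Longrightarrow> finite (increasing_trees n)"
  by (induction n rule: dec_induct) (auto simp: increasing_trees_1 increasing_trees_Suc)

lemma root_increasing_trees:
  assumes "T \<in> increasing_trees n" "n \<ge> 1"
  shows "root T = 1"
proof -
  obtain a ts where eq: "T = Node a ts" by (cases T)
  have inc: "increasing_below a ts" and lab: "insert a (set (forest_labels ts)) = {1..n}"
    using assms by (auto simp: increasing_trees_def eq increasing_Node simp del: increasing.simps)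
  have "1 \<in> insert a (set (forest_labels ts))" "a \<in> {1..n}"
    using lab assms(2) by (simp only: atLeastAtMost_iff, simp) (use lab in blast)
  then show ?thesis using increasing_below_labels[OF inc, of 1] by (auto simp: eq)
qed

lemma sum_increasing_trees_Suc:
  fixes F :: "plane_tree \<Rightarrow> real"
  assumes "n \<ge> 1"
  shows "(\<Sum>T\<in>increasing_trees (Suc n). F T) =
           (\<Sum>T\<in>increasing_trees n. sum_list (map F (tree_insertions (Suc n) T)))"
proof -
  have absent: "Suc n \<notin> set (forest_labels (subtrees T))" if "T \<in> increasing_trees n" for T
  proof -
    have "Suc n \<notin> set (labels T)" using that by (simp add: increasing_trees_def)
    then show ?thesis by (cases T) simp
  qed
  have "set (tree_insertions (Suc n) T) \<inter> set (tree_insertions (Suc n) T') = {}"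
    if "T \<in> increasing_trees n" "T' \<in> increasing_trees n" "T \<noteq> T'" for T T'
  proof -
    have "T = T'" if "Node (root T) us = Node (root T') us'" "us \<in> set (leaf_insertions (Suc n) (subtrees T))"
      "us' \<in> set (leaf_insertions (Suc n) (subtrees T'))" for us us'
      using that delete_node_leaf_insertions[OF absent] \<open>T \<in> _\<close> \<open>T' \<in> _\<close>
      by (metis plane_tree.expand plane_tree.inject)
    then show ?thesis using that by (auto simp: tree_insertions_def)
  qed
  note disjoint = this
  have "(\<Sum>T\<in>increasing_trees (Suc n). F T) =
      (\<Sum>T\<in>increasing_trees n. \<Sum>T'\<in>set (tree_insertions (Suc n) T). F T')"
    unfolding increasing_trees_Suc[OF assms]
    by (rule sum.UNION_disjoint) (use disjoint finite_increasing_trees[OF assms] in auto)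
  also have "\<dots> = (\<Sum>T\<in>increasing_trees n. sum_list (map F (tree_insertions (Suc n) T)))"
  proof (rule sum.cong[OF refl])
    fix T assume "T \<in> increasing_trees n"
    then have "distinct (tree_insertions (Suc n) T)"
      using distinct_leaf_insertions[OF absent] by (auto simp: tree_insertions_def distinct_map inj_on_def)
    then show "(\<Sum>T'\<in>set (tree_insertions (Suc n) T). F T') = sum_list (map F (tree_insertions (Suc n) T))"
      by (simp add: sum_list_distinct_conv_sum_set)
  qed
  finally show ?thesis .
qed

section \<open>The weight of all insertions of a leaf\<close>

abbreviation forest_edges :: "nat \<Rightarrow> plane_tree list \<Rightarrow> (nat \<times> nat) set" where
  "forest_edges b ts \<equiv> (\<Union>t\<in>set ts. insert (b, root t) (edges t))"

primrec outdegrees :: "plane_tree \<Rightarrow> (nat \<times> nat) list" where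
  "outdegrees (Node a ts) = (a, length ts) # concat (map outdegrees ts)"

text \<open>
  A node of outdegree \<open>k\<close> offers \<open>k + 1\<close> places for a new leaf, each of which replaces the factor \<open>\<phi>\<^sub>k\<close> by
  \<open>\<phi>\<^sub>k\<^sub>+\<^sub>1\<close>; by the recurrence for the weights, this amounts to the factor \<open>A - B * k\<close>. The roots of the
  forest are children of a node \<open>b\<close> outside of it; the weight of \<open>b\<close> is represented by an arbitrary function
  \<open>\<psi>\<close> of the number of trees, so that the induction can pass to the right and downwards.
\<close>
lemma sum_leaf_insertions:
  fixes \<phi> :: "real fps" and A B :: real
  assumes \<phi>0: "fps_nth \<phi> 0 = 1"
    and \<phi>_Suc: "\<And>k. real (Suc k) * fps_nth \<phi> (Suc k) = (A - B * real k) * fps_nth \<phi> k"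
  shows "(\<Sum>ts'\<leftarrow>leaf_insertions x ts. \<psi> (length ts') * prod_list (map (tree_weight \<phi>) ts') * F (forest_edges b ts')) =
    prod_list (map (tree_weight \<phi>) ts) *
      (real (Suc (length ts)) * \<psi> (Suc (length ts)) * F (insert (b, x) (forest_edges b ts)) +
       \<psi> (length ts) * (\<Sum>(v, k)\<leftarrow>concat (map outdegrees ts). (A - B * real k) * F (insert (v, x) (forest_edges b ts))))"
proof (induction x ts arbitrary: b F \<psi> rule: leaf_insertions.induct)
  case (1 x)
  then show ?case by (simp add: \<phi>0)
next
  case (2 x a us ts)
  define \<omega> where "\<omega> = (\<lambda>ts. prod_list (map (tree_weight \<phi>) ts))"
  define E1 where "E1 = forest_edges a us"
  define E2 where "E2 = forest_edges b ts"
  define E where "E = forest_edges b (Node a us # ts)"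
  have E: "E = insert (b, a) (E1 \<union> E2)" by (simp add: E_def E1_def E2_def)
  define S1 where "S1 = (\<Sum>(v, k)\<leftarrow>concat (map outdegrees us). (A - B * real k) * F (insert (v, x) E))"
  define S2 where "S2 = (\<Sum>(v, k)\<leftarrow>concat (map outdegrees ts). (A - B * real k) * F (insert (v, x) E))"
  let ?l = "length ts" and ?k = "length us"
  have front: "\<psi> (Suc (Suc ?l)) * \<omega> (Node x [] # Node a us # ts) * F (forest_edges b (Node x [] # Node a us # ts))
     = fps_nth \<phi> ?k * \<omega> us * \<omega> ts * \<psi> (Suc (Suc ?l)) * F (insert (b, x) E)"
    by (simp add: \<omega>_def \<phi>0 E_def insert_commute)
  have "(\<Sum>us'\<leftarrow>leaf_insertions x us. \<psi> (Suc ?l) * \<omega> (Node a us' # ts) * F (forest_edges b (Node a us' # ts)))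
     = (\<Sum>us'\<leftarrow>leaf_insertions x us. (\<psi> (Suc ?l) * \<omega> ts) * (fps_nth \<phi> (length us') * \<omega> us' * F (insert (b, a) (forest_edges a us' \<union> E2))))"
    by (simp add: \<omega>_def E2_def mult_ac)
  also have "\<dots> = (\<psi> (Suc ?l) * \<omega> ts) * (\<Sum>us'\<leftarrow>leaf_insertions x us. fps_nth \<phi> (length us') * \<omega> us' * F (insert (b, a) (forest_edges a us' \<union> E2)))"
    by (rule sum_list_const_mult)
  also have "(\<Sum>us'\<leftarrow>leaf_insertions x us. fps_nth \<phi> (length us') * \<omega> us' * F (insert (b, a) (forest_edges a us' \<union> E2)))
     = \<omega> us * (real (Suc ?k) * fps_nth \<phi> (Suc ?k) * F (insert (a, x) E) + fps_nth \<phi> ?k * S1)"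
    using "2.IH"(1)[of "fps_nth \<phi>" "\<lambda>E. F (insert (b, a) (E \<union> E2))" a]
    by (simp add: \<omega>_def S1_def E E1_def insert_commute)
  also have "\<dots> = \<omega> us * fps_nth \<phi> ?k * ((A - B * real ?k) * F (insert (a, x) E) + S1)"
    unfolding \<phi>_Suc by (simp add: algebra_simps)
  finally have middle: "(\<Sum>us'\<leftarrow>leaf_insertions x us. \<psi> (Suc ?l) * \<omega> (Node a us' # ts) * F (forest_edges b (Node a us' # ts)))
     = \<psi> (Suc ?l) * \<omega> ts * (\<omega> us * fps_nth \<phi> ?k * ((A - B * real ?k) * F (insert (a, x) E) + S1))" .
  have "(\<Sum>ts'\<leftarrow>leaf_insertions x ts. \<psi> (Suc (length ts')) * \<omega> (Node a us # ts') * F (forest_edges b (Node a us # ts')))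
     = (\<Sum>ts'\<leftarrow>leaf_insertions x ts. (fps_nth \<phi> ?k * \<omega> us) * (\<psi> (Suc (length ts')) * \<omega> ts' * F (insert (b, a) (E1 \<union> forest_edges b ts'))))"
    by (simp add: \<omega>_def E1_def mult_ac)
  also have "\<dots> = (fps_nth \<phi> ?k * \<omega> us) * (\<Sum>ts'\<leftarrow>leaf_insertions x ts. \<psi> (Suc (length ts')) * \<omega> ts' * F (insert (b, a) (E1 \<union> forest_edges b ts')))"
    by (rule sum_list_const_mult)
  also have "(\<Sum>ts'\<leftarrow>leaf_insertions x ts. \<psi> (Suc (length ts')) * \<omega> ts' * F (insert (b, a) (E1 \<union> forest_edges b ts')))
     = \<omega> ts * (real (Suc ?l) * \<psi> (Suc (Suc ?l)) * F (insert (b, x) E) + \<psi> (Suc ?l) * S2)"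
    using "2.IH"(2)[of "\<lambda>l. \<psi> (Suc l)" "\<lambda>E. F (insert (b, a) (E1 \<union> E))" b]
    by (simp add: \<omega>_def S2_def E E2_def insert_commute)
  finally have right: "(\<Sum>ts'\<leftarrow>leaf_insertions x ts. \<psi> (Suc (length ts')) * \<omega> (Node a us # ts') * F (forest_edges b (Node a us # ts')))
     = fps_nth \<phi> ?k * \<omega> us * (\<omega> ts * (real (Suc ?l) * \<psi> (Suc (Suc ?l)) * F (insert (b, x) E) + \<psi> (Suc ?l) * S2))" .
  have "(\<Sum>ts'\<leftarrow>leaf_insertions x (Node a us # ts). \<psi> (length ts') * \<omega> ts' * F (forest_edges b ts'))
     = \<psi> (Suc (Suc ?l)) * \<omega> (Node x [] # Node a us # ts) * F (forest_edges b (Node x [] # Node a us # ts))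
      + (\<Sum>us'\<leftarrow>leaf_insertions x us. \<psi> (Suc ?l) * \<omega> (Node a us' # ts) * F (forest_edges b (Node a us' # ts)))
      + (\<Sum>ts'\<leftarrow>leaf_insertions x ts. \<psi> (Suc (length ts')) * \<omega> (Node a us # ts') * F (forest_edges b (Node a us # ts')))"
    by (simp add: comp_def add_ac)
  also have "\<dots> = \<omega> (Node a us # ts) * (real (Suc (Suc ?l)) * \<psi> (Suc (Suc ?l)) * F (insert (b, x) E)
      + \<psi> (Suc ?l) * ((A - B * real ?k) * F (insert (a, x) E) + S1 + S2))"
    unfolding front middle right by (simp add: \<omega>_def algebra_simps)
  finally show ?case unfolding \<omega>_def E_def S1_def S2_def by simp
qed

lemma sum_tree_insertions:
  fixes \<phi> :: "real fps" and A B :: real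
  assumes "fps_nth \<phi> 0 = 1"
    and Suc: "\<And>k. real (Suc k) * fps_nth \<phi> (Suc k) = (A - B * real k) * fps_nth \<phi> k"
  shows "(\<Sum>T'\<leftarrow>tree_insertions x T. tree_weight \<phi> T' * F (edges T')) =
    tree_weight \<phi> T * (\<Sum>(v, k)\<leftarrow>outdegrees T. (A - B * real k) * F (insert (v, x) (edges T)))"
proof (cases T)
  case (Node a ts)
  show ?thesis
    using sum_leaf_insertions[OF assms, where \<psi> = "fps_nth \<phi>" and b = a and x = x and ts = ts and F = F]
    unfolding Suc by (simp add: Node tree_insertions_def comp_def algebra_simps)
qed

text \<open>
  The sources of edges are labels, so disjoint subtrees do not contribute to each other's outdegrees.
\<close>
lemma fst_edges: "(u, v) \<in> edges T \<Longrightarrow> u \<in> set (labels T)"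
proof (induction T)
  case (Node a ts)
  then show ?case by auto
qed

lemma root_in_labels [simp]: "root t \<in> set (labels t)"
  by (cases t) auto

lemma card_roots: "distinct (forest_labels ts) \<Longrightarrow> card (root ` set ts) = length ts"
proof -
  assume "distinct (forest_labels ts)"
  then have "distinct (map root ts)"
    by (induction ts) (auto, metis IntI UN_I empty_iff root_in_labels)
  then show ?thesis using distinct_card[of "map root ts"] by simp
qed

lemma forest_outdegrees:
  assumes "distinct (b # forest_labels ts)"
  shows "forest_edges b ts `` {b} = root ` set ts \<and> 
    concat (map outdegrees ts) = map (\<lambda>v. (v, outdegree (forest_edges b ts) v)) (forest_labels ts)"
  using assms
proof (induction ts arbitrary: b rule: forest_induct)
  case (Cons a us ts)
  let ?E1 = "forest_edges a us" and ?E2 = "forest_edges b ts"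
  let ?E = "forest_edges b (Node a us # ts)"
  have E: "?E = insert (b, a) (?E1 \<union> ?E2)" by simp
  note d = Cons.prems
  have src: "u = c \<or> u \<in> set (forest_labels ws)" if "(u, v) \<in> forest_edges c ws" for u v c ws
    using that fst_edges[of u v] by auto
  have a: "a \<noteq> b" "a \<notin> set (forest_labels ts)" "a \<notin> set (forest_labels us)"
    "b \<notin> set (forest_labels us)" "b \<notin> set (forest_labels ts)"
    "set (forest_labels us) \<inter> set (forest_labels ts) = {}"
    using d by auto
  have "?E `` {b} = root ` set (Node a us # ts)"
    using Cons.IH(2)[of b] d src[of b _ a us] a unfolding E by auto
  moreover have "?E `` {v} = ?E1 `` {v}" if "v = a \<or> v \<in> set (forest_labels us)" for v
    using that src[of v _ b ts] a unfolding E by blast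
  moreover have "?E `` {v} = ?E2 `` {v}" if "v \<in> set (forest_labels ts)" for v
    using that src[of v _ a us] a unfolding E by blast
  ultimately show ?case
    using Cons.IH(1)[of a] Cons.IH(2)[of b] d a card_roots[of us] unfolding outdegree_def
    by (auto simp del: UN_insert)
qed simp

text \<open>
  This transfers the insertion of a leaf to the edge sets.
\<close>
lemma forest_edges_leaf_insertions:
  "ts' \<in> set (leaf_insertions x ts) \<Longrightarrow>
     \<exists>v\<in>insert b (set (forest_labels ts)). forest_edges b ts' = insert (v, x) (forest_edges b ts)"
proof (induction x ts arbitrary: ts' b rule: leaf_insertions.induct)
  case (2 x a us ts)
  from "2.prems" consider "ts' = Node x [] # Node a us # ts"
    | us' where "us' \<in> set (leaf_insertions x us)" "ts' = Node a us' # ts"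
    | ts'' where "ts'' \<in> set (leaf_insertions x ts)" "ts' = Node a us # ts''"
    by auto
  then show ?case
  proof cases
    case 1
    then show ?thesis by auto
  next
    case (2 us')
    then obtain v where v: "v \<in> insert a (set (forest_labels us))"
      "forest_edges a us' = insert (v, x) (forest_edges a us)"
      using "2.IH"(1)[of us' a] by blast
    have "forest_edges b ts' = insert (v, x) (forest_edges b (Node a us # ts))"
      using v(2) by (simp add: 2(2) insert_commute)
    then show ?thesis using v(1) by (intro bexI[of _ v]) auto
  next
    case (3 ts'')
    then obtain v where v: "v \<in> insert b (set (forest_labels ts))"
      "forest_edges b ts'' = insert (v, x) (forest_edges b ts)"
      using "2.IH"(2)[of ts'' b] by blast
    have "forest_edges b ts' = insert (v, x) (forest_edges b (Node a us # ts))"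
      using v(2) by (simp add: 3(2) insert_commute)
    then show ?thesis using v(1) by (intro bexI[of _ v]) auto
  qed
qed auto

lemma recursive_tree_edges:
  assumes "n \<ge> 1" "T \<in> increasing_trees n"
  shows "recursive_tree n (edges T)"
  using assms
proof (induction n arbitrary: T rule: dec_induct)
  case base
  then show ?case by (auto simp: increasing_trees_1 intro: recursive_tree.single)
next
  case (step n)
  then obtain T0 where T0: "T0 \<in> increasing_trees n" "T \<in> set (tree_insertions (Suc n) T0)"
    unfolding increasing_trees_Suc[OF step(1)] by blast
  obtain a ts where eq: "T0 = Node a ts" by (cases T0)
  obtain ts' where ts': "T = Node a ts'" "ts' \<in> set (leaf_insertions (Suc n) ts)"
    using T0(2) by (auto simp: tree_insertions_def eq)
  obtain v where v: "v \<in> insert a (set (forest_labels ts))"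
    "forest_edges a ts' = insert (v, Suc n) (forest_edges a ts)"
    using forest_edges_leaf_insertions[OF ts'(2)] by blast
  have "set (labels T0) = {1..n}" using T0(1) by (simp add: increasing_trees_def)
  then have "v \<in> {1..n}" using v(1) by (simp add: eq)
  moreover have "edges T = insert (v, Suc n) (edges T0)" using v(2) by (simp add: ts'(1) eq)
  ultimately show ?case using recursive_tree.grow[OF step.IH[OF T0(1)]] by simp
qed

lemma outdegrees_eq:
  assumes "distinct (labels T)"
  shows "outdegrees T = map (\<lambda>v. (v, outdegree (edges T) v)) (labels T)"
proof -
  obtain a ts where eq: "T = Node a ts" by (cases T)
  have d: "distinct (a # forest_labels ts)" using assms by (simp add: eq)
  have "outdegree (forest_edges a ts) a = length ts"
    using forest_outdegrees[OF d] card_roots[of ts] d by (simp add: outdegree_def)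
  then show ?thesis using forest_outdegrees[OF d] by (simp add: eq)
qed

text \<open>
  Every tree is classified by what remains when its largest label is removed. This is one step of the
  growth process before normalisation.
\<close>
lemma weighted_sum_Suc:
  fixes \<phi> :: "real fps"
  assumes n: "n \<ge> 1" and \<phi>: "fps_nth \<phi> 0 = 1"
    "\<And>k. real (Suc k) * fps_nth \<phi> (Suc k) = (A - B * real k) * fps_nth \<phi> k"
  shows "(\<Sum>T\<in>increasing_trees (Suc n). tree_weight \<phi> T * F (edges T)) =
    (\<Sum>T\<in>increasing_trees n. tree_weight \<phi> T *
       (\<Sum>v\<in>{1..n}. (A - B * real (outdegree (edges T) v)) * F (insert (v, Suc n) (edges T))))"
  unfolding sum_increasing_trees_Suc[OF n]
proof (rule sum.cong[OF refl])
  fix T assume T: "T \<in> increasing_trees n"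
  then have d: "distinct (labels T)" "set (labels T) = {1..n}" by (auto simp: increasing_trees_def)
  have "(\<Sum>(v, k)\<leftarrow>outdegrees T. (A - B * real k) * F (insert (v, Suc n) (edges T))) =
     (\<Sum>v\<leftarrow>labels T. (A - B * real (outdegree (edges T) v)) * F (insert (v, Suc n) (edges T)))"
    unfolding outdegrees_eq[OF d(1)] by (simp add: comp_def)
  also have "\<dots> = (\<Sum>v\<in>{1..n}. (A - B * real (outdegree (edges T) v)) * F (insert (v, Suc n) (edges T)))"
    using sum_list_distinct_conv_sum_set[OF d(1)] d(2) by simp
  finally show "(\<Sum>T'\<leftarrow>tree_insertions (Suc n) T. tree_weight \<phi> T' * F (edges T')) = tree_weight \<phi> T *
       (\<Sum>v\<in>{1..n}. (A - B * real (outdegree (edges T) v)) * F (insert (v, Suc n) (edges T)))"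
    using sum_tree_insertions[OF \<phi>, where x = "Suc n" and T = T and F = F] by simp
qed

section \<open>Asymptotics, falling factorials and the beta integral\<close>

text \<open>
  The absorption identity reduces \<open>Suc k\<close> to \<open>k\<close>, at the price of a factor that tends to \<open>c / Suc k\<close>.
\<close>
lemma binomial_over_power_tendsto:
  assumes "(\<lambda>n. real (m n) / real n) \<longlonglongrightarrow> c"
  shows "(\<lambda>n. real (m n choose k) / real n ^ k) \<longlonglongrightarrow> c ^ k / fact k"
proof (induction k)
  case (Suc k)
  have "real (m choose Suc k) = (real m - real k) * real (m choose k) / real (Suc k)" for m
  proof -
    have "Suc k * (m choose Suc k) = (m - k) * (m choose k)"
      using binomial_absorption[of k m] binomial_absorb_comp[of m k] by simp
    then have "real (Suc k) * real (m choose Suc k) = real (m - k) * real (m choose k)"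
      by (simp only: of_nat_mult[symmetric])
    also have "\<dots> = (real m - real k) * real (m choose k)"
      by (cases "k \<le> m") (auto simp: of_nat_diff)
    finally show ?thesis by (simp add: field_simps del: of_nat_Suc)
  qed
  then have "real (m n choose Suc k) / real n ^ Suc k =
      (real (m n) / real n - real k / real n) * (real (m n choose k) / real n ^ k) / real (Suc k)" for n
    by (simp add: diff_divide_distrib[symmetric] mult_ac del: of_nat_Suc)
  moreover have "(\<lambda>n. (real (m n) / real n - real k / real n) * (real (m n choose k) / real n ^ k) / real (Suc k))
     \<longlonglongrightarrow> (c - 0) * (c ^ k / fact k) / real (Suc k)"
    by (intro tendsto_intros assms Suc lim_const_over_n) auto
  ultimately show ?case by (simp add: mult_ac del: of_nat_Suc)
qed simp

lemma half_over_tendsto: "(\<lambda>n. real (n div 2) / real n) \<longlonglongrightarrow> 1 / 2"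
proof (rule tendsto_sandwich)
  show "\<forall>\<^sub>F n in sequentially. 1 / 2 - 1 / real n \<le> real (n div 2) / real n"
    using eventually_gt_at_top[of 0]
  proof eventually_elim
    case (elim n)
    have "real n - 2 \<le> 2 * real (n div 2)" by linarith
    then have "(real n - 2) / (2 * real n) \<le> 2 * real (n div 2) / (2 * real n)"
      by (intro divide_right_mono) auto
    with elim show ?case by (simp add: diff_divide_distrib)
  qed
  show "\<forall>\<^sub>F n in sequentially. real (n div 2) / real n \<le> 1 / 2"
    using eventually_gt_at_top[of 0]
  proof eventually_elim
    case (elim n)
    have "2 * real (n div 2) \<le> real n" by linarith
    with elim show ?case by (simp add: field_simps)
  qed
  show "(\<lambda>n. 1 / 2 - 1 / real n) \<longlonglongrightarrow> 1 / 2" by real_asymp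
qed simp

text \<open>
  The quotient \<open>pochhammer \<alpha> n / fact n\<close> grows like a constant times \<open>n powr (\<alpha> - 1)\<close>.
\<close>
lemma pochhammer_ratio_tendsto:
  fixes \<alpha> :: real
  assumes \<alpha>_pos: "\<alpha> > 0"
  shows "(\<lambda>n. (pochhammer \<alpha> (n div 2) / fact (n div 2)) / (pochhammer \<alpha> (n - 1) / fact (n - 1))) \<longlonglongrightarrow> 2 * (1 / 2) powr \<alpha>"
proof -
  have G: "Gamma \<alpha> \<noteq> 0" using Gamma_real_pos[OF \<alpha>_pos] by (metis less_irrefl)
  have h: "filterlim (\<lambda>n::nat. n div 2) at_top sequentially"
    unfolding filterlim_at_top
  proof
    fix Z :: nat
    show "\<forall>\<^sub>F n in sequentially. Z \<le> n div 2"
      using eventually_ge_at_top[of "2 * Z"] by eventually_elim linarith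
  qed
  have n1: "filterlim (\<lambda>n::nat. n - 1) at_top sequentially" by (rule filterlim_minus_const_nat_at_top)
  \<comment> \<open>Euler's limit formula for the gamma function; the limit cancels in the quotient.\<close>
  have eq: "pochhammer \<alpha> n / fact n = real n powr \<alpha> / (Gamma_series \<alpha> n * (\<alpha> + real n))" if "n > 0" for n
  proof -
    have "pochhammer \<alpha> n > 0" by (rule pochhammer_pos[OF \<alpha>_pos])
    have pos: "real n powr \<alpha> > 0" "\<alpha> + real n > 0" using that \<alpha>_pos by auto
    have G: "Gamma_series \<alpha> n = fact n * real n powr \<alpha> / (pochhammer \<alpha> n * (\<alpha> + real n))"
      using that by (simp add: Gamma_series_def powr_def pochhammer_Suc mult.commute)
    have "p / f = x / (f * x / (p * d) * d)" if "p > 0" "f > 0" "x > 0" "d > 0" for p f x d :: real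
      using that by (simp add: field_simps)
    from this[OF \<open>pochhammer \<alpha> n > 0\<close> fact_gt_zero pos] show ?thesis unfolding G .
  qed
  have r: "(\<lambda>n. real (n div 2) / real (n - 1)) \<longlonglongrightarrow> 1 / 2"
  proof -
    have "(\<lambda>n. real (n div 2) / real n * (real n / real (n - 1))) \<longlonglongrightarrow> 1 / 2 * 1"
    proof (intro tendsto_mult half_over_tendsto)
      show "(\<lambda>n. real n / real (n - 1)) \<longlonglongrightarrow> 1" by real_asymp
    qed
    moreover have "\<forall>\<^sub>F n in sequentially. real (n div 2) / real n * (real n / real (n - 1)) = real (n div 2) / real (n - 1)"
      using eventually_gt_at_top[of 0] by eventually_elim simp
    ultimately show ?thesis using Lim_transform_eventually by fastforce
  qed
  have r': "(\<lambda>n. (\<alpha> + real (n - 1)) / (\<alpha> + real (n div 2))) \<longlonglongrightarrow> 2"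
  proof -
    have "(\<lambda>n. (\<alpha> / real n + real (n - 1) / real n) / (\<alpha> / real n + real (n div 2) / real n)) \<longlonglongrightarrow> (0 + 1) / (0 + 1 / 2)"
    proof -
      have "(\<lambda>n. real (n - 1) / real n) \<longlonglongrightarrow> 1" by real_asymp
      from tendsto_divide[OF tendsto_add[OF lim_const_over_n this] tendsto_add[OF lim_const_over_n half_over_tendsto]]
      show ?thesis by simp
    qed
    moreover have "\<forall>\<^sub>F n in sequentially. (\<alpha> / real n + real (n - 1) / real n) / (\<alpha> / real n + real (n div 2) / real n)
        = (\<alpha> + real (n - 1)) / (\<alpha> + real (n div 2))"
      using eventually_gt_at_top[of 0] by eventually_elim (simp add: add_divide_distrib[symmetric])
    ultimately show ?thesis by (simp add: tendsto_cong)
  qed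
  have lim: "(\<lambda>n. (real (n div 2) / real (n - 1)) powr \<alpha> * (Gamma_series \<alpha> (n - 1) / Gamma_series \<alpha> (n div 2)) *
       ((\<alpha> + real (n - 1)) / (\<alpha> + real (n div 2)))) \<longlonglongrightarrow> (1 / 2) powr \<alpha> * (Gamma \<alpha> / Gamma \<alpha>) * 2"
    by (rule tendsto_mult[OF tendsto_mult[OF tendsto_powr[OF r tendsto_const]
          tendsto_divide[OF filterlim_compose[OF Gamma_series_LIMSEQ n1] filterlim_compose[OF Gamma_series_LIMSEQ h] G]] r']) simp
  have "\<forall>\<^sub>F n in sequentially. (pochhammer \<alpha> (n div 2) / fact (n div 2)) / (pochhammer \<alpha> (n - 1) / fact (n - 1)) =
     (real (n div 2) / real (n - 1)) powr \<alpha> * (Gamma_series \<alpha> (n - 1) / Gamma_series \<alpha> (n div 2)) *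
       ((\<alpha> + real (n - 1)) / (\<alpha> + real (n div 2)))"
    using eventually_gt_at_top[of 1]
  proof eventually_elim
    case (elim n)
    have "n div 2 > 0" "n - 1 > 0" using elim by auto
    then show ?case by (simp add: eq powr_divide mult_ac)
  qed
  then have ev: "\<forall>\<^sub>F n in sequentially. (real (n div 2) / real (n - 1)) powr \<alpha> * (Gamma_series \<alpha> (n - 1) / Gamma_series \<alpha> (n div 2)) *
       ((\<alpha> + real (n - 1)) / (\<alpha> + real (n div 2))) = (pochhammer \<alpha> (n div 2) / fact (n div 2)) / (pochhammer \<alpha> (n - 1) / fact (n - 1))"
    by (rule eventually_mono) (rule sym)
  from Lim_transform_eventually[OF lim ev] G show ?thesis by (simp add: mult.commute)
qed

lemma two_powr_minus: "2 powr (- (x + real k)) = (1 / 2) powr x * (1 / 2 :: real) ^ k"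
proof -
  have "2 powr (- y) = (1 / 2 :: real) powr y" for y
    by (simp add: powr_minus powr_divide inverse_eq_divide)
  then have "2 powr (- (x + real k)) = (1 / 2 :: real) powr (x + real k)" .
  also have "\<dots> = (1 / 2) powr x * (1 / 2) powr real k" by (rule powr_add)
  also have "(1 / 2 :: real) powr real k = (1 / 2) ^ k" by (rule powr_realpow) simp
  finally show ?thesis .
qed

lemma falling_factorial_Suc: "falling_factorial x (Suc m) = falling_factorial x m * (x - real m)"
  by (simp add: falling_factorial_def)

lemma falling_factorial_shift: "falling_factorial (x + 1) (Suc m) = (x + 1) * falling_factorial x m"
  unfolding falling_factorial_def prod.lessThan_Suc_shift by (simp add: comp_def algebra_simps)

lemma falling_factorial_plus_1:
  "falling_factorial (x + 1) (Suc m) = falling_factorial x (Suc m) + real (Suc m) * falling_factorial x m"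
  unfolding falling_factorial_shift unfolding falling_factorial_Suc by (simp add: algebra_simps)

lemma falling_factorial_of_nat_0: "k < m \<Longrightarrow> falling_factorial (real k) m = 0"
  by (auto simp: falling_factorial_def)

lemma falling_factorial_of_nat: "falling_factorial (real (k + m)) m = fact (k + m) / fact k"
proof (induction m)
  case (Suc m)
  have "falling_factorial (real (k + Suc m)) (Suc m) = falling_factorial (real (k + m) + 1) (Suc m)"
    by (simp add: algebra_simps)
  also have "\<dots> = (real (k + m) + 1) * (fact (k + m) / fact k)"
    unfolding falling_factorial_shift Suc ..
  finally show ?case by (simp add: algebra_simps)
qed (simp add: falling_factorial_def)

lemma falling_factorial_nonneg: "0 \<le> falling_factorial (real k) m"
proof (cases "k < m")
  case False
  then obtain j where "k = j + m" by (metis le_Suc_ex add.commute not_less)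
  then show ?thesis by (simp only: falling_factorial_of_nat) simp
qed (simp add: falling_factorial_of_nat_0)

lemma falling_factorial_le_power: "falling_factorial (real k) m \<le> real k ^ m"
proof (induction m)
  case (Suc m)
  show ?case
  proof (cases "k < Suc m")
    case False
    then have "falling_factorial (real k) m * (real k - real m) \<le> real k ^ m * real k"
      using Suc falling_factorial_nonneg[of k m] by (intro mult_mono) auto
    then show ?thesis by (simp add: falling_factorial_Suc mult.commute)
  qed (simp add: falling_factorial_of_nat_0)
qed (simp add: falling_factorial_def)

lemma summation_by_parts:
  fixes F T r :: "nat \<Rightarrow> real"
  assumes T: "\<And>k. T (Suc k) = T k - r k"
    and lim: "(\<lambda>k. F k * T k) \<longlonglongrightarrow> 0"
    and sums: "(\<lambda>k. F (Suc k) * r k) sums s"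
  shows "(\<lambda>k. (F (Suc k) - F k) * T k) sums (s - F 0 * T 0)"
proof -
  have "(\<lambda>k. F (Suc k) * T (Suc k) - F k * T k) sums (0 - F 0 * T 0)"
    by (rule telescope_sums[OF lim])
  from sums_add[OF sums this]
  have "(\<lambda>k. F (Suc k) * r k + (F (Suc k) * T (Suc k) - F k * T k)) sums (s - F 0 * T 0)" by simp
  moreover have "F (Suc k) * r k + (F (Suc k) * T (Suc k) - F k * T k) = (F (Suc k) - F k) * T k" for k
    by (simp add: T algebra_simps)
  ultimately show ?thesis by simp
qed

lemma sums_shift_1:
  fixes f :: "nat \<Rightarrow> real"
  assumes "(\<lambda>k. falling_factorial (real (Suc k)) (Suc m) * f k) sums s"
  shows "(\<lambda>k. falling_factorial (real k) (Suc m) * f (k - 1)) sums s"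
proof -
  have "(\<lambda>k. falling_factorial (real (Suc k)) (Suc m) * f (Suc k - 1)) sums s" using assms by simp
  then show ?thesis
    using sums_Suc_iff[of "\<lambda>k. falling_factorial (real k) (Suc m) * f (k - 1)" s] falling_factorial_of_nat_0[of 0 "Suc m"] by simp
qed

text \<open>
  The sum ranges over all indices, and a possible term with index \<open>0\<close> vanishes since \<open>1 / 0 = 0\<close>.
\<close>
definition harmonic_tail :: "nat \<Rightarrow> real" where
  "harmonic_tail k = (\<Sum>j. if k \<le> j then (1 / 2) ^ j / real j else 0)"

lemma summable_harmonic: "summable (\<lambda>j. if k \<le> j then (1 / 2) ^ j / real j else 0 :: real)"
proof (rule summable_comparison_test[OF exI[of _ 0]])
  show "summable (\<lambda>j. (1 / 2 :: real) ^ j)" by (rule summable_geometric) simp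
  show "\<forall>j\<ge>0. norm (if k \<le> j then (1 / 2) ^ j / real j else 0 :: real) \<le> (1 / 2) ^ j"
  proof (intro allI impI)
    fix j :: nat
    show "norm (if k \<le> j then (1 / 2) ^ j / real j else 0 :: real) \<le> (1 / 2) ^ j"
      by (cases j) (auto simp: divide_le_eq mult_le_cancel_left1)
  qed
qed

lemma harmonic_tail_Suc: "harmonic_tail (Suc k) = harmonic_tail k - (1 / 2) ^ k / real k"
proof -
  have "(\<lambda>j. (if k \<le> j then (1 / 2) ^ j / real j else 0) - (if j = k then (1 / 2) ^ k / real k else 0)) sums
     (harmonic_tail k - (1 / 2) ^ k / real k)"
    unfolding harmonic_tail_def by (intro sums_diff summable_sums summable_harmonic sums_single)
  moreover have "(if k \<le> j then (1 / 2) ^ j / real j else 0) - (if j = k then (1 / 2) ^ k / real k else 0)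
     = (if Suc k \<le> j then (1 / 2) ^ j / real j else 0 :: real)" for j by auto
  ultimately show ?thesis unfolding harmonic_tail_def by (simp add: sums_iff)
qed

lemma infsum_harmonic: "(\<Sum>\<^sub>\<infinity>j\<in>{k..}. (1 / 2) ^ j / real j) = harmonic_tail k"
proof -
  have "((\<lambda>j. if k \<le> j then (1 / 2) ^ j / real j else 0) has_sum harmonic_tail k) UNIV"
    unfolding harmonic_tail_def using summable_harmonic[of k]
    by (intro sums_nonneg_imp_has_sum) (auto intro: summable_sums)
  then have "((\<lambda>j. (1 / 2) ^ j / real j) has_sum harmonic_tail k) {k..}"
    by (rule has_sum_cong_neutral[THEN iffD1, rotated -1]) auto
  then show ?thesis by (rule infsumI)
qed

text \<open>
  For integer \<open>k\<close> the incomplete beta integral is elementary: the derivatives of the summands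
  \<open>(1 - x) powr \<alpha> * x ^ i\<close>, with their coefficients, telescope.
\<close>
lemma has_integral_beta_antiderivative:
  fixes \<alpha> :: real
  assumes \<alpha>: "\<alpha> > 0" and x: "0 \<le> x" "x < 1" and k: "k \<ge> 1"
  shows "((\<lambda>t. pochhammer \<alpha> k / fact (k - 1) * (t powr (real k - 1) * (1 - t) powr (\<alpha> - 1))) has_integral
     (1 - (\<Sum>i<k. pochhammer \<alpha> i / fact i * ((1 - x) powr \<alpha> * x ^ i)))) {0..x}"
proof -
  define c where "c = (\<lambda>i. pochhammer \<alpha> i / fact i)"
  define H where "H = (\<lambda>k t. 1 - (\<Sum>i<k. c i * ((1 - t) powr \<alpha> * t ^ i)))"
  have deriv: "(H k has_real_derivative (if k = 0 then 0 else pochhammer \<alpha> k / fact (k - 1) * (t ^ (k - 1) * (1 - t) powr (\<alpha> - 1)))) (at t)"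
    if t: "0 < t" "t < 1" for t k
  proof (induction k)
    case (Suc k)
    have "((\<lambda>t. c k * ((1 - t) powr \<alpha> * t ^ k)) has_real_derivative
        c k * (\<alpha> * (1 - t) powr (\<alpha> - 1) * (- 1) * t ^ k + real k * t ^ (k - 1) * (1 - t) powr \<alpha>)) (at t)"
      using t by (auto intro!: derivative_eq_intros simp: powr_diff)
    from DERIV_diff[OF Suc this]
    have "(H (Suc k) has_real_derivative (if k = 0 then 0 else pochhammer \<alpha> k / fact (k - 1) * (t ^ (k - 1) * (1 - t) powr (\<alpha> - 1))) -
        c k * (\<alpha> * (1 - t) powr (\<alpha> - 1) * (- 1) * t ^ k + real k * t ^ (k - 1) * (1 - t) powr \<alpha>)) (at t)"
      by (simp add: H_def algebra_simps)
    moreover have "(if k = 0 then 0 else pochhammer \<alpha> k / fact (k - 1) * (t ^ (k - 1) * (1 - t) powr (\<alpha> - 1))) -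
        c k * (\<alpha> * (1 - t) powr (\<alpha> - 1) * (- 1) * t ^ k + real k * t ^ (k - 1) * (1 - t) powr \<alpha>)
      = pochhammer \<alpha> (Suc k) / fact k * (t ^ k * (1 - t) powr (\<alpha> - 1))"
    proof (cases k)
      case 0
      then show ?thesis by (simp add: c_def)
    next
      case (Suc j)
      have P: "(1 - t) powr \<alpha> = (1 - t) * (1 - t) powr (\<alpha> - 1)"
        using t by (simp add: powr_diff)
      have ck: "pochhammer \<alpha> k / fact (k - 1) = real k * c k"
        by (simp add: c_def Suc del: of_nat_Suc)
      have ck': "pochhammer \<alpha> (Suc k) / fact k = (\<alpha> + real k) * c k"
        by (simp add: c_def pochhammer_Suc)
      show ?thesis unfolding ck ck' P using Suc by (simp add: algebra_simps)
    qed
    ultimately show ?case by simp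
  qed (simp add: H_def)
  have "((\<lambda>t. pochhammer \<alpha> k / fact (k - 1) * (t powr (real k - 1) * (1 - t) powr (\<alpha> - 1))) has_integral (H k x - H k 0)) {0..x}"
  proof (rule fundamental_theorem_of_calculus_interior)
    show "continuous_on {0..x} (H k)"
      unfolding H_def using x by (intro continuous_intros) auto
    fix t assume t: "t \<in> {0<..<x}"
    have "real (k - 1) = real k - 1" using k by simp
    then have "t ^ (k - 1) = t powr (real k - 1)" using t powr_realpow[of t "k - 1"] by simp
    then show "(H k has_vector_derivative pochhammer \<alpha> k / fact (k - 1) * (t powr (real k - 1) * (1 - t) powr (\<alpha> - 1))) (at t)"
      using deriv[of t k] t x k by (simp add: has_real_derivative_iff_has_vector_derivative)
  qed (use x in auto)
  moreover have "H k 0 = 0"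
  proof -
    have "c i * ((1 - 0) powr \<alpha> * 0 ^ i) = (if i = 0 then 1 else 0)" for i
      by (simp add: c_def)
    then show ?thesis using k by (simp add: H_def)
  qed
  ultimately show ?thesis by (simp add: H_def c_def)
qed

section \<open>Expectations under the growth process\<close>

text \<open>
  The process is described by the effect of one step on expectations, as this is all that the
  computations of laws and moments use.
\<close>
locale growing_tree =
  fixes \<alpha> :: real and \<T> :: "nat \<Rightarrow> (nat \<times> nat) set pmf"
  assumes \<alpha>_pos: "\<alpha> > 0"
    and support: "\<And>n E. n \<ge> 1 \<Longrightarrow> E \<in> set_pmf (\<T> n) \<Longrightarrow> recursive_tree n E"
    and expectation_Suc: "\<And>n F. n \<ge> 1 \<Longrightarrow> measure_pmf.expectation (\<T> (Suc n)) F =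
      measure_pmf.expectation (\<T> n) (\<lambda>E. \<Sum>v\<in>{1..n}.
        (\<alpha> - (\<alpha> - 1) * real (outdegree E v)) / (real n + \<alpha> - 1) * F (insert (v, Suc n) E) :: real)"
begin

abbreviation expect :: "nat \<Rightarrow> ((nat \<times> nat) set \<Rightarrow> real) \<Rightarrow> real" where
  "expect n \<equiv> measure_pmf.expectation (\<T> n)"

lemma finite_support: "n \<ge> 1 \<Longrightarrow> finite (set_pmf (\<T> n))"
proof (rule finite_subset)
  assume n: "n \<ge> 1"
  show "set_pmf (\<T> n) \<subseteq> Pow ({1..n} \<times> {1..n})"
    using recursive_tree_edge[OF support[OF n]] by fastforce
qed simp

lemma integrable_tree [simp, intro]: "n \<ge> 1 \<Longrightarrow> integrable (measure_pmf (\<T> n)) (F :: _ \<Rightarrow> real)"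
  by (rule integrable_measure_pmf_finite[OF finite_support])

lemma expect_cong:
  assumes n: "n \<ge> 1" and eq: "\<And>E. recursive_tree n E \<Longrightarrow> F E = G E"
  shows "expect n F = expect n G"
  by (rule integral_cong_AE) (simp_all add: AE_measure_pmf_iff eq[OF support[OF n]])

lemma expect_mono:
  assumes n: "n \<ge> 1" and le: "\<And>E. recursive_tree n E \<Longrightarrow> F E \<le> G E"
  shows "expect n F \<le> expect n G"
  by (rule integral_mono_AE) (use n in \<open>simp_all add: AE_measure_pmf_iff le[OF support[OF n]]\<close>)

lemma expect_const [simp]: "expect n (\<lambda>E. c) = c"
  by simp

lemma denominator_pos: "n \<ge> 1 \<Longrightarrow> real n + \<alpha> - 1 > 0"
  using \<alpha>_pos by (smt (verit) of_nat_1 of_nat_le_iff)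

definition attraction :: "(nat \<times> nat) set \<Rightarrow> nat \<Rightarrow> real" where
  "attraction E v = \<alpha> - (\<alpha> - 1) * real (outdegree E v)"

lemma sum_attraction:
  assumes "recursive_tree n E" "j \<in> {1..n}"
  shows "(\<Sum>v\<in>descendants E j. attraction E v) = real (card (descendants E j)) + \<alpha> - 1"
proof -
  have "real (\<Sum>v\<in>descendants E j. outdegree E v) = real (card (descendants E j)) - 1"
    using sum_outdegree_descendants[OF assms] by linarith
  moreover have "(\<Sum>v\<in>descendants E j. attraction E v) =
      \<alpha> * real (card (descendants E j)) - (\<alpha> - 1) * real (\<Sum>v\<in>descendants E j. outdegree E v)"
    by (simp add: attraction_def sum_subtractf sum_distrib_left)
  ultimately have "(\<Sum>v\<in>descendants E j. attraction E v) =
      \<alpha> * real (card (descendants E j)) - (\<alpha> - 1) * (real (card (descendants E j)) - 1)"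
    by simp
  then show ?thesis by (simp add: algebra_simps)
qed

lemma sum_attraction_all:
  assumes "recursive_tree n E"
  shows "(\<Sum>v\<in>{1..n}. attraction E v) = real n + \<alpha> - 1"
  using sum_attraction[OF assms, of 1] descendants_root[OF assms] recursive_tree_pos[OF assms] by simp

lemma expect_Suc:
  "n \<ge> 1 \<Longrightarrow> expect (Suc n) F = expect n (\<lambda>E. \<Sum>v\<in>{1..n}. attraction E v / (real n + \<alpha> - 1) * F (insert (v, Suc n) E))"
  by (simp add: expectation_Suc attraction_def)

text \<open>
  When a node is added, the attraction of \<open>k\<close> changes by \<open>1 - \<alpha>\<close> with a probability proportional to it, so the expected attraction is multiplied by a constant.
\<close>
lemma expect_attraction:
  assumes "1 \<le> k" "k \<le> n"
  shows "expect n (\<lambda>E. attraction E k) = \<alpha> * (\<Prod>l\<in>{k..<n}. real l / (real l + \<alpha> - 1))"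
  using assms(2)
proof (induction n rule: dec_induct)
  case base
  have "expect k (\<lambda>E. attraction E k) = expect k (\<lambda>E. \<alpha>)"
    by (rule expect_cong) (use assms outdegree_new in \<open>auto simp: attraction_def\<close>)
  then show ?case by simp
next
  case (step n)
  have n: "n \<ge> 1" using step assms by simp
  note den = denominator_pos[OF n]
  have "expect (Suc n) (\<lambda>E. attraction E k) = expect n (\<lambda>E. attraction E k * (real n / (real n + \<alpha> - 1)))"
    unfolding expect_Suc[OF n]
  proof (rule expect_cong[OF n])
    fix E assume T: "recursive_tree n E"
    define d c e where "d = real n + \<alpha> - 1" and "c = attraction E k / d" and "e = attraction E k * ((\<alpha> - 1) / d)"
    have grown: "attraction (insert (v, Suc n) E) k = attraction E k - (if v = k then \<alpha> - 1 else 0)" for v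
      by (simp add: attraction_def outdegree_grow[OF T] algebra_simps)
    have "attraction E v / d * attraction (insert (v, Suc n) E) k =
        attraction E v * c - (if v = k then e else 0)" for v
      unfolding grown by (simp add: c_def e_def algebra_simps diff_divide_distrib)
    then have "(\<Sum>v\<in>{1..n}. attraction E v / d * attraction (insert (v, Suc n) E) k) =
        (\<Sum>v\<in>{1..n}. attraction E v) * c - e"
      using step assms by (simp add: sum_subtractf sum_distrib_right)
    also have "\<dots> = d * c - e" unfolding sum_attraction_all[OF T] d_def ..
    also have "\<dots> = attraction E k * ((d - (\<alpha> - 1)) / d)"
      using den[folded d_def] by (simp add: c_def e_def field_simps)
    also have "d - (\<alpha> - 1) = real n" by (simp add: d_def)
    finally show "(\<Sum>v\<in>{1..n}. attraction E v / (real n + \<alpha> - 1) * attraction (insert (v, Suc n) E) k) =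
      attraction E k * (real n / (real n + \<alpha> - 1))" unfolding d_def .
  qed
  then show ?case using step by (simp add: prod.atLeastLessThan_Suc)
qed

text \<open>
  The probability that \<open>k\<close> is the parent of \<open>j\<close>.
\<close>
definition parent_prob :: "nat \<Rightarrow> nat \<Rightarrow> real" where
  "parent_prob j k = \<alpha> * (\<Prod>l\<in>{k..<j - 1}. real l / (real l + \<alpha> - 1)) / (real j + \<alpha> - 2)"

lemma expect_parent:
  assumes "1 \<le> k" "k < j"
  shows "expect j (\<lambda>E. of_bool ((k, j) \<in> E)) = parent_prob j k"
proof -
  obtain n where j: "j = Suc n" using assms by (cases j) auto
  have n: "n \<ge> 1" "k \<le> n" using assms j by auto
  have "expect (Suc n) (\<lambda>E. of_bool ((k, j) \<in> E)) = expect n (\<lambda>E. attraction E k * (1 / (real n + \<alpha> - 1)))"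
    unfolding expect_Suc[OF n(1)]
  proof (rule expect_cong[OF n(1)])
    fix E assume T: "recursive_tree n E"
    have "(k, j) \<notin> E" using recursive_tree_edge[OF T, of k j] j by auto
    then have "attraction E v / (real n + \<alpha> - 1) * of_bool ((k, j) \<in> insert (v, Suc n) E) =
       (if v = k then attraction E k * (1 / (real n + \<alpha> - 1)) else 0)" for v
      by (auto simp: j)
    then show "(\<Sum>v\<in>{1..n}. attraction E v / (real n + \<alpha> - 1) * of_bool ((k, j) \<in> insert (v, Suc n) E)) =
      attraction E k * (1 / (real n + \<alpha> - 1))" using n assms(1) by simp
  qed
  then show ?thesis
    using expect_attraction[OF assms(1) n(2)] by (simp add: j parent_prob_def)
qed

lemma parent_prob_nonneg: "1 \<le> k \<Longrightarrow> k < j \<Longrightarrow> 0 \<le> parent_prob j k"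
  using expect_mono[of j "\<lambda>_. 0" "\<lambda>E. of_bool ((k, j) \<in> E)"] by (simp add: expect_parent)

lemma parent_prob_le_1: "1 \<le> k \<Longrightarrow> k < j \<Longrightarrow> parent_prob j k \<le> 1"
  using expect_mono[of j "\<lambda>E. of_bool ((k, j) \<in> E)" "\<lambda>_. 1"] by (simp add: expect_parent)

subsection \<open>Subtree sizes\<close>

abbreviation subtree_size :: "(nat \<times> nat) set \<Rightarrow> nat \<Rightarrow> nat" where
  "subtree_size E j \<equiv> card (descendants E j)"

lemma subtree_size_bounds:
  assumes "recursive_tree n E" "j \<in> {1..n}"
  shows "1 \<le> subtree_size E j" "subtree_size E j + j \<le> Suc n"
proof -
  show "1 \<le> subtree_size E j"
    using finite_descendants[OF assms] descendants_self[of j E] card_gt_0_iff[of "descendants E j"] by auto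
  show "subtree_size E j + j \<le> Suc n"
    using card_mono[OF _ descendants_subset[OF assms]] assms(2) by auto
qed

text \<open>
  The total attraction of the subtree at \<open>j\<close> depends only on its size, so that size is a Polya urn. The
  factor \<open>X\<close> stands for information that later steps do not change, such as the parent of \<open>j\<close>.
\<close>
lemma expect_subtree_size_Suc:
  fixes X :: "(nat \<times> nat) set \<Rightarrow> real" and g :: "nat \<Rightarrow> real"
  assumes j: "1 \<le> j" "j \<le> n" and X: "\<And>E v. X (insert (v, Suc n) E) = X E"
  shows "expect (Suc n) (\<lambda>E. X E * g (subtree_size E j)) =
    expect n (\<lambda>E. X E * ((real (subtree_size E j) + \<alpha> - 1) * g (Suc (subtree_size E j))
                 + (real n - real (subtree_size E j)) * g (subtree_size E j)) / (real n + \<alpha> - 1))"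
proof -
  have n: "n \<ge> 1" using j by simp
  show ?thesis
    unfolding expect_Suc[OF n]
  proof (rule expect_cong[OF n])
    fix E assume T: "recursive_tree n E"
    let ?B = "descendants E j" and ?s = "subtree_size E j" and ?d = "real n + \<alpha> - 1"
    have B: "?B \<subseteq> {1..n}" using descendants_subset[OF T, of j] j by auto
    have fin: "finite ?B" using B finite_subset by auto
    have "Suc n \<notin> ?B" using B by auto
    then have summand: "attraction E v / ?d * (X (insert (v, Suc n) E) * g (subtree_size (insert (v, Suc n) E) j))
        = attraction E v * (X E * (if v \<in> ?B then g (Suc ?s) else g ?s) / ?d)" if "v \<in> {1..n}" for v
      using fin by (simp add: X descendants_grow[OF T that])
    define d c1 c2 where "d = real n + \<alpha> - 1" and "c1 = X E * g ?s / d" and "c2 = X E * g (Suc ?s) / d"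
    have "(\<Sum>v\<in>{1..n}. attraction E v * (X E * (if v \<in> ?B then g (Suc ?s) else g ?s) / ?d)) =
      (\<Sum>v\<in>{1..n} - ?B. attraction E v * c1) + (\<Sum>v\<in>?B. attraction E v * c2)"
      unfolding sum.subset_diff[OF B finite_atLeastAtMost] by (simp add: c1_def c2_def d_def)
    also have "\<dots> = (\<Sum>v\<in>{1..n} - ?B. attraction E v) * c1 + (\<Sum>v\<in>?B. attraction E v) * c2"
      by (simp only: sum_distrib_right)
    also have "\<dots> = (real n - real ?s) * c1 + (real ?s + \<alpha> - 1) * c2"
      using j by (simp only: sum_diff[OF finite_atLeastAtMost B]) (simp add: sum_attraction_all[OF T, simplified] sum_attraction[OF T])
    also have "\<dots> = X E * ((real ?s + \<alpha> - 1) * g (Suc ?s) + (real n - real ?s) * g ?s) / ?d"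
      unfolding d_def[symmetric]
      by (simp add: c1_def c2_def algebra_simps add_divide_distrib diff_divide_distrib)
    also have "(\<Sum>v\<in>{1..n}. attraction E v * (X E * (if v \<in> ?B then g (Suc ?s) else g ?s) / ?d)) =
       (\<Sum>v\<in>{1..n}. attraction E v / ?d * (X (insert (v, Suc n) E) * g (subtree_size (insert (v, Suc n) E) j)))"
      by (rule sum.cong[OF refl summand[symmetric]])
    finally show "(\<Sum>v\<in>{1..n}. attraction E v / ?d * (X (insert (v, Suc n) E) * g (subtree_size (insert (v, Suc n) E) j)))
       = X E * ((real ?s + \<alpha> - 1) * g (Suc ?s) + (real n - real ?s) * g ?s) / ?d"
      .
  qed
qed

lemma expect_subtree_size_new:
  assumes "1 \<le> j" 
  shows "expect j (\<lambda>E. X E * g (subtree_size E j)) = g 1 * expect j X"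
proof -
  have "expect j (\<lambda>E. X E * g (subtree_size E j)) = expect j (\<lambda>E. g 1 * X E)"
  proof (rule expect_cong[OF assms])
    fix E assume T: "recursive_tree j E"
    have "subtree_size E j = 1" using subtree_size_bounds[OF T, of j] assms by simp
    then show "X E * g (subtree_size E j) = g 1 * X E" by simp
  qed
  then show ?thesis by simp
qed

text \<open>
  The rising factorials of the weight of the urn are martingales up to a deterministic factor.
\<close>
lemma expect_pochhammer_subtree_size:
  assumes "1 \<le> j" "j \<le> n"
  shows "expect n (\<lambda>E. pochhammer (real (subtree_size E j) + \<alpha> - 1) r) =
    pochhammer \<alpha> r * pochhammer (real n + \<alpha> - 1) r / pochhammer (real j + \<alpha> - 1) r"
  using assms(2)
proof (induction n rule: dec_induct)
  case base
  have "pochhammer (real j + \<alpha> - 1) r > 0" by (rule pochhammer_pos[OF denominator_pos[OF assms(1)]])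
  then show ?case
    using expect_subtree_size_new[OF assms(1), of "\<lambda>_. 1" "\<lambda>s. pochhammer (real s + \<alpha> - 1) r"] by simp
next
  case (step n)
  have n: "n \<ge> 1" using step assms by simp
  note den = denominator_pos[OF n]
  have rec: "x * pochhammer (x + 1) r = pochhammer x r * (x + real r)" for x :: real
    using pochhammer_rec[of x r] pochhammer_rec'[of x r] by (simp add: mult.commute)
  define g where "g = (\<lambda>s::nat. pochhammer (real s + \<alpha> - 1) r)"
  have "(real s + \<alpha> - 1) * g (Suc s) + (real n - real s) * g s = g s * (real n + \<alpha> - 1 + real r)" for s
    using rec[of "real s + \<alpha> - 1"] unfolding g_def by (simp add: algebra_simps)
  then have "expect (Suc n) (\<lambda>E. g (subtree_size E j)) =
     expect n (\<lambda>E. g (subtree_size E j) * ((real n + \<alpha> - 1 + real r) / (real n + \<alpha> - 1)))"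
    using expect_subtree_size_Suc[OF assms(1) step(1), of "\<lambda>_. 1" g] by (simp only: mult_1 times_divide_eq_right)
  then have "expect (Suc n) (\<lambda>E. pochhammer (real (subtree_size E j) + \<alpha> - 1) r) =
     expect n (\<lambda>E. pochhammer (real (subtree_size E j) + \<alpha> - 1) r) * ((real n + \<alpha> - 1 + real r) / (real n + \<alpha> - 1))"
    unfolding g_def by (simp only: integral_mult_left_zero)
  also have "\<dots> = pochhammer \<alpha> r / pochhammer (real j + \<alpha> - 1) r * (pochhammer (real n + \<alpha> - 1) r * (real n + \<alpha> - 1 + real r) / (real n + \<alpha> - 1))"
    unfolding step.IH by simp
  also have "pochhammer (real n + \<alpha> - 1) r * (real n + \<alpha> - 1 + real r) / (real n + \<alpha> - 1) = pochhammer (real (Suc n) + \<alpha> - 1) r"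
    using rec[of "real n + \<alpha> - 1"] den by (simp add: field_simps)
  finally show ?case by simp
qed

text \<open>
  The law of the size of the subtree at \<open>j\<close> among \<open>n\<close> nodes, for \<open>j \<ge> 2\<close>: the Polya urn distribution.
  The guard excludes the sizes for which the truncated differences \<open>s - 1\<close> and \<open>n - s - 1\<close> may give
  a nonzero value.
\<close>
definition size_law :: "nat \<Rightarrow> nat \<Rightarrow> nat \<Rightarrow> real" where
  "size_law j n s = (if s = 0 \<or> n \<le> s then 0 else
     pochhammer \<alpha> (s - 1) / fact (s - 1) * real ((n - s - 1) choose (j - 2)) *
     (fact (n - j) / pochhammer (real j + \<alpha> - 1) (n - j)))"

lemma size_law_Suc:
  assumes "2 \<le> j" "j \<le> n"
  shows "(real n + \<alpha> - 1) * size_law j (Suc n) s =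
    (if s = 0 then 0 else (real s + \<alpha> - 2) * size_law j n (s - 1)) + (real n - real s) * size_law j n s"
proof (cases "s = 0 \<or> s > n")
  case True
  then show ?thesis using assms by (auto simp: size_law_def)
next
  case False
  define a where "a = (\<lambda>s. pochhammer \<alpha> s / fact s)"
  define c where "c = fact (n - j) / pochhammer (real j + \<alpha> - 1) (n - j)"
  define i where "i = j - 2"
  have den: "real n + \<alpha> - 1 > 0" using assms by (intro denominator_pos) simp
  have "pochhammer (real j + \<alpha> - 1) (Suc n - j) = pochhammer (real j + \<alpha> - 1) (n - j) * (real n + \<alpha> - 1)"
    using assms by (simp add: Suc_diff_le pochhammer_Suc of_nat_diff algebra_simps)
  moreover have "fact (Suc n - j) = (real n - real j + 1) * fact (n - j)"
    using assms by (simp add: Suc_diff_le of_nat_diff algebra_simps)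
  ultimately have lhs: "(real n + \<alpha> - 1) * size_law j (Suc n) s =
      a (s - 1) * real ((n - s) choose i) * ((real n - real j + 1) * c)"
    using False den by (simp add: size_law_def a_def c_def i_def)
  have rhs1: "(real s + \<alpha> - 2) * size_law j n (s - 1) = (real s - 1) * a (s - 1) * real ((n - s) choose i) * c"
  proof (cases "s = 1")
    case True
    then show ?thesis by (simp add: size_law_def)
  next
    case s: False
    then obtain t where t: "s = Suc (Suc t)" using False by (metis One_nat_def not0_implies_Suc)
    have "a (Suc t) * real (Suc t) = a t * (\<alpha> + real t)"
      by (simp add: a_def pochhammer_Suc del: of_nat_Suc)
    moreover have "size_law j n (s - 1) = a t * real ((n - s) choose i) * c"
      using False t by (simp add: size_law_def a_def c_def i_def)
    ultimately show ?thesis by (simp add: t algebra_simps)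
  qed
  have rhs2: "(real n - real s) * size_law j n s = (real n - real s - real i) * a (s - 1) * real ((n - s) choose i) * c"
  proof (cases "s = n")
    case True
    then show ?thesis by (cases i) (auto simp: size_law_def)
  next
    case s: False
    have "(n - s - i) * ((n - s) choose i) = (n - s) * ((n - s - 1) choose i)"
      by (rule binomial_absorb_comp)
    then have "real (n - s - i) * real ((n - s) choose i) = real (n - s) * real ((n - s - 1) choose i)"
      by (simp only: of_nat_mult[symmetric])
    moreover have "real (n - s - i) * real ((n - s) choose i) = (real n - real s - real i) * real ((n - s) choose i)"
      using False by (cases "i \<le> n - s") (auto simp: of_nat_diff)
    moreover have "real (n - s) = real n - real s" using False by simp
    ultimately have "(real n - real s) * real ((n - s - 1) choose i) = (real n - real s - real i) * real ((n - s) choose i)"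
      by simp
    then show ?thesis using s False by (simp add: size_law_def a_def c_def i_def mult_ac)
  qed
  have "real j = real i + 2" using assms by (simp add: i_def)
  then show ?thesis using False unfolding lhs rhs1 rhs2 by (simp add: algebra_simps)
qed

text \<open>
  The factor \<open>X\<close> shows the independence of the subtree size from what was decided up to time \<open>j\<close>.
\<close>
lemma expect_size_law:
  assumes j: "2 \<le> j" "j \<le> n" and X: "\<And>n E v. n \<ge> j \<Longrightarrow> X (insert (v, Suc n) E) = X E"
  shows "expect n (\<lambda>E. X E * of_bool (subtree_size E j = s)) = size_law j n s * expect j X"
  using j(2)
proof (induction n arbitrary: s rule: dec_induct)
  case base
  have "real j - 1 = real (j - 1)" using j by simp
  have "of_bool (1 = s) = size_law j j s"
  proof (cases "s = 1")
    case False
    then have "j - s - 1 < j - 2 \<or> s = 0 \<or> s \<ge> j" using j by auto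
    then show ?thesis using False by (auto simp: size_law_def binomial_eq_0)
  qed (use j in \<open>auto simp: size_law_def binomial_n_n numeral_2_eq_2\<close>)
  then show ?case
    using expect_subtree_size_new[of j X "\<lambda>t. of_bool (t = s)"] j by simp
next
  case (step n)
  have n: "n \<ge> 1" using step j by simp
  note den = denominator_pos[OF n]
  have split: "X E * ((real t + \<alpha> - 1) * of_bool (Suc t = s) + (real n - real t) * of_bool (t = s)) / d =
      (if s = 0 then 0 else (real s + \<alpha> - 2) / d * (X E * of_bool (t = s - 1)))
      + (real n - real s) / d * (X E * of_bool (t = s))" for E t d
    by (cases s) auto
  have "expect (Suc n) (\<lambda>E. X E * of_bool (subtree_size E j = s)) =
     expect n (\<lambda>E. (if s = 0 then 0 else (real s + \<alpha> - 2) / (real n + \<alpha> - 1) * (X E * of_bool (subtree_size E j = s - 1)))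
            + (real n - real s) / (real n + \<alpha> - 1) * (X E * of_bool (subtree_size E j = s)))"
    using expect_subtree_size_Suc[OF _ step(1) X[OF step(1)], of "\<lambda>t. of_bool (t = s)"] j
    unfolding split by simp
  also have "\<dots> = (if s = 0 then 0 else (real s + \<alpha> - 2) / (real n + \<alpha> - 1) * (size_law j n (s - 1) * expect j X))
            + (real n - real s) / (real n + \<alpha> - 1) * (size_law j n s * expect j X)"
    using n by (simp add: step.IH)
  also have "\<dots> = ((if s = 0 then 0 else (real s + \<alpha> - 2) * size_law j n (s - 1)) + (real n - real s) * size_law j n s)
       / (real n + \<alpha> - 1) * expect j X"
  proof -
    have "A / d * (p * x) + B / d * (q * x) = (A * p + B * q) / d * x" for A B p q d x :: real
      by (simp add: add_divide_distrib algebra_simps)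
    from this[of _ "real n + \<alpha> - 1"] show ?thesis by (cases "s = 0") simp_all
  qed
  also have "\<dots> = size_law j (Suc n) s * expect j X"
    unfolding size_law_Suc[OF j(1) step(1), symmetric] using den by simp
  finally show ?case .
qed

lemma expect_invariant:
  assumes j: "1 \<le> j" "j \<le> n" and X: "\<And>n E v. n \<ge> j \<Longrightarrow> X (insert (v, Suc n) E) = X E"
  shows "expect n X = expect j X"
  using j(2)
proof (induction n rule: dec_induct)
  case (step n)
  have den: "real n + \<alpha> - 1 \<noteq> 0" using denominator_pos[of n] step j by simp
  have "(real s + \<alpha> - 1) * 1 + (real n - real s) * 1 = real n + \<alpha> - 1" for s :: nat by simp
  then show ?case
    using expect_subtree_size_Suc[OF j(1) step(1) X[OF step(1)], of "\<lambda>_. 1"] step.IH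
    by (simp only: nonzero_mult_div_cancel_right[OF den] mult_1_right)
qed simp

lemma expect_size_greater:
  assumes j: "2 \<le> j" "j \<le> n" and X: "\<And>n E v. n \<ge> j \<Longrightarrow> X (insert (v, Suc n) E) = X E"
  shows "expect n (\<lambda>E. X E * of_bool (subtree_size E j > h)) = (1 - (\<Sum>s\<in>{1..h}. size_law j n s)) * expect j X"
proof -
  have n: "n \<ge> 1" using j by simp
  have "expect n (\<lambda>E. X E * of_bool (subtree_size E j > h)) =
    expect n (\<lambda>E. X E - (\<Sum>s\<in>{1..h}. X E * of_bool (subtree_size E j = s)))"
  proof (rule expect_cong[OF n])
    fix E assume T: "recursive_tree n E"
    have "(\<Sum>s\<in>{1..h}. X E * of_bool (subtree_size E j = s)) = (\<Sum>s\<in>{1..h}. if subtree_size E j = s then X E else 0)"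
      by (intro sum.cong) auto
    also have "\<dots> = (if subtree_size E j \<in> {1..h} then X E else 0)" by (rule sum.delta') simp
    also have "\<dots> = X E * of_bool (subtree_size E j \<le> h)"
      using subtree_size_bounds(1)[OF T, of j] j by auto
    finally have "(\<Sum>s\<in>{1..h}. X E * of_bool (subtree_size E j = s)) = X E * of_bool (subtree_size E j \<le> h)" .
    then show "X E * of_bool (subtree_size E j > h) = X E - (\<Sum>s\<in>{1..h}. X E * of_bool (subtree_size E j = s))"
      by (auto simp: of_bool_def)
  qed
  also have "\<dots> = expect n X - (\<Sum>s\<in>{1..h}. size_law j n s * expect j X)"
  proof -
    have "expect n (\<lambda>E. X E - (\<Sum>s\<in>{1..h}. X E * of_bool (subtree_size E j = s))) =
      expect n X - expect n (\<lambda>E. \<Sum>s\<in>{1..h}. X E * of_bool (subtree_size E j = s))"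
      using n by (intro Bochner_Integration.integral_diff) auto
    also have "expect n (\<lambda>E. \<Sum>s\<in>{1..h}. X E * of_bool (subtree_size E j = s)) =
      (\<Sum>s\<in>{1..h}. expect n (\<lambda>E. X E * of_bool (subtree_size E j = s)))"
      using n by (intro Bochner_Integration.integral_sum) auto
    finally show ?thesis by (simp only: expect_size_law[OF j X])
  qed
  also have "expect n X = expect j X" using j by (intro expect_invariant X) auto
  finally show ?thesis by (simp add: algebra_simps sum_distrib_right sum_distrib_left)
qed

text \<open>
  The increment from \<open>i\<close> to \<open>i + 1\<close> of the probability that the subtree at the given node has at most \<open>h\<close>
  nodes.
\<close>
definition cdf_step :: "nat \<Rightarrow> nat \<Rightarrow> nat \<Rightarrow> real" where
  "cdf_step i n h = real h * (pochhammer \<alpha> h / fact h) * real ((n - h - 1) choose (i - 1)) *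
     (fact (n - i - 1) / pochhammer (real i + \<alpha>) (n - i - 1)) / (real i + \<alpha> - 1)"

lemma cdf_size_law_2:
  assumes "2 \<le> n" "h < n"
  shows "(\<Sum>s\<in>{1..h}. size_law 2 n s) = cdf_step 1 n h"
proof -
  define a where "a = (\<lambda>s. pochhammer \<alpha> s / fact s)"
  define c where "c = fact (n - 2) / pochhammer (1 + \<alpha>) (n - 2)"
  have "\<alpha> * (\<Sum>s\<in>{1..h}. a (s - 1)) = real h * a h" for h
  proof (induction h)
    case (Suc h)
    have "real (Suc h) * a (Suc h) = (\<alpha> + real h) * a h"
      by (simp add: a_def pochhammer_Suc del: of_nat_Suc)
    with Suc show ?case by (simp add: algebra_simps)
  qed simp
  then have "(\<Sum>s\<in>{1..h}. a (s - 1)) = real h * a h / \<alpha>"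
    using \<alpha>_pos by (simp add: field_simps)
  moreover have "(\<Sum>s\<in>{1..h}. size_law 2 n s) = (\<Sum>s\<in>{1..h}. a (s - 1)) * c"
    unfolding sum_distrib_right using assms by (intro sum.cong) (auto simp: size_law_def a_def c_def)
  moreover have "cdf_step 1 n h = real h * a h / \<alpha> * c"
    by (simp add: cdf_step_def a_def c_def numeral_2_eq_2)
  ultimately show ?thesis by simp
qed

text \<open>
  The summands of the laws for \<open>j\<close> and for \<open>j + 1\<close> differ by a rational factor in \<open>s\<close>, and their difference
  is, up to a constant, the difference of consecutive values of \<open>s * a s * (n - s - 1 choose j - 1)\<close>, where
  \<open>a s = pochhammer \<alpha> s / fact s\<close>.
\<close>
lemma cdf_size_law_Suc:
  assumes "2 \<le> j" "Suc j \<le> n" "h < n"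
  shows "(\<Sum>s\<in>{1..h}. size_law (Suc j) n s) = (\<Sum>s\<in>{1..h}. size_law j n s) + cdf_step j n h"
proof -
  define i where "i = j - 2"
  have i: "j = Suc (Suc i)" using assms(1) by (simp add: i_def)
  define a where "a = (\<lambda>s. pochhammer \<alpha> s / fact s)"
  define c where "c = fact (n - Suc j) / pochhammer (real j + \<alpha>) (n - Suc j)"
  have jpos: "real j + \<alpha> - 1 > 0" using denominator_pos[of j] assms by simp
  have nj: "n - j = Suc (n - Suc j)" using assms by simp
  have "pochhammer (real j + \<alpha> - 1) (n - j) = (real j + \<alpha> - 1) * pochhammer (real j + \<alpha>) (n - Suc j)"
    unfolding nj pochhammer_rec by (simp add: algebra_simps)
  moreover have "fact (n - j) = (real n - real j) * fact (n - Suc j)"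
    unfolding nj fact_Suc using assms by (simp add: of_nat_diff)
  ultimately have c': "fact (n - j) / pochhammer (real j + \<alpha> - 1) (n - j) = (real n - real j) * c / (real j + \<alpha> - 1)"
    by (simp add: c_def)
  define A where "A = (\<lambda>h k. \<Sum>s\<in>{1..h}. a (s - 1) * real ((n - s - 1) choose k))"
  have telescope: "(real j + \<alpha> - 1) * A h (Suc i) - (real n - real j) * A h i = real h * a h * real ((n - h - 1) choose Suc i)"
    using assms(3)
  proof (induction h)
    case (Suc h)
    \<comment> \<open>With \<open>N\<close> the truncated differences in the binomial coefficients disappear.\<close>
    define N where "N = n - h - 2"
    have N: "n = Suc (Suc (h + N))" using Suc.prems by (simp add: N_def)
    have "Suc i * (N choose Suc i) = (N - i) * (N choose i)"
      using binomial_absorption[of i N] binomial_absorb_comp[of N i] by simp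
    then have "real (Suc i) * real (N choose Suc i) = real (N - i) * real (N choose i)"
      by (simp only: of_nat_mult[symmetric])
    also have "\<dots> = (real N - real i) * real (N choose i)"
      by (cases "i \<le> N") (auto simp: of_nat_diff)
    finally have absorb: "(real i + 1) * real (N choose Suc i) = (real N - real i) * real (N choose i)" by (simp add: add.commute)
    have "real (Suc h) * a (Suc h) = (\<alpha> + real h) * a h"
      by (simp add: a_def pochhammer_Suc del: of_nat_Suc)
    moreover have "A (Suc h) k = A h k + a h * real (N choose k)" for k
      by (simp add: A_def N)
    moreover have "(n - h - 1) choose Suc i = (N choose i) + (N choose Suc i)" by (simp add: N)
    moreover have "(n - Suc h - 1) choose Suc i = N choose Suc i" by (simp add: N)
    moreover have "(real j + \<alpha> - 1) * (a h * real (N choose Suc i)) - (real n - real j) * (a h * real (N choose i))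
        + real h * a h * (real (N choose i) + real (N choose Suc i)) = (\<alpha> + real h) * a h * real (N choose Suc i)"
    proof -
      have "(i' + 2 + \<alpha> - 1) * (a * X) - (h' + N' + 2 - (i' + 2)) * (a * Y) + h' * a * (Y + X) = (\<alpha> + h') * a * X"
        if "(i' + 1) * X = (N' - i') * Y" for i' h' N' a X Y :: real
      proof -
        have "(i' + 2 + \<alpha> - 1) * (a * X) - (h' + N' + 2 - (i' + 2)) * (a * Y) + h' * a * (Y + X) =
            (\<alpha> + h') * a * X + a * ((i' + 1) * X - (N' - i') * Y)"
          by (simp add: algebra_simps)
        with that show ?thesis by simp
      qed
      moreover have "real j = real i + 2" "real n = real h + real N + 2" by (simp_all add: i N)
      ultimately show ?thesis using absorb by (simp only:)
    qed
    ultimately show ?case using Suc by (simp add: algebra_simps)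
  qed (simp add: A_def)
  have "(\<Sum>s\<in>{1..h}. size_law (Suc j) n s) = A h (Suc i) * c"
    unfolding A_def sum_distrib_right using assms
    by (intro sum.cong) (auto simp: size_law_def a_def c_def i algebra_simps)
  moreover have "(\<Sum>s\<in>{1..h}. size_law j n s) = A h i * ((real n - real j) * c / (real j + \<alpha> - 1))"
    unfolding A_def sum_distrib_right c'[symmetric] using assms
    by (intro sum.cong) (auto simp: size_law_def a_def i)
  moreover have "cdf_step j n h = (real h * a h * real ((n - h - 1) choose Suc i)) * c / (real j + \<alpha> - 1)"
    by (simp add: cdf_step_def a_def c_def i)
  moreover have "p * c = q * (m * c / d) + (d * p - m * q) * c / d" if "d > 0" for p q m d :: real
    using that by (simp add: field_simps)
  from this[OF jpos] have "A h (Suc i) * c = A h i * ((real n - real j) * c / (real j + \<alpha> - 1)) +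
      ((real j + \<alpha> - 1) * A h (Suc i) - (real n - real j) * A h i) * c / (real j + \<alpha> - 1)" .
  ultimately show ?thesis
    unfolding telescope by (simp only:)
qed

lemma cdf_size_law:
  assumes "2 \<le> j" "j \<le> n" "h < n"
  shows "(\<Sum>s\<in>{1..h}. size_law j n s) = (\<Sum>i\<in>{1..<j}. cdf_step i n h)"
  using assms
proof (induction j rule: dec_induct)
  case base
  then show ?case using cdf_size_law_2[of n h] by (simp add: numeral_2_eq_2)
next
  case (step j)
  then show ?case using cdf_size_law_Suc[of j n h] by simp
qed

text \<open>
  The probability that \<open>j\<close> is heavy. For \<open>j = 1\<close> the sum is empty, as it should be for the root.
\<close>
definition heavy_prob :: "nat \<Rightarrow> nat \<Rightarrow> real" where
  "heavy_prob j n = 1 - (\<Sum>i\<in>{1..<j}. cdf_step i n (n div 2))"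

lemma expect_heavy:
  assumes j: "1 \<le> j" "j \<le> n" and X: "\<And>n E v. n \<ge> j \<Longrightarrow> X (insert (v, Suc n) E) = X E"
  shows "expect n (\<lambda>E. X E * of_bool (heavy n E j)) = heavy_prob j n * expect j X"
proof (cases "j = 1")
  case True
  have n: "n \<ge> 1" using j by simp
  have "expect n (\<lambda>E. X E * of_bool (heavy n E j)) = expect n X"
  proof (rule expect_cong[OF n])
    fix E assume "recursive_tree n E"
    then show "X E * of_bool (heavy n E j) = X E"
      using n descendants_root[of n E] by (simp add: heavy_def True)
  qed
  also have "\<dots> = expect j X" using j by (intro expect_invariant X) auto
  finally show ?thesis by (simp add: heavy_prob_def True)
next
  case False
  have "heavy n E j \<longleftrightarrow> subtree_size E j > n div 2" for E
    unfolding heavy_def by linarith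
  then show ?thesis
    using expect_size_greater[OF _ j(2) X, of "n div 2"] cdf_size_law[of j n "n div 2"] j False
    by (simp add: heavy_prob_def)
qed

lemma heavy_prob_eq: "1 \<le> j \<Longrightarrow> j \<le> n \<Longrightarrow> heavy_prob j n = expect n (\<lambda>E. of_bool (heavy n E j))"
  using expect_heavy[of j n "\<lambda>_. 1"] by simp

lemma heavy_prob_nonneg: "1 \<le> j \<Longrightarrow> j \<le> n \<Longrightarrow> 0 \<le> heavy_prob j n"
  using expect_mono[of n "\<lambda>_. 0" "\<lambda>E. of_bool (heavy n E j)"] by (simp add: heavy_prob_eq)

text \<open>
  Markov's inequality for the rising factorial of the weight of the urn. It grows by the factor \<open>2 ^ r\<close>
  at most when the size of a heavy subtree is replaced by \<open>n\<close>.
\<close>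
lemma heavy_prob_bound:
  assumes "1 \<le> j" "j \<le> n"
  shows "heavy_prob j n \<le> 2 ^ r * pochhammer \<alpha> r / pochhammer (real j + \<alpha> - 1) r"
proof -
  have n: "n \<ge> 1" using assms by simp
  let ?p = "pochhammer (real n + \<alpha> - 1) r"
  have p: "?p > 0" using denominator_pos[OF n] by (rule pochhammer_pos)
  have "heavy_prob j n \<le> expect n (\<lambda>E. (2 ^ r / ?p) * pochhammer (real (subtree_size E j) + \<alpha> - 1) r)"
    unfolding heavy_prob_eq[OF assms]
  proof (rule expect_mono[OF n])
    fix E assume T: "recursive_tree n E"
    let ?s = "subtree_size E j"
    have s: "1 \<le> ?s" using subtree_size_bounds[OF T, of j] assms by simp
    have pos: "pochhammer (real ?s + \<alpha> - 1) r > 0" for r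
      using denominator_pos[OF s] by (rule pochhammer_pos)
    have "?p \<le> 2 ^ r * pochhammer (real ?s + \<alpha> - 1) r" if "heavy n E j"
    proof (induction r)
      case (Suc r)
      \<comment> \<open>Heaviness gives one unit more than half, which compensates for \<open>\<alpha> < 1\<close>.\<close>
      have "real n + 1 \<le> 2 * real ?s" using that unfolding heavy_def by linarith
      then have "real n + \<alpha> - 1 + real r \<le> 2 * (real ?s + \<alpha> - 1 + real r)" using \<alpha>_pos by simp
      moreover have "0 \<le> real n + \<alpha> - 1 + real r" using denominator_pos[OF n] by simp
      moreover have "0 \<le> 2 ^ r * pochhammer (real ?s + \<alpha> - 1) r" using pos[of r] by simp
      ultimately have "pochhammer (real n + \<alpha> - 1) r * (real n + \<alpha> - 1 + real r) \<le>
          (2 ^ r * pochhammer (real ?s + \<alpha> - 1) r) * (2 * (real ?s + \<alpha> - 1 + real r))"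
        using Suc by (intro mult_mono) auto
      then show ?case by (simp add: pochhammer_Suc algebra_simps)
    qed simp
    then show "of_bool (heavy n E j) \<le> (2 ^ r / ?p) * pochhammer (real ?s + \<alpha> - 1) r"
      using p pos[of r] by (cases "heavy n E j") (simp_all add: field_simps)
  qed
  also have "\<dots> = (2 ^ r / ?p) * (pochhammer \<alpha> r * ?p / pochhammer (real j + \<alpha> - 1) r)"
    using expect_pochhammer_subtree_size[OF assms, of r] by simp
  finally show ?thesis using p by simp
qed

lemma heavy_child_unique:
  assumes T: "recursive_tree n E" and "(k, v) \<in> E" "(k, w) \<in> E" "heavy n E v" "heavy n E w"
  shows "v = w"
proof (rule ccontr)
  assume "v \<noteq> w"
  note e = recursive_tree_edge[OF T assms(2)] recursive_tree_edge[OF T assms(3)]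
  have not_above: "(v', w') \<notin> E\<^sup>*" if h: "(k, v') \<in> E" "(k, w') \<in> E" "v' \<noteq> w'" for v' w'
  proof
    assume "(v', w') \<in> E\<^sup>*"
    then obtain y where y: "(v', y) \<in> E\<^sup>*" "(y, w') \<in> E" using h(3) by (auto elim: rtranclE)
    then have "y = k" using recursive_tree_unique_parent[OF T _ h(2)] by simp
    then have "k \<in> descendants E v'" using y by (simp add: descendants_def)
    moreover have "v' \<in> {1..n}" "k < v'" using recursive_tree_edge[OF T h(1)] by auto
    ultimately show False using descendants_subset[OF T, of v'] by auto
  qed
  obtain u where "(v, u) \<in> E\<^sup>*" "(w, u) \<in> E\<^sup>*"
    using heavy_intersect[OF T _ _ assms(4,5)] e by (auto simp: descendants_def)
  then show False
    using common_descendant_comparable[OF T, of v u w] not_above[of v w] not_above[of w v] assms(2,3) \<open>v \<noteq> w\<close> by simp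
qed

text \<open>
  A heavy node has at most one heavy child, and the parent of a heavy node is heavy.
\<close>
lemma last_heavy_indicator:
  assumes T: "recursive_tree n E" and k: "k \<in> {1..n}"
  shows "of_bool (last_heavy n E k) = of_bool (heavy n E k)
     - (\<Sum>j\<in>{Suc k..n}. of_bool ((k, j) \<in> E) * of_bool (heavy n E j) :: real)"
proof (cases "\<exists>j. (k, j) \<in> E \<and> heavy n E j")
  case True
  then obtain w where w: "(k, w) \<in> E" "heavy n E w" by blast
  have "heavy n E k" by (rule heavy_antimono[OF T k r_into_rtrancl[OF w(1)] w(2)])
  moreover have "(\<Sum>j\<in>{Suc k..n}. of_bool ((k, j) \<in> E) * of_bool (heavy n E j) :: real) = (\<Sum>j\<in>{Suc k..n}. if j = w then 1 else 0)"
  proof (rule sum.cong[OF refl])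
    fix j
    have "(k, j) \<in> E \<and> heavy n E j \<longleftrightarrow> j = w"
      using heavy_child_unique[OF T _ w(1) _ w(2), of j] w by blast
    then show "of_bool ((k, j) \<in> E) * of_bool (heavy n E j) = (if j = w then 1 else 0 :: real)"
      by (simp only: of_bool_conj[symmetric]) simp
  qed
  moreover have "\<dots> = 1" using recursive_tree_edge[OF T w(1)] by simp
  moreover have "\<not> last_heavy n E k" using w by (auto simp: last_heavy_def)
  ultimately show ?thesis by simp
next
  case False
  then have "last_heavy n E k \<longleftrightarrow> heavy n E k" using k unfolding last_heavy_def by blast
  moreover have "(\<Sum>j\<in>{Suc k..n}. of_bool ((k, j) \<in> E) * of_bool (heavy n E j) :: real) = 0"
    using False by (intro sum.neutral) auto
  ultimately show ?thesis by simp
qed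

lemma expect_last_heavy:
  assumes k: "1 \<le> k" "k \<le> n"
  shows "expect n (\<lambda>E. of_bool (last_heavy n E k)) =
     heavy_prob k n - (\<Sum>j\<in>{Suc k..n}. parent_prob j k * heavy_prob j n)"
proof -
  have n: "n \<ge> 1" using k by simp
  have "expect n (\<lambda>E. of_bool (last_heavy n E k)) =
    expect n (\<lambda>E. of_bool (heavy n E k) - (\<Sum>j\<in>{Suc k..n}. of_bool ((k, j) \<in> E) * of_bool (heavy n E j)))"
    by (rule expect_cong[OF n], rule last_heavy_indicator) (use k in auto)
  also have "\<dots> = expect n (\<lambda>E. of_bool (heavy n E k)) - expect n (\<lambda>E. \<Sum>j\<in>{Suc k..n}. of_bool ((k, j) \<in> E) * of_bool (heavy n E j))"
    using n by (intro Bochner_Integration.integral_diff) auto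
  finally have diff: "expect n (\<lambda>E. of_bool (last_heavy n E k)) = expect n (\<lambda>E. of_bool (heavy n E k))
     - expect n (\<lambda>E. \<Sum>j\<in>{Suc k..n}. of_bool ((k, j) \<in> E) * of_bool (heavy n E j))" .
  have "expect n (\<lambda>E. \<Sum>j\<in>{Suc k..n}. of_bool ((k, j) \<in> E) * of_bool (heavy n E j)) =
      (\<Sum>j\<in>{Suc k..n}. expect n (\<lambda>E. of_bool ((k, j) \<in> E) * of_bool (heavy n E j)))"
    using n by (intro Bochner_Integration.integral_sum) auto
  also have "\<dots> = (\<Sum>j\<in>{Suc k..n}. parent_prob j k * heavy_prob j n)"
  proof (rule sum.cong[OF refl])
    fix j assume j: "j \<in> {Suc k..n}"
    have "expect n (\<lambda>E. of_bool ((k, j) \<in> E) * of_bool (heavy n E j)) =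
        heavy_prob j n * expect j (\<lambda>E. of_bool ((k, j) \<in> E))"
      by (rule expect_heavy) (use j k in auto)
    then show "expect n (\<lambda>E. of_bool ((k, j) \<in> E) * of_bool (heavy n E j)) = parent_prob j k * heavy_prob j n"
      using expect_parent[of k j] j k by simp
  qed
  finally show ?thesis unfolding diff heavy_prob_eq[OF k] by simp
qed

subsection \<open>The limiting probability that a node is heavy\<close>

text \<open>
  The negative binomial probabilities with parameters \<open>\<alpha>\<close> and \<open>1/2\<close>.
\<close>
definition neg_binomial :: "nat \<Rightarrow> real" where
  "neg_binomial i = pochhammer \<alpha> i / fact i * 2 powr (- (\<alpha> + real i))"

lemma cdf_step_tendsto: "(\<lambda>n. cdf_step (Suc k) n (n div 2)) \<longlonglongrightarrow> neg_binomial k"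
proof -
  let ?b = "\<lambda>n. pochhammer \<alpha> n / fact n"
  have r: "(\<lambda>n. real (n - n div 2 - 1) / real n) \<longlonglongrightarrow> 1 / 2"
  proof -
    have l: "(\<lambda>n. 1 - real (n div 2) / real n - 1 / real n) \<longlonglongrightarrow> 1 - 1 / 2 - 0"
      by (rule tendsto_diff[OF tendsto_diff[OF tendsto_const half_over_tendsto] lim_const_over_n])
    have "\<forall>\<^sub>F n in sequentially. 1 - real (n div 2) / real n - 1 / real n = real (n - n div 2 - 1) / real n"
      using eventually_gt_at_top[of 0]
    proof eventually_elim
      case (elim n)
      have "real (n - n div 2 - 1) = real n - real (n div 2) - 1" using elim by (subst of_nat_diff; simp add: of_nat_diff)
      then show ?case using elim by (simp add: diff_divide_distrib add_divide_distrib)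
    qed
    from Lim_transform_eventually[OF l this] show ?thesis by simp
  qed
  have r1: "(\<lambda>n. real (n - 1) / real n) \<longlonglongrightarrow> 1" by real_asymp
  have lim: "(\<lambda>n. pochhammer \<alpha> k * (real (n div 2) / real n) * (?b (n div 2) / ?b (n - 1)) *
       (real ((n - n div 2 - 1) choose k) / real n ^ k) / (fact (Suc k) * (real ((n - 1) choose Suc k) / real n ^ Suc k)))
    \<longlonglongrightarrow> pochhammer \<alpha> k * (1 / 2) * (2 * (1 / 2) powr \<alpha>) * ((1 / 2) ^ k / fact k) / (fact (Suc k) * (1 ^ Suc k / fact (Suc k)))"
    by (rule tendsto_divide[OF tendsto_mult[OF tendsto_mult[OF tendsto_mult[OF tendsto_const half_over_tendsto]
          pochhammer_ratio_tendsto[OF \<alpha>_pos]] binomial_over_power_tendsto[OF r]]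
          tendsto_mult[OF tendsto_const binomial_over_power_tendsto[OF r1]]]) simp
  have val: "pochhammer \<alpha> k * (1 / 2) * (2 * (1 / 2) powr \<alpha>) * ((1 / 2) ^ k / fact k) / (fact (Suc k) * (1 ^ Suc k / fact (Suc k)))
      = neg_binomial k"
  proof -
    have "2 powr (- (\<alpha> + real k)) = (1 / 2) powr \<alpha> * (1 / 2) ^ k"
      by (rule two_powr_minus)
    then show ?thesis by (simp add: neg_binomial_def del: fact_Suc)
  qed
  have "\<forall>\<^sub>F n in sequentially. pochhammer \<alpha> k * (real (n div 2) / real n) * (?b (n div 2) / ?b (n - 1)) *
       (real ((n - n div 2 - 1) choose k) / real n ^ k) / (fact (Suc k) * (real ((n - 1) choose Suc k) / real n ^ Suc k))
     = cdf_step (Suc k) n (n div 2)"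
    using eventually_ge_at_top[of "k + 2"]
  proof eventually_elim
    case (elim n)
    define m where "m = n - k - 2"
    have m: "n - 1 = Suc (k + m)" "n - Suc k - 1 = m" using elim by (auto simp: m_def)
    have n: "n > 0" using elim by simp
    have "fact (Suc k) * fact m * (Suc (k + m) choose Suc k) = (fact (Suc (k + m)) :: nat)"
      using binomial_fact_lemma[of "Suc k" "Suc (k + m)"] by (simp del: fact_Suc binomial_Suc_Suc)
    from arg_cong[OF this, of real]
    have "fact (Suc k) * fact m * real (Suc (k + m) choose Suc k) = fact (Suc (k + m))"
      by (simp only: of_nat_mult of_nat_fact)
    then have B: "fact (Suc k) * real ((n - 1) choose Suc k) = fact (n - 1) / fact m"
      unfolding m by (simp add: field_simps del: fact_Suc binomial_Suc_Suc)
    have P: "pochhammer \<alpha> (n - 1) = pochhammer \<alpha> k * ((real (Suc k) + \<alpha> - 1) * pochhammer (real (Suc k) + \<alpha>) m)"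
      unfolding m add_Suc_right[symmetric] pochhammer_product'[of \<alpha> k "Suc m"] pochhammer_rec by (simp add: algebra_simps)
    have q: "real (Suc k) + \<alpha> - 1 > 0" using denominator_pos[of "Suc k"] by simp
    then have "real (Suc k) + \<alpha> > 0" by linarith
    note pos = q pochhammer_pos[OF \<alpha>_pos, of k] pochhammer_pos[OF this, of m]
    have D: "fact (Suc k) * (real ((n - 1) choose Suc k) / real n ^ Suc k) = fact (n - 1) / fact m / (real n * real n ^ k)"
      unfolding times_divide_eq_right B by simp
    have "p * (h / x) * (b / (p * (q * r) / F)) * (C / y) / (F / f / (x * y)) = h * b * C * (f / r) / q"
      if "p \<noteq> 0" "x \<noteq> 0" "y \<noteq> 0" "q \<noteq> 0" "r \<noteq> 0" "F \<noteq> 0" "f \<noteq> 0" for p h x b q r F C y f :: real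
      using that by (simp add: field_simps)
    note cancel = this
    show ?case
      unfolding cdf_step_def P D m(2) diff_Suc_1 by (rule cancel) (use n in \<open>simp_all only: pos[THEN less_imp_neq, symmetric] fact_nonzero power_not_zero of_nat_eq_0_iff simp_thms neq0_conv\<close>)
  qed
  from Lim_transform_eventually[OF lim this] show ?thesis unfolding val .
qed

text \<open>
  The probability that a negative binomial variable is at least \<open>j - 1\<close>.
\<close>
definition heavy_limit :: "nat \<Rightarrow> real" where
  "heavy_limit j = 1 - (\<Sum>i<j - 1. neg_binomial i)"

lemma heavy_prob_tendsto: "(\<lambda>n. heavy_prob j n) \<longlonglongrightarrow> heavy_limit j"
proof -
  have "{1..<j} = Suc ` {..<j - 1}"
    unfolding lessThan_atLeast0 image_Suc_atLeastLessThan by (cases j) auto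
  then have "heavy_prob j n = 1 - (\<Sum>i<j - 1. cdf_step (Suc i) n (n div 2))" for n
    by (simp add: heavy_prob_def sum.reindex)
  then show ?thesis
    unfolding heavy_limit_def
    by (simp only:) (rule tendsto_diff[OF tendsto_const tendsto_sum[OF cdf_step_tendsto]])
qed

text \<open>
  This uniform bound dominates all sums over labels that occur below.
\<close>
lemma heavy_prob_power_bound:
  obtains C where "C \<ge> 0" "\<And>j n. 1 \<le> j \<Longrightarrow> j \<le> n \<Longrightarrow> heavy_prob j n \<le> C / real j ^ r"
proof
  \<comment> \<open>The factors of \<open>pochhammer (j + \<alpha> - 1) r\<close> are at least \<open>\<delta> * j\<close>.\<close>
  define \<delta> where "\<delta> = min 1 \<alpha>"
  have \<delta>: "\<delta> > 0" using \<alpha>_pos by (simp add: \<delta>_def)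
  show "0 \<le> 2 ^ r * pochhammer \<alpha> r / \<delta> ^ r"
    using \<delta> pochhammer_pos[OF \<alpha>_pos, of r] by simp
  fix j n :: nat assume j: "1 \<le> j" "j \<le> n"
  have "\<delta> * real j \<le> real j + \<alpha> - 1"
  proof (cases "\<alpha> \<ge> 1")
    case False
    have "0 \<le> (real j - 1) * (1 - \<alpha>)" using j False by simp
    then show ?thesis using False by (simp add: \<delta>_def algebra_simps)
  qed (simp add: \<delta>_def)
  then have step: "\<delta> * real j \<le> real j + \<alpha> - 1 + real i" for i by (simp add: add_increasing2)
  have "(\<delta> * real j) ^ r \<le> pochhammer (real j + \<alpha> - 1) r"
  proof (induction r)
    case (Suc r)
    have "(\<delta> * real j) ^ r * (\<delta> * real j) \<le> pochhammer (real j + \<alpha> - 1) r * (real j + \<alpha> - 1 + real r)"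
      using Suc step[of r] \<delta> pochhammer_pos[OF denominator_pos[OF j(1)], of r] by (intro mult_mono) auto
    then show ?case by (simp add: pochhammer_Suc mult.commute)
  qed simp
  moreover have "0 < (\<delta> * real j) ^ r" using \<delta> j by simp
  moreover have "0 \<le> 2 ^ r * pochhammer \<alpha> r" using pochhammer_pos[OF \<alpha>_pos, of r] by simp
  ultimately have "2 ^ r * pochhammer \<alpha> r / pochhammer (real j + \<alpha> - 1) r \<le> 2 ^ r * pochhammer \<alpha> r / (\<delta> * real j) ^ r"
    by (intro divide_left_mono mult_pos_pos) auto
  with heavy_prob_bound[OF j, of r]
  show "heavy_prob j n \<le> 2 ^ r * pochhammer \<alpha> r / \<delta> ^ r / real j ^ r"
    by (simp add: power_mult_distrib)
qed

lemma heavy_limit_nonneg: "1 \<le> j \<Longrightarrow> 0 \<le> heavy_limit j"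
  using heavy_prob_nonneg[of j] by (intro LIMSEQ_le_const[OF heavy_prob_tendsto]) auto

lemma heavy_limit_power_bound:
  obtains C where "C \<ge> 0" "\<And>j. 1 \<le> j \<Longrightarrow> heavy_limit j \<le> C / real j ^ r"
proof -
  obtain C where C: "C \<ge> 0" "\<And>j n. 1 \<le> j \<Longrightarrow> j \<le> n \<Longrightarrow> heavy_prob j n \<le> C / real j ^ r"
    using heavy_prob_power_bound[of r] by metis
  have "heavy_limit j \<le> C / real j ^ r" if "1 \<le> j" for j
    using C(2)[OF that] by (intro LIMSEQ_le_const2[OF heavy_prob_tendsto]) auto
  with C(1) show ?thesis by (rule that)
qed

subsection \<open>The limiting distribution of the label\<close>

definition label_prob :: "nat \<Rightarrow> nat \<Rightarrow> real" where
  "label_prob n k = expect n (\<lambda>E. of_bool (last_heavy n E k))"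

text \<open>
  The limit of the probability that the centroid has label \<open>k\<close>, as it arises from the decomposition over
  the children of \<open>k\<close>. It is identified with \<open>limit_prob\<close> below.
\<close>
definition label_limit :: "nat \<Rightarrow> real" where
  "label_limit k = (if k = 0 then 0
     else heavy_limit k - (\<Sum>j. if k < j then parent_prob j k * heavy_limit j else 0))"

lemma label_prob_outside: "n \<ge> 1 \<Longrightarrow> k \<notin> {1..n} \<Longrightarrow> label_prob n k = 0"
proof -
  assume "n \<ge> 1" "k \<notin> {1..n}"
  then have "of_bool (last_heavy n E k) = (0 :: real)" for E by (auto simp: last_heavy_def)
  then show ?thesis by (simp only: label_prob_def expect_const)
qed

lemma label_prob_nonneg: "n \<ge> 1 \<Longrightarrow> 0 \<le> label_prob n k"
  unfolding label_prob_def using expect_mono[of n "\<lambda>_. 0" "\<lambda>E. of_bool (last_heavy n E k)"] by simp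

lemma label_prob_le: "1 \<le> k \<Longrightarrow> k \<le> n \<Longrightarrow> label_prob n k \<le> heavy_prob k n"
  unfolding label_prob_def heavy_prob_eq by (rule expect_mono) (auto simp: last_heavy_def)

lemma parent_term_tendsto:
  assumes k: "1 \<le> k"
  shows "(\<lambda>n. \<Sum>j\<in>{Suc k..n}. parent_prob j k * heavy_prob j n) \<longlonglongrightarrow>
           (\<Sum>j. if k < j then parent_prob j k * heavy_limit j else 0)"
    and "summable (\<lambda>j. if k < j then parent_prob j k * heavy_limit j else 0)"
proof -
  obtain C where C: "C \<ge> 0" "\<And>j n. 1 \<le> j \<Longrightarrow> j \<le> n \<Longrightarrow> heavy_prob j n \<le> C / real j ^ 2"
    using heavy_prob_power_bound[of 2] by metis
  define a where "a = (\<lambda>j n. if k < j \<and> j \<le> n then parent_prob j k * heavy_prob j n else 0)"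
  define b where "b = (\<lambda>j. if k < j then parent_prob j k * heavy_limit j else 0)"
  have lim: "(\<lambda>n. a j n) \<longlonglongrightarrow> b j" for j
  proof (cases "k < j")
    case True
    have "(\<lambda>n. parent_prob j k * heavy_prob j n) \<longlonglongrightarrow> parent_prob j k * heavy_limit j"
      by (intro tendsto_mult tendsto_const heavy_prob_tendsto)
    moreover have "\<forall>\<^sub>F n in sequentially. parent_prob j k * heavy_prob j n = a j n"
      using eventually_ge_at_top[of j] by eventually_elim (simp add: a_def True)
    ultimately have "(\<lambda>n. a j n) \<longlonglongrightarrow> parent_prob j k * heavy_limit j" by (rule Lim_transform_eventually)
    then show ?thesis by (simp add: b_def True)
  qed (simp add: a_def b_def)
  have bound: "norm (a j n) \<le> C / real j ^ 2" for j n
  proof (cases "k < j \<and> j \<le> n")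
    case True
    then have "\<bar>parent_prob j k\<bar> * \<bar>heavy_prob j n\<bar> \<le> 1 * (C / real j ^ 2)"
      using C(2)[of j n] heavy_prob_nonneg[of j n] parent_prob_nonneg[OF k, of j] parent_prob_le_1[OF k, of j]
      by (intro mult_mono) auto
    then show ?thesis using True by (simp add: a_def abs_mult)
  qed (use C(1) in \<open>auto simp: a_def\<close>)
  have "summable (\<lambda>j. C / real j ^ 2)"
    using summable_mult[OF inverse_power_summable[of 2], of C] by (simp add: divide_inverse)
  from tannerys_theorem[of a b, OF lim always_eventually this]
  have T: "summable (\<lambda>j. norm (b j))" "(\<lambda>n. suminf (\<lambda>j. a j n)) \<longlonglongrightarrow> suminf b"
    using bound by auto
  have "suminf (\<lambda>j. a j n) = (\<Sum>j\<in>{Suc k..n}. parent_prob j k * heavy_prob j n)" for n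
  proof -
    have "suminf (\<lambda>j. a j n) = (\<Sum>j\<in>{Suc k..n}. a j n)" by (rule suminf_finite) (auto simp: a_def)
    then show ?thesis by (simp add: a_def)
  qed
  then show "(\<lambda>n. \<Sum>j\<in>{Suc k..n}. parent_prob j k * heavy_prob j n) \<longlonglongrightarrow>
           (\<Sum>j. if k < j then parent_prob j k * heavy_limit j else 0)"
    using T(2) by (simp add: b_def)
  show "summable (\<lambda>j. if k < j then parent_prob j k * heavy_limit j else 0)"
    using summable_norm_cancel[OF T(1)] by (simp add: b_def)
qed

lemma label_prob_tendsto: "(\<lambda>n. label_prob n k) \<longlonglongrightarrow> label_limit k"
proof (cases "k = 0")
  case True
  have "\<forall>\<^sub>F n in sequentially. 0 = label_prob n k"
    using eventually_ge_at_top[of 1] by eventually_elim (simp add: label_prob_outside True)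
  from Lim_transform_eventually[OF tendsto_const this] show ?thesis by (simp add: label_limit_def True)
next
  case False
  then have k: "1 \<le> k" by simp
  have "\<forall>\<^sub>F n in sequentially. heavy_prob k n - (\<Sum>j\<in>{Suc k..n}. parent_prob j k * heavy_prob j n) = label_prob n k"
    using eventually_ge_at_top[of k] by eventually_elim (simp add: label_prob_def expect_last_heavy[OF k])
  from Lim_transform_eventually[OF tendsto_diff[OF heavy_prob_tendsto parent_term_tendsto(1)[OF k]] this]
  show ?thesis using False by (simp add: label_limit_def)
qed

lemma label_limit_nonneg: "0 \<le> label_limit k"
  by (rule LIMSEQ_le_const[OF label_prob_tendsto]) (use label_prob_nonneg in blast)

definition centre :: "nat \<Rightarrow> (nat \<times> nat) set \<Rightarrow> nat" where
  "centre n E = (THE k. last_heavy n E k)"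

lemma centre_eq:
  assumes "recursive_tree n E" "last_heavy n E k" shows "centre n E = k"
  unfolding centre_def using assms last_heavy_unique by blast

lemma expect_centre:
  assumes n: "n \<ge> 1"
  shows "expect n (\<lambda>E. f (centre n E)) = (\<Sum>k\<in>{1..n}. f k * label_prob n k)"
proof -
  have "expect n (\<lambda>E. f (centre n E)) = expect n (\<lambda>E. \<Sum>k\<in>{1..n}. f k * of_bool (last_heavy n E k))"
  proof (rule expect_cong[OF n])
    fix E assume T: "recursive_tree n E"
    obtain c where c: "last_heavy n E c" using last_heavy_arg_min[OF T] by blast
    have pointwise: "f k * of_bool (last_heavy n E k) = (if k = c then f c else 0)" for k
      using c last_heavy_unique[OF T c, of k] by (cases "k = c") auto
    have "(\<Sum>k\<in>{1..n}. f k * of_bool (last_heavy n E k)) = f c"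
    proof -
      have "(\<Sum>k\<in>{1..n}. f k * of_bool (last_heavy n E k)) = (\<Sum>k\<in>{1..n}. if k = c then f c else 0)"
        by (rule sum.cong[OF refl pointwise])
      also have "\<dots> = (if c \<in> {1..n} then f c else 0)" by (rule sum.delta) simp
      finally show ?thesis using c unfolding last_heavy_def by simp
    qed
    then show "f (centre n E) = (\<Sum>k\<in>{1..n}. f k * of_bool (last_heavy n E k))"
      using centre_eq[OF T c] by simp
  qed
  also have "\<dots> = (\<Sum>k\<in>{1..n}. expect n (\<lambda>E. f k * of_bool (last_heavy n E k)))"
    using n by (intro Bochner_Integration.integral_sum) auto
  finally show ?thesis by (simp add: label_prob_def)
qed

text \<open>
  Tannery's theorem, with the bound \<open>P(L = k) \<le> P(k heavy) \<le> C / k ^ (p + 2)\<close>.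
\<close>
lemma expect_centre_tendsto:
  assumes f: "\<And>k. \<bar>f k\<bar> \<le> K * real k ^ p"
  shows "summable (\<lambda>k. norm (f k * label_limit k))"
    and "(\<lambda>n. expect n (\<lambda>E. f (centre n E))) \<longlonglongrightarrow> (\<Sum>k. f k * label_limit k)"
proof -
  obtain C where C: "C \<ge> 0" "\<And>j n. 1 \<le> j \<Longrightarrow> j \<le> n \<Longrightarrow> heavy_prob j n \<le> C / real j ^ (p + 2)"
    using heavy_prob_power_bound[of "p + 2"] by metis
  have K: "K \<ge> 0" using f[of 1] by simp
  define a where "a = (\<lambda>k n. if n \<ge> 1 then f k * label_prob n k else 0)"
  have lim: "(\<lambda>n. a k n) \<longlonglongrightarrow> f k * label_limit k" for k
  proof (rule Lim_transform_eventually)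
    show "(\<lambda>n. f k * label_prob n k) \<longlonglongrightarrow> f k * label_limit k"
      by (intro tendsto_mult tendsto_const label_prob_tendsto)
    show "\<forall>\<^sub>F n in sequentially. f k * label_prob n k = a k n"
      using eventually_ge_at_top[of 1] by eventually_elim (simp add: a_def)
  qed
  have bound: "norm (a k n) \<le> K * C / real k ^ 2" for k n
  proof (cases "k \<in> {1..n}")
    case True
    then have "\<bar>f k\<bar> * \<bar>label_prob n k\<bar> \<le> (K * real k ^ p) * (C / real k ^ (p + 2))"
      using C(2)[of k n] label_prob_le[of k n] label_prob_nonneg[of n k] f[of k]
      by (intro mult_mono) auto
    also have "\<dots> = K * C / real k ^ 2" using True by (simp add: power_add power2_eq_square)
    finally show ?thesis using True by (simp add: a_def abs_mult)
  next
    case False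
    then have "a k n = 0" using label_prob_outside[of n k] by (auto simp: a_def)
    then show ?thesis using K C(1) by simp
  qed
  have "summable (\<lambda>j. K * C / real j ^ 2)"
    using summable_mult[OF inverse_power_summable[of 2], of "K * C"] by (simp add: divide_inverse)
  from tannerys_theorem[of a, OF lim always_eventually this]
  have T: "summable (\<lambda>k. norm (f k * label_limit k))" "(\<lambda>n. suminf (\<lambda>k. a k n)) \<longlonglongrightarrow> (\<Sum>k. f k * label_limit k)"
    using bound by auto
  have "\<forall>\<^sub>F n in sequentially. suminf (\<lambda>k. a k n) = expect n (\<lambda>E. f (centre n E))"
    using eventually_ge_at_top[of 1]
  proof eventually_elim
    case (elim n)
    have "suminf (\<lambda>k. a k n) = (\<Sum>k\<in>{1..n}. a k n)"
      by (rule suminf_finite) (use elim label_prob_outside in \<open>auto simp: a_def\<close>)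
    then show ?case using elim by (simp add: expect_centre a_def)
  qed
  from Lim_transform_eventually[OF T(2) this]
  show "(\<lambda>n. expect n (\<lambda>E. f (centre n E))) \<longlonglongrightarrow> (\<Sum>k. f k * label_limit k)" .
  show "summable (\<lambda>k. norm (f k * label_limit k))" by (rule T(1))
qed

lemma label_limit_sums_1: "label_limit sums 1"
proof -
  have b: "\<bar>1 :: real\<bar> \<le> 1 * real k ^ 0" for k by simp
  have "(\<lambda>n. expect n (\<lambda>E. 1)) \<longlonglongrightarrow> (\<Sum>k. 1 * label_limit k)"
    by (rule expect_centre_tendsto(2)[OF b])
  then have "suminf label_limit = 1" by (simp add: LIMSEQ_unique tendsto_const_iff)
  moreover have "summable label_limit"
    using summable_norm_cancel[OF expect_centre_tendsto(1)[OF b]] by simp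
  ultimately show ?thesis by (metis summable_sums)
qed

subsection \<open>The negative binomial distribution\<close>

lemma neg_binomial_Suc:
  "neg_binomial (Suc i) = neg_binomial i * ((\<alpha> + real i) / real (Suc i)) / 2"
proof -
  have "2 powr (- (\<alpha> + real (Suc i))) = 2 powr (- (\<alpha> + real i)) / (2 :: real)"
    unfolding two_powr_minus by simp
  then show ?thesis unfolding neg_binomial_def by (simp only: pochhammer_Suc fact_Suc) (simp add: mult_ac)
qed

text \<open>
  Dividing out the rising factorial of \<open>\<alpha>\<close> shifts the parameter from \<open>\<alpha>\<close> to \<open>\<alpha> + m\<close>, and the remaining sum
  is the generalised binomial series at \<open>-1/2\<close>.
\<close>
lemma sums_falling_factorial_neg_binomial:
  "(\<lambda>k. falling_factorial (real k) m * neg_binomial k) sums pochhammer \<alpha> m"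
proof -
  define \<beta> where "\<beta> = \<alpha> + real m"
  have "(\<lambda>r. (- \<beta> gchoose r) * (- 1 / 2) ^ r) sums (1 + (- 1 / 2)) powr (- \<beta>)"
    by (rule gen_binomial_real) simp
  moreover have "(- \<beta> gchoose r) * (- 1 / 2) ^ r = pochhammer \<beta> r / fact r * (1 / 2) ^ r" for r
    by (simp add: gbinomial_pochhammer power_mult_distrib[symmetric])
  ultimately have "(\<lambda>r. pochhammer \<beta> r / fact r * (1 / 2) ^ r) sums (1 / 2) powr (- \<beta>)" by simp
  note * = sums_mult[OF this, of "pochhammer \<alpha> m * (1 / 2) powr \<beta>"]
  have "(\<lambda>r. pochhammer \<alpha> m * (1 / 2) powr \<beta> * (pochhammer \<beta> r / fact r * (1 / 2) ^ r)) sums pochhammer \<alpha> m"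
  proof -
    have "pochhammer \<alpha> m * (1 / 2) powr \<beta> * (1 / 2) powr (- \<beta>) = pochhammer \<alpha> m"
      by (simp add: powr_minus del: power_divide)
    with * show ?thesis by (simp only:)
  qed
  moreover have "pochhammer \<alpha> m * (1 / 2) powr \<beta> * (pochhammer \<beta> r / fact r * (1 / 2) ^ r) =
      falling_factorial (real (r + m)) m * neg_binomial (r + m)" for r
  proof -
    have "\<alpha> + real (r + m) = \<beta> + real r" by (simp add: \<beta>_def)
    then have "neg_binomial (r + m) = pochhammer \<alpha> (m + r) / fact (r + m) * ((1 / 2) powr \<beta> * (1 / 2) ^ r)"
      by (simp only: neg_binomial_def two_powr_minus add.commute)
    then show ?thesis
      by (simp only: falling_factorial_of_nat pochhammer_product' \<beta>_def) simp
  qed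
  ultimately have "(\<lambda>r. falling_factorial (real (r + m)) m * neg_binomial (r + m)) sums pochhammer \<alpha> m" by simp
  then show ?thesis
    by (subst (asm) sums_zero_iff_shift) (auto simp: falling_factorial_of_nat_0)
qed

lemma sums_falling_factorial_Suc_neg_binomial:
  "(\<lambda>k. falling_factorial (real (Suc k)) (Suc m) * neg_binomial k) sums
     (pochhammer \<alpha> (Suc m) + real (Suc m) * pochhammer \<alpha> m)"
proof -
  have "falling_factorial (real (Suc k)) (Suc m) * neg_binomial k =
      falling_factorial (real k) (Suc m) * neg_binomial k + real (Suc m) * (falling_factorial (real k) m * neg_binomial k)" for k
    using falling_factorial_plus_1[of "real k" m] by (simp add: algebra_simps)
  then show ?thesis
    using sums_add[OF sums_falling_factorial_neg_binomial[of "Suc m"]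
        sums_mult[OF sums_falling_factorial_neg_binomial[of m], of "real (Suc m)"]] by simp
qed

lemma heavy_limit_Suc: "heavy_limit (Suc (Suc k)) = heavy_limit (Suc k) - neg_binomial k"
  by (simp add: heavy_limit_def)

lemma power_heavy_limit_tendsto_0:
  "(\<lambda>k. real k ^ m * heavy_limit k) \<longlonglongrightarrow> 0"
proof -
  obtain C where C: "C \<ge> 0" "\<And>j. 1 \<le> j \<Longrightarrow> heavy_limit j \<le> C / real j ^ (m + 1)"
    using heavy_limit_power_bound[of "m + 1"] by metis
  show ?thesis
  proof (rule tendsto_sandwich[OF _ _ tendsto_const lim_const_over_n])
    show "\<forall>\<^sub>F k in sequentially. 0 \<le> real k ^ m * heavy_limit k"
      using eventually_ge_at_top[of 1] by eventually_elim (simp add: heavy_limit_nonneg)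
    show "\<forall>\<^sub>F k in sequentially. real k ^ m * heavy_limit k \<le> C / real k"
      using eventually_ge_at_top[of 1]
    proof eventually_elim
      case (elim k)
      have "real k ^ m * heavy_limit k \<le> real k ^ m * (C / real k ^ (m + 1))"
        using C(2)[OF elim] by (intro mult_left_mono) auto
      then show ?case using elim by simp
    qed
  qed
qed

lemma falling_factorial_heavy_limit_tendsto_0:
  assumes "\<And>k. 0 \<le> T k" "\<And>k. 1 \<le> k \<Longrightarrow> T k \<le> heavy_limit k"
  shows "(\<lambda>k. falling_factorial (real k) m * T k) \<longlonglongrightarrow> 0"
proof (rule tendsto_sandwich[OF _ _ tendsto_const power_heavy_limit_tendsto_0[of m]])
  show "\<forall>\<^sub>F k in sequentially. 0 \<le> falling_factorial (real k) m * T k"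
    using falling_factorial_nonneg assms(1) by simp
  show "\<forall>\<^sub>F k in sequentially. falling_factorial (real k) m * T k \<le> real k ^ m * heavy_limit k"
    using eventually_ge_at_top[of 1]
    by eventually_elim (intro mult_mono falling_factorial_le_power assms falling_factorial_nonneg; simp)
qed

text \<open>
  For a tail \<open>T\<close> of a series with terms \<open>r\<close>, the falling factorials of order \<open>m\<close> are the differences of those
  of order \<open>m + 1\<close>, up to a constant.
\<close>
lemma sums_by_parts_falling:
  assumes T: "\<And>k. T (Suc k) = T k - r k" "\<And>k. 0 \<le> T k" "\<And>k. 1 \<le> k \<Longrightarrow> T k \<le> heavy_limit k"
    and sums: "(\<lambda>k. falling_factorial (real (Suc k)) (Suc m) * r k) sums s"
  shows "(\<lambda>k. falling_factorial (real k) m * T k) sums (s / real (Suc m))"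
proof -
  define F where "F = (\<lambda>k. falling_factorial (real k) (Suc m) / real (Suc m))"
  have "F (Suc k) - F k = falling_factorial (real k) m" for k
    using falling_factorial_plus_1[of "real k" m]
    by (simp add: F_def diff_divide_distrib[symmetric] add.commute del: of_nat_Suc) (simp add: add.commute)
  moreover have "F 0 = 0" using falling_factorial_of_nat_0[of 0 "Suc m"] by (simp add: F_def)
  moreover have "(\<lambda>k. F k * T k) \<longlonglongrightarrow> 0"
    using tendsto_divide[OF falling_factorial_heavy_limit_tendsto_0[OF T(2,3), of "Suc m"] tendsto_const[of "real (Suc m)"]]
    by (simp add: F_def)
  moreover have "(\<lambda>k. F (Suc k) * r k) sums (s / real (Suc m))"
    using sums_divide[OF sums, of "real (Suc m)"] by (simp add: F_def)
  ultimately show ?thesis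
    using summation_by_parts[of T r F, OF T(1)] by simp
qed

lemma sums_falling_factorial_tail:
  "(\<lambda>k. falling_factorial (real k) m * heavy_limit (Suc k)) sums
     ((pochhammer \<alpha> (Suc m) + real (Suc m) * pochhammer \<alpha> m) / real (Suc m))"
proof (rule sums_by_parts_falling[OF _ _ _ sums_falling_factorial_Suc_neg_binomial])
  show "heavy_limit (Suc (Suc k)) = heavy_limit (Suc k) - neg_binomial k" for k by (rule heavy_limit_Suc)
  show "0 \<le> heavy_limit (Suc k)" for k by (rule heavy_limit_nonneg) simp
  show "heavy_limit (Suc k) \<le> heavy_limit k" if "1 \<le> k" for k
  proof -
    have "0 \<le> neg_binomial i" for i
      using pochhammer_pos[OF \<alpha>_pos, of i] by (simp add: neg_binomial_def)
    then show ?thesis using that heavy_limit_Suc[of "k - 1"] by simp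
  qed
qed

lemma inc_beta_half:
  assumes k: "k \<ge> 1"
  shows "inc_beta (1 / 2) (real k) \<alpha> = heavy_limit (Suc k)"
proof -
  let ?I = "integral {0..1 / 2} (\<lambda>t. t powr (real k - 1) * (1 - t) powr (\<alpha> - 1))"
  have P: "pochhammer \<alpha> k / fact (k - 1) > 0" using pochhammer_pos[OF \<alpha>_pos, of k] by simp
  have "((\<lambda>t. pochhammer \<alpha> k / fact (k - 1) * (t powr (real k - 1) * (1 - t) powr (\<alpha> - 1))) has_integral
     (1 - (\<Sum>i<k. pochhammer \<alpha> i / fact i * ((1 - 1 / 2) powr \<alpha> * (1 / 2) ^ i)))) {0..1 / 2}"
    by (rule has_integral_beta_antiderivative[OF \<alpha>_pos _ _ k]) auto
  then have "integral {0..1 / 2} (\<lambda>t. pochhammer \<alpha> k / fact (k - 1) * (t powr (real k - 1) * (1 - t) powr (\<alpha> - 1))) =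
     1 - (\<Sum>i<k. pochhammer \<alpha> i / fact i * ((1 - 1 / 2) powr \<alpha> * (1 / 2) ^ i))"
    by (rule integral_unique)
  also have "\<dots> = heavy_limit (Suc k)"
  proof -
    have "neg_binomial i = pochhammer \<alpha> i / fact i * ((1 / 2) powr \<alpha> * (1 / 2) ^ i)" for i
      by (simp only: neg_binomial_def two_powr_minus)
    then show ?thesis by (simp add: heavy_limit_def)
  qed
  finally have "pochhammer \<alpha> k / fact (k - 1) * ?I = heavy_limit (Suc k)" by simp
  moreover have "1 / Beta (real k) \<alpha> = pochhammer \<alpha> k / fact (k - 1)"
  proof -
    have "\<alpha> \<notin> \<int>\<^sub>\<le>\<^sub>0" using \<alpha>_pos nonpos_Ints_nonpos[of \<alpha>] by auto
    then have "pochhammer \<alpha> k = Gamma (\<alpha> + real k) / Gamma \<alpha>" by (rule pochhammer_Gamma)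
    moreover have "Gamma (real k) = fact (k - 1)"
      using k Gamma_fact[of "k - 1", where 'a = real] by (simp add: of_nat_diff)
    ultimately show ?thesis by (simp add: Beta_def add.commute)
  qed
  ultimately show ?thesis by (simp add: inc_beta_def)
qed

lemma gchoose_neg_binomial:
  assumes k: "k \<ge> 1"
  shows "((\<alpha> + real k - 2) gchoose (k - 1)) * 2 powr (- (\<alpha> + real k - 1)) = neg_binomial (k - 1)"
proof -
  have "\<alpha> + real k - 2 - real (k - 1) + 1 = \<alpha>" using k by (simp add: of_nat_diff)
  moreover have "\<alpha> + real k - 1 = \<alpha> + real (k - 1)" using k by (simp add: of_nat_diff)
  ultimately show ?thesis by (simp only: gbinomial_pochhammer' neg_binomial_def)
qed

text \<open>
  With \<open>u i\<close> as in the proof, the probability that \<open>k\<close> is the parent of \<open>k + 1 + i\<close> is a multiple of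
  \<open>u i - u (i + 1)\<close>. Summation by parts leaves the products of \<open>u\<close> with negative binomial probabilities,
  and these form a geometric series because the quotients of gamma factors cancel.
\<close>
lemma parent_sum:
  assumes \<alpha>1: "\<alpha> \<noteq> 1" and k: "k \<ge> 1"
  shows "(\<Sum>j. if k < j then parent_prob j k * heavy_limit j else 0) =
     \<alpha> / (\<alpha> - 1) * (heavy_limit (Suc k) - neg_binomial (k - 1))"
proof -
  define u where "u = (\<lambda>i. \<Prod>l\<in>{k..<k + i}. real l / (real l + \<alpha> - 1))"
  define T where "T = (\<lambda>i. heavy_limit (Suc (k + i)))"
  have T_Suc: "T (Suc i) = T i - neg_binomial (k + i)" for i
    using heavy_limit_Suc[of "k + i"] by (simp add: T_def)
  have den: "real k + real i + \<alpha> - 1 > 0" for i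
    using denominator_pos[of "k + i"] k by simp
  have u_Suc: "u (Suc i) = u i * ((real k + real i) / (real k + real i + \<alpha> - 1))" for i
    by (simp add: u_def prod.atLeastLessThan_Suc)
  have pi: "parent_prob (i + Suc k) k = \<alpha> * u i / (real k + real i + \<alpha> - 1)" for i
    by (simp add: parent_prob_def u_def algebra_simps)
  have pi': "parent_prob (i + Suc k) k = \<alpha> / (\<alpha> - 1) * (u i - u (Suc i))" for i
  proof -
    have "a * x / d = a / e * (x - x * (b / d))" if "d \<noteq> 0" "e \<noteq> 0" "d - b = e" for a x d e b :: real
      using that by (simp add: field_simps)
    from this[of "real k + real i + \<alpha> - 1" "\<alpha> - 1" "real k + real i" \<alpha> "u i"]
    show ?thesis unfolding pi u_Suc using den[of i] \<alpha>1 by simp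
  qed
  have geometric: "neg_binomial (k + i) * u (Suc i) = neg_binomial (k - 1) * (1 / 2) ^ Suc i" for i
  proof -
    have step: "neg_binomial (k + i) * u (Suc i) = neg_binomial (k + i - 1) * u i / 2" for i
    proof -
      have nb: "neg_binomial (k + i) = neg_binomial (k + i - 1) * ((real k + real i + \<alpha> - 1) / (real k + real i)) / 2"
        using neg_binomial_Suc[of "k + i - 1"] k by (simp add: of_nat_diff algebra_simps)
      have cancel: "b * (d / x) / 2 * (w * (x / d)) = b * w / 2" if "x \<noteq> 0" "d \<noteq> 0" for b d x w :: real
        using that by simp
      show ?thesis unfolding u_Suc nb by (rule cancel) (use den[of i] k in auto)
    qed
    show ?thesis
    proof (induction i)
      case 0
      show ?case unfolding step[of 0] by (simp add: u_def)
    next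
      case (Suc i)
      show ?case unfolding step[of "Suc i"] using Suc by (simp add: mult.commute)
    qed
  qed
  have lim: "(\<lambda>i. T i * u i) \<longlonglongrightarrow> 0"
  proof (rule tendsto_sandwich[OF _ _ tendsto_const])
    \<comment> \<open>As \<open>parent_prob\<close> is at most \<open>1\<close>, the sequence \<open>u\<close> grows at most linearly with slope \<open>D\<close>.\<close>
    define D where "D = (1 + \<alpha>) / \<alpha>"
    have upper: "(\<lambda>i. D * (real (i + Suc k) ^ 1 * heavy_limit (i + Suc k))) \<longlonglongrightarrow> D * 0"
      by (intro tendsto_mult tendsto_const LIMSEQ_ignore_initial_segment[OF power_heavy_limit_tendsto_0])
    then show "(\<lambda>i. D * (real (i + Suc k) ^ 1 * heavy_limit (i + Suc k))) \<longlonglongrightarrow> 0" by simp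
    have u0: "0 \<le> u i" for i
      unfolding u_def using k denominator_pos by (intro prod_nonneg) (auto intro!: divide_nonneg_pos)
    have T0: "0 \<le> T i" for i unfolding T_def by (rule heavy_limit_nonneg) simp
    show "\<forall>\<^sub>F i in sequentially. 0 \<le> T i * u i" using u0 T0 by simp
    show "\<forall>\<^sub>F i in sequentially. T i * u i \<le> D * (real (i + Suc k) ^ 1 * heavy_limit (i + Suc k))"
    proof (rule always_eventually, rule allI)
      fix i
      have "\<alpha> * u i / (real k + real i + \<alpha> - 1) \<le> 1"
        using parent_prob_le_1[OF k, of "i + Suc k"] by (simp add: pi[symmetric])
      then have "\<alpha> * u i \<le> real k + real i + \<alpha> - 1" using den[of i] by (simp add: divide_le_eq)
      also have "\<dots> \<le> (1 + \<alpha>) * real (i + Suc k)"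
        using \<alpha>_pos mult_nonneg_nonneg[of \<alpha> "real k + real i"] by (simp add: algebra_simps)
      finally have "u i \<le> D * real (i + Suc k)" using \<alpha>_pos by (simp add: D_def field_simps)
      then have "T i * u i \<le> T i * (D * real (i + Suc k))" using T0 by (intro mult_left_mono)
      then show "T i * u i \<le> D * (real (i + Suc k) ^ 1 * heavy_limit (i + Suc k))"
        by (simp add: T_def add.commute mult_ac)
    qed
  qed
  have "(\<lambda>i. T i * u i - T (Suc i) * u (Suc i)) sums (T 0 * u 0 - 0)"
    by (rule telescope_sums'[OF lim])
  moreover have "(\<lambda>i. neg_binomial (k - 1) * (1 / 2) ^ Suc i) sums (neg_binomial (k - 1) * 1)"
    by (intro sums_mult power_half_series)
  ultimately have "(\<lambda>i. T i * u i - T (Suc i) * u (Suc i) - neg_binomial (k - 1) * (1 / 2) ^ Suc i) sums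
      (T 0 * u 0 - 0 - neg_binomial (k - 1) * 1)"
    by (rule sums_diff)
  moreover have "T i * u i - T (Suc i) * u (Suc i) - neg_binomial (k - 1) * (1 / 2) ^ Suc i = T i * (u i - u (Suc i))" for i
    unfolding geometric[symmetric] T_Suc by (simp add: algebra_simps)
  ultimately have "(\<lambda>i. T i * (u i - u (Suc i))) sums (heavy_limit (Suc k) - neg_binomial (k - 1))"
    by (simp add: T_def u_def)
  from sums_mult[OF this, of "\<alpha> / (\<alpha> - 1)"]
  have "(\<lambda>i. \<alpha> / (\<alpha> - 1) * (T i * (u i - u (Suc i)))) sums
     (\<alpha> / (\<alpha> - 1) * (heavy_limit (Suc k) - neg_binomial (k - 1)))" .
  moreover have "\<alpha> / (\<alpha> - 1) * (T i * (u i - u (Suc i))) = parent_prob (i + Suc k) k * heavy_limit (i + Suc k)" for i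
    unfolding pi' T_def by (simp add: add.commute)
  ultimately have "(\<lambda>i. if k < i + Suc k then parent_prob (i + Suc k) k * heavy_limit (i + Suc k) else 0) sums
     (\<alpha> / (\<alpha> - 1) * (heavy_limit (Suc k) - neg_binomial (k - 1)))" by simp
  then have "(\<lambda>j. if k < j then parent_prob j k * heavy_limit j else 0) sums
     (\<alpha> / (\<alpha> - 1) * (heavy_limit (Suc k) - neg_binomial (k - 1)))"
    by (subst (asm) sums_zero_iff_shift) auto
  then show ?thesis by (rule sums_unique[symmetric])
qed

lemma label_limit_neq_1:
  assumes "\<alpha> \<noteq> 1" "k \<ge> 1"
  shows "label_limit k = - (1 / (\<alpha> - 1)) * heavy_limit (Suc k) + (1 + \<alpha> / (\<alpha> - 1)) * neg_binomial (k - 1)"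
proof -
  have "heavy_limit k = heavy_limit (Suc k) + neg_binomial (k - 1)"
    using heavy_limit_Suc[of "k - 1"] assms by simp
  then have "label_limit k = heavy_limit (Suc k) + neg_binomial (k - 1)
      - \<alpha> / (\<alpha> - 1) * (heavy_limit (Suc k) - neg_binomial (k - 1))"
    using assms by (simp add: label_limit_def parent_sum)
  moreover have "\<alpha> / (\<alpha> - 1) = 1 + 1 / (\<alpha> - 1)" using assms(1) by (simp add: field_simps)
  ultimately show ?thesis by (simp only:) (simp add: algebra_simps)
qed

subsection \<open>The case of recursive trees\<close>

lemma neg_binomial_1: "\<alpha> = 1 \<Longrightarrow> neg_binomial k = (1 / 2) ^ Suc k"
  unfolding neg_binomial_def two_powr_minus by (simp add: pochhammer_fact[symmetric])

lemma heavy_limit_1: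
  assumes "\<alpha> = 1"
  shows "heavy_limit (Suc k) = (1 / 2) ^ k"
proof (induction k)
  case (Suc k)
  show ?case unfolding heavy_limit_Suc Suc neg_binomial_1[OF assms] by simp
qed (simp add: heavy_limit_def)

text \<open>
  For recursive trees the parent of \<open>j\<close> is uniform among the \<open>j - 1\<close> older nodes and the negative binomial
  distribution is geometric.
\<close>
lemma label_limit_1:
  assumes "\<alpha> = 1" "k \<ge> 1"
  shows "label_limit k = (1 / 2) ^ (k - 1) - harmonic_tail k"
proof -
  have pi: "parent_prob (Suc j) k = 1 / real j" if "k \<le> j" for j
  proof -
    have "(\<Prod>l\<in>{k..<j}. real l / (real l + \<alpha> - 1)) = 1"
      by (rule prod.neutral) (use assms in auto)
    then show ?thesis unfolding parent_prob_def diff_Suc_1 using assms(1) by simp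
  qed
  let ?f = "\<lambda>j. if k < j then parent_prob j k * heavy_limit j else 0"
  have "?f (Suc j) = (if k \<le> j then (1 / 2) ^ j / real j else 0)" for j
    by (auto simp: pi heavy_limit_1[OF assms(1)] less_Suc_eq_le)
  then have "(\<lambda>j. ?f (Suc j)) sums harmonic_tail k"
    unfolding harmonic_tail_def using summable_sums[OF summable_harmonic[of k]] by simp
  then have "?f sums harmonic_tail k" by (subst (asm) sums_Suc_iff) simp
  then have "suminf ?f = harmonic_tail k" by (rule sums_unique[symmetric])
  moreover have "heavy_limit k = (1 / 2) ^ (k - 1)" using heavy_limit_1[OF assms(1), of "k - 1"] assms(2) by simp
  ultimately show ?thesis using assms(2) by (simp add: label_limit_def)
qed

lemma limit_prob_eq: "limit_prob \<alpha> k = label_limit k"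
proof (cases "k = 0")
  case False
  then have k: "k \<ge> 1" by simp
  show ?thesis
  proof (cases "\<alpha> = 1")
    case True
    show ?thesis unfolding label_limit_1[OF True k] using True k by (simp add: limit_prob_def infsum_harmonic)
  next
    case False
    then show ?thesis
      unfolding limit_prob_def inc_beta_half[OF k] label_limit_neq_1[OF False k] gchoose_neg_binomial[OF k, symmetric]
      using k by (simp add: mult.assoc)
  qed
qed (simp add: limit_prob_def label_limit_def)

subsection \<open>Factorial moments of the limit\<close>

text \<open>
  The limit is a linear combination of the tails and the shifted probabilities of the negative binomial
  distribution, whose factorial moments are known.
\<close>
lemma factorial_moment_neq_1:
  assumes "\<alpha> \<noteq> 1"
  shows "(\<lambda>k. falling_factorial (real k) (Suc m) * label_limit k) sums
     ((4 * real (Suc m) ^ 2 + 2 * \<alpha> * real (Suc m) + \<alpha> - 2) / (real (Suc m) + 1) * pochhammer \<alpha> m)"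
proof -
  let ?f = "\<lambda>k. falling_factorial (real k) (Suc m)"
  define M where "M = real (Suc m)"
  define p where "p = pochhammer \<alpha> m"
  have p1: "pochhammer \<alpha> (Suc m) = p * (\<alpha> + M - 1)" by (simp add: p_def M_def pochhammer_Suc)
  have p2: "pochhammer \<alpha> (Suc (Suc m)) = p * (\<alpha> + M - 1) * (\<alpha> + M)"
    unfolding pochhammer_Suc[of \<alpha> "Suc m"] p1 by (simp add: M_def)
  have M: "M > 0" "real (Suc (Suc m)) = M + 1" by (simp_all add: M_def)
  have "(\<lambda>k. ?f k * heavy_limit (Suc k)) sums ((p * (\<alpha> + M - 1) * (\<alpha> + M) + (M + 1) * (p * (\<alpha> + M - 1))) / (M + 1))"
    using sums_falling_factorial_tail[of "Suc m"] unfolding p1 p2 M(2) .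
  moreover have "(\<lambda>k. ?f k * neg_binomial (k - 1)) sums (p * (\<alpha> + M - 1) + M * p)"
    using sums_shift_1[OF sums_falling_factorial_Suc_neg_binomial[of m]] unfolding p1 p_def[symmetric] M_def[symmetric] .
  ultimately have "(\<lambda>k. - (1 / (\<alpha> - 1)) * (?f k * heavy_limit (Suc k)) + (1 + \<alpha> / (\<alpha> - 1)) * (?f k * neg_binomial (k - 1))) sums
      (- (1 / (\<alpha> - 1)) * ((p * (\<alpha> + M - 1) * (\<alpha> + M) + (M + 1) * (p * (\<alpha> + M - 1))) / (M + 1))
       + (1 + \<alpha> / (\<alpha> - 1)) * (p * (\<alpha> + M - 1) + M * p))"
    by (intro sums_add sums_mult)
  moreover have "- (1 / (\<alpha> - 1)) * (?f k * heavy_limit (Suc k)) + (1 + \<alpha> / (\<alpha> - 1)) * (?f k * neg_binomial (k - 1))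
      = ?f k * label_limit k" for k
  proof (cases "k = 0")
    case True
    then show ?thesis using falling_factorial_of_nat_0[of 0 "Suc m"] by simp
  next
    case False
    then have k: "1 \<le> k" by simp
    show ?thesis unfolding label_limit_neq_1[OF assms k] by (simp add: algebra_simps)
  qed
  moreover have "- (1 / (\<alpha> - 1)) * ((p * (\<alpha> + M - 1) * (\<alpha> + M) + (M + 1) * (p * (\<alpha> + M - 1))) / (M + 1))
       + (1 + \<alpha> / (\<alpha> - 1)) * (p * (\<alpha> + M - 1) + M * p)
     = (4 * M ^ 2 + 2 * \<alpha> * M + \<alpha> - 2) / (M + 1) * p"
  proof -
    define Y Z where "Y = p * (\<alpha> + M - 1) * (\<alpha> + M) + (M + 1) * (p * (\<alpha> + M - 1))" and "Z = p * (\<alpha> + M - 1) + M * p"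
    have "- (1 / e) * (Y / N) + (1 + a / e) * Z = ((e + a) * Z * N - Y) / (e * N)" if "e \<noteq> 0" "N \<noteq> 0" for e N a Y Z :: real
      using that by (simp add: field_simps)
    then have "- (1 / (\<alpha> - 1)) * (Y / (M + 1)) + (1 + \<alpha> / (\<alpha> - 1)) * Z =
        ((\<alpha> - 1 + \<alpha>) * Z * (M + 1) - Y) / ((\<alpha> - 1) * (M + 1))"
      using assms M(1) by simp
    also have "(\<alpha> - 1 + \<alpha>) * Z * (M + 1) - Y = (\<alpha> - 1) * ((4 * M ^ 2 + 2 * \<alpha> * M + \<alpha> - 2) * p)"
      by (simp add: Y_def Z_def power2_eq_square algebra_simps)
    finally show ?thesis using assms unfolding Y_def Z_def by simp
  qed
  ultimately show ?thesis by (simp add: M_def p_def)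
qed

text \<open>
  The factor \<open>1 / j\<close> of the logarithmic tail cancels against the falling factorial that results from the
  summation by parts.
\<close>
lemma factorial_moment_1:
  assumes "\<alpha> = 1"
  shows "(\<lambda>k. falling_factorial (real k) (Suc m) * label_limit k) sums
     ((4 * real (Suc m) ^ 2 + 2 * \<alpha> * real (Suc m) + \<alpha> - 2) / (real (Suc m) + 1) * pochhammer \<alpha> m)"
proof -
  let ?f = "\<lambda>k. falling_factorial (real k) (Suc m)"
  define M where "M = real (Suc m)"
  define p where "p = pochhammer \<alpha> m"
  have p1: "pochhammer \<alpha> (Suc m) = p * M" by (simp add: p_def M_def pochhammer_Suc assms add.commute)
  have M: "M > 0" "real (Suc (Suc m)) = M + 1" by (simp_all add: M_def)
  have "(\<lambda>k. 2 * (?f k * neg_binomial (k - 1))) sums (2 * (p * M + M * p))"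
    using sums_mult[OF sums_shift_1[OF sums_falling_factorial_Suc_neg_binomial[of m]], of 2]
    unfolding p1 p_def[symmetric] M_def[symmetric] .
  moreover have "2 * (?f k * neg_binomial (k - 1)) = ?f k * (1 / 2) ^ (k - 1)" for k
    by (simp add: neg_binomial_1[OF assms])
  moreover have "2 * (p * M + M * p) = 4 * M * p" by simp
  ultimately have first: "(\<lambda>k. ?f k * (1 / 2) ^ (k - 1)) sums (4 * M * p)" by (simp only:)
  have "(\<lambda>i. ?f i * neg_binomial i + (M + 1) * (falling_factorial (real i) m * neg_binomial i)) sums (p * M + (M + 1) * p)"
    using sums_add[OF sums_falling_factorial_neg_binomial[of "Suc m"]
        sums_mult[OF sums_falling_factorial_neg_binomial[of m], of "M + 1"]] unfolding p1 p_def[symmetric] .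
  moreover have "?f i * neg_binomial i + (M + 1) * (falling_factorial (real i) m * neg_binomial i) =
     falling_factorial (real (Suc (Suc i))) (Suc (Suc m)) * ((1 / 2) ^ Suc i / real (Suc i))" for i
  proof -
    have "falling_factorial (real (Suc (Suc i))) (Suc (Suc m)) = (real i + 2) * (real (Suc i) * falling_factorial (real i) m)"
      using falling_factorial_shift[of "real (Suc i)" "Suc m"] falling_factorial_shift[of "real i" m]
      by (simp add: add.commute)
    then have "falling_factorial (real (Suc (Suc i))) (Suc (Suc m)) * ((1 / 2) ^ Suc i / real (Suc i)) =
        (real i + 2) * falling_factorial (real i) m * neg_binomial i"
      by (simp add: neg_binomial_1[OF assms] del: of_nat_Suc)
    then show ?thesis by (simp add: falling_factorial_Suc M_def algebra_simps)
  qed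
  ultimately have "(\<lambda>i. falling_factorial (real (Suc (Suc i))) (Suc (Suc m)) * ((1 / 2) ^ Suc i / real (Suc i))) sums (p * M + (M + 1) * p)"
    by simp
  then have "(\<lambda>i. falling_factorial (real (Suc i)) (Suc (Suc m)) * ((1 / 2) ^ i / real i)) sums (p * M + (M + 1) * p)"
    using sums_Suc_iff[of "\<lambda>i. falling_factorial (real (Suc i)) (Suc (Suc m)) * ((1 / 2) ^ i / real i)"] by simp
  note tail = this
  have second: "(\<lambda>k. ?f k * harmonic_tail k) sums ((p * M + (M + 1) * p) / (M + 1))"
  proof -
    have "0 \<le> harmonic_tail k" for k
      unfolding harmonic_tail_def by (rule suminf_nonneg[OF summable_harmonic]) auto
    moreover have "harmonic_tail k \<le> heavy_limit k" if "1 \<le> k" for k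
      using label_limit_1[OF assms that] label_limit_nonneg[of k] heavy_limit_1[OF assms, of "k - 1"] that by simp
    ultimately show ?thesis
      using sums_by_parts_falling[OF harmonic_tail_Suc _ _ tail]
      unfolding M(2) by blast
  qed
  have "?f k * (1 / 2) ^ (k - 1) - ?f k * harmonic_tail k = ?f k * label_limit k" for k
  proof (cases "k = 0")
    case True
    then show ?thesis using falling_factorial_of_nat_0[of 0 "Suc m"] by simp
  next
    case False
    then have k: "1 \<le> k" by simp
    show ?thesis unfolding label_limit_1[OF assms k] by (simp add: algebra_simps)
  qed
  with sums_diff[OF first second]
  have "(\<lambda>k. ?f k * label_limit k) sums (4 * M * p - (p * M + (M + 1) * p) / (M + 1))" by simp
  moreover have "4 * M * p - (p * M + (M + 1) * p) / (M + 1) = (4 * M ^ 2 + 2 * \<alpha> * M + \<alpha> - 2) / (M + 1) * p"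
    using M(1) assms by (simp add: field_simps power2_eq_square)
  ultimately show ?thesis by (simp add: M_def p_def)
qed

end

section \<open>Very simple families\<close>

lemma weight_gf_0: "fps_nth (weight_gf c1 c2) 0 = 1"
  by (simp add: weight_gf_def)

text \<open>
  The coefficient form of the differential equation \<open>(1 + c2 * u) * \<phi>'(u) = (c1 + c2) * \<phi>(u)\<close>.
\<close>
lemma weight_gf_Suc:
  assumes "c1 \<noteq> 0"
  shows "real (Suc k) * fps_nth (weight_gf c1 c2) (Suc k) = (c1 + c2 - c2 * real k) * fps_nth (weight_gf c1 c2) k"
proof (cases "c2 = 0")
  case True
  have "real (Suc k) * (x / fact (Suc k)) = x / fact k" for x :: real
    unfolding fact_Suc by (simp del: of_nat_Suc)
  then show ?thesis using True by (simp add: weight_gf_def del: of_nat_Suc fact_Suc)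
next
  case False
  have "real (Suc k) * ((1 + c1 / c2) gchoose Suc k) = (1 + c1 / c2 - real k) * ((1 + c1 / c2) gchoose k)"
    using gbinomial_absorb_comp[of "1 + c1 / c2" k] gbinomial_absorption[of k "1 + c1 / c2"] by simp
  then have "c2 ^ Suc k * (real (Suc k) * ((1 + c1 / c2) gchoose Suc k)) =
      c2 ^ Suc k * ((1 + c1 / c2 - real k) * ((1 + c1 / c2) gchoose k))"
    by (simp only:)
  then have "real (Suc k) * (c2 ^ Suc k * ((1 + c1 / c2) gchoose Suc k)) =
      c2 * (1 + c1 / c2 - real k) * (c2 ^ k * ((1 + c1 / c2) gchoose k))"
    by (simp only: power_Suc mult_ac)
  also have "c2 * (1 + c1 / c2 - real k) = c1 + c2 - c2 * real k" using False by (simp add: field_simps)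
  finally show ?thesis using False by (simp add: weight_gf_def del: of_nat_Suc power_Suc)
qed

text \<open>
  For \<open>c2 \<le> 0\<close> all factors of the recurrence are positive. For \<open>c2 > 0\<close> the admissible parameters make the
  exponent of the generating function the natural number \<open>d\<close>.
\<close>
lemma weight_gf_nonneg:
  assumes "very_simple_family c1 c2"
  shows "0 \<le> fps_nth (weight_gf c1 c2) k"
proof -
  have c1: "c1 > 0" and pos: "1 + c2 / c1 > 0"
    using assms by (auto simp: very_simple_family_def tree_alpha_def)
  have sum: "c1 + c2 > 0" using c1 pos by (simp add: field_simps)
  consider "c2 \<le> 0" | d :: nat where "c2 > 0" "d \<ge> 2" "1 + c2 / c1 = real d / (real d - 1)"
    using assms by (force simp: very_simple_family_def tree_alpha_def)
  then show ?thesis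
  proof cases
    case 1
    show ?thesis
    proof (induction k)
      case (Suc k)
      have "c2 * real k \<le> 0" using 1 by (simp add: mult_nonpos_nonneg)
      then have "0 \<le> real (Suc k) * fps_nth (weight_gf c1 c2) (Suc k)"
        using Suc sum c1 unfolding weight_gf_Suc[OF less_imp_neq[OF c1, symmetric]] by (intro mult_nonneg_nonneg) auto
      then show ?case by (simp add: zero_le_mult_iff del: of_nat_Suc)
    qed (simp add: weight_gf_0)
  next
    case (2 d)
    have "real d - 1 > 0" using 2(2) by simp
    then have "c2 * (real d - 1) = c1" using 2(3) c1 by (simp add: field_simps)
    then have "1 + c1 / c2 = real d" using 2(1) by (simp add: field_simps)
    then show ?thesis
      using 2(1) by (simp add: weight_gf_def binomial_gbinomial[symmetric])
  qed
qed

lemma tree_weight_nonneg: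
  assumes "\<And>k. 0 \<le> fps_nth \<phi> k" shows "0 \<le> tree_weight \<phi> T"
  by (induction T) (auto intro!: mult_nonneg_nonneg prod_list_nonneg assms)

lemma tree_dist_eq_graph_dist: "tree_dist T u v = graph_dist (edges T \<union> (edges T)\<inverse>) u v"
  by (simp add: tree_dist_def graph_dist_def)

lemma last_heavy_centroid_label:
  assumes "n \<ge> 1" "T \<in> increasing_trees n"
  shows "last_heavy n (edges T) (centroid_label T)"
proof -
  have "set (labels T) = {1..n}" using assms(2) by (simp add: increasing_trees_def)
  then have "is_centroid T = minimal_distance n (edges T)"
    by (intro ext) (simp add: is_centroid_def minimal_distance_def total_distance_def tree_dist_eq_graph_dist)
  moreover have "tree_dist T (root T) = graph_dist (edges T \<union> (edges T)\<inverse>) 1"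
    using root_increasing_trees[OF assms(2,1)] by (simp add: tree_dist_eq_graph_dist fun_eq_iff)
  ultimately show ?thesis
    using last_heavy_arg_min[OF recursive_tree_edges[OF assms]] by (simp add: centroid_label_def)
qed

context
  fixes c1 c2 \<alpha> :: real
  assumes family: "very_simple_family c1 c2" and \<alpha>: "\<alpha> = tree_alpha c1 c2"
begin

lemma c1_pos: "c1 > 0" and family_alpha_pos: "\<alpha> > 0" and c1_alpha: "c1 + c2 - c2 * x = c1 * (\<alpha> - (\<alpha> - 1) * x)"
  using family by (auto simp: very_simple_family_def \<alpha> tree_alpha_def field_simps)

definition total_weight :: "nat \<Rightarrow> real" where
  "total_weight n = (\<Sum>T\<in>increasing_trees n. tree_weight (weight_gf c1 c2) T)"

lemma weighted_sum_family_Suc: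
  assumes n: "n \<ge> 1"
  shows "(\<Sum>T\<in>increasing_trees (Suc n). tree_weight (weight_gf c1 c2) T * F (edges T)) =
    c1 * (\<Sum>T\<in>increasing_trees n. tree_weight (weight_gf c1 c2) T *
       (\<Sum>v\<in>{1..n}. (\<alpha> - (\<alpha> - 1) * real (outdegree (edges T) v)) * F (insert (v, Suc n) (edges T))))"
proof -
  have c1: "c1 \<noteq> 0" using c1_pos by simp
  show ?thesis
    unfolding weighted_sum_Suc[OF n weight_gf_0 weight_gf_Suc[OF c1]] c1_alpha
    by (simp add: sum_distrib_left mult_ac)
qed

lemma total_weight_Suc:
  assumes n: "n \<ge> 1"
  shows "total_weight (Suc n) = c1 * (real n + \<alpha> - 1) * total_weight n"
proof -
  have "(\<Sum>v\<in>{1..n}. \<alpha> - (\<alpha> - 1) * real (outdegree (edges T) v)) = real n + \<alpha> - 1"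
    if "T \<in> increasing_trees n" for T
  proof -
    have "recursive_tree n (edges T)" by (rule recursive_tree_edges[OF n that])
    then have "Suc (\<Sum>v\<in>{1..n}. outdegree (edges T) v) = n"
      using sum_outdegree_descendants[of n "edges T" 1] descendants_root[of n "edges T"] n by simp
    then have "real (\<Sum>v\<in>{1..n}. outdegree (edges T) v) = real n - 1" by linarith
    moreover have "(\<Sum>v\<in>{1..n}. \<alpha> - (\<alpha> - 1) * real (outdegree (edges T) v)) =
        \<alpha> * real n - (\<alpha> - 1) * real (\<Sum>v\<in>{1..n}. outdegree (edges T) v)"
      by (simp add: sum_subtractf sum_distrib_left)
    ultimately have "(\<Sum>v\<in>{1..n}. \<alpha> - (\<alpha> - 1) * real (outdegree (edges T) v)) =
        \<alpha> * real n - (\<alpha> - 1) * (real n - 1)"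
      by simp
    then show ?thesis by (simp add: algebra_simps)
  qed
  then show ?thesis
    using weighted_sum_family_Suc[OF n, of "\<lambda>_. 1"]
    by (simp add: total_weight_def sum_distrib_left mult_ac)
qed

lemma total_weight_pos: "n \<ge> 1 \<Longrightarrow> total_weight n > 0"
proof (induction n rule: dec_induct)
  case base
  then show ?case by (simp add: total_weight_def increasing_trees_1 weight_gf_0)
next
  case (step n)
  have "real n + \<alpha> - 1 > 0" using step(1) family_alpha_pos by (smt (verit) of_nat_1 of_nat_le_iff)
  then show ?case using step c1_pos by (simp add: total_weight_Suc)
qed

lemma pmf_random_tree:
  assumes n: "n \<ge> 1"
  shows "pmf (random_tree c1 c2 n) T = (if T \<in> increasing_trees n then tree_weight (weight_gf c1 c2) T / total_weight n else 0)"
proof -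
  let ?f = "\<lambda>T. if T \<in> increasing_trees n then tree_weight (weight_gf c1 c2) T / total_weight n else 0"
  have nonneg: "0 \<le> ?f T" for T
    using total_weight_pos[OF n] tree_weight_nonneg[OF weight_gf_nonneg[OF family]] by simp
  have fin: "finite (increasing_trees n)" by (rule finite_increasing_trees[OF n])
  have "(\<integral>\<^sup>+T. ennreal (?f T) \<partial>count_space UNIV) = (\<Sum>T\<in>increasing_trees n. ennreal (?f T))"
    by (rule nn_integral_count_space'[OF fin]) (auto split: if_splits)
  also have "\<dots> = ennreal (\<Sum>T\<in>increasing_trees n. ?f T)" by (rule sum_ennreal) (rule nonneg)
  also have "(\<Sum>T\<in>increasing_trees n. ?f T) = 1"
    using total_weight_pos[OF n] by (simp add: sum_divide_distrib[symmetric]) (simp add: total_weight_def)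
  finally have "(\<integral>\<^sup>+T. ennreal (?f T) \<partial>count_space UNIV) = 1" by simp
  with nonneg have "pmf (embed_pmf ?f) T = ?f T" by (rule pmf_embed_pmf)
  then show ?thesis unfolding random_tree_def total_weight_def[symmetric] .
qed

lemma set_random_tree: "n \<ge> 1 \<Longrightarrow> set_pmf (random_tree c1 c2 n) \<subseteq> increasing_trees n"
  by (auto simp: set_pmf_eq pmf_random_tree split: if_splits)

lemma expectation_random_tree:
  assumes n: "n \<ge> 1"
  shows "measure_pmf.expectation (random_tree c1 c2 n) F = (\<Sum>T\<in>increasing_trees n. tree_weight (weight_gf c1 c2) T * F T) / total_weight n"
proof -
  have "measure_pmf.expectation (random_tree c1 c2 n) F = (\<Sum>T\<in>increasing_trees n. F T * pmf (random_tree c1 c2 n) T)"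
    by (rule integral_measure_pmf_real) (use finite_increasing_trees[OF n] set_random_tree[OF n] in auto)
  then show ?thesis
    by (simp add: pmf_random_tree[OF n] sum_divide_distrib mult.commute)
qed

text \<open>
  The factors \<open>c1\<close> cancel on normalisation, as the total weight grows by \<open>c1 * (n + \<alpha> - 1)\<close>.
\<close>
lemma growing_tree_random_tree: "growing_tree \<alpha> (\<lambda>n. map_pmf edges (random_tree c1 c2 n))"
proof
  show "\<alpha> > 0" by (rule family_alpha_pos)
  fix n :: nat assume n: "n \<ge> 1"
  show "recursive_tree n E" if "E \<in> set_pmf (map_pmf edges (random_tree c1 c2 n))" for E
    using that set_random_tree[OF n] recursive_tree_edges[OF n] by auto
  fix F :: "(nat \<times> nat) set \<Rightarrow> real"
  let ?d = "real n + \<alpha> - 1"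
  have "?d > 0" using n family_alpha_pos by (smt (verit) of_nat_1 of_nat_le_iff)
  have "measure_pmf.expectation (random_tree c1 c2 (Suc n)) (\<lambda>T. F (edges T)) =
      c1 * (\<Sum>T\<in>increasing_trees n. tree_weight (weight_gf c1 c2) T *
       (\<Sum>v\<in>{1..n}. (\<alpha> - (\<alpha> - 1) * real (outdegree (edges T) v)) * F (insert (v, Suc n) (edges T))))
      / (c1 * ?d * total_weight n)"
    using n by (simp only: expectation_random_tree[OF le_SucI[OF n]] weighted_sum_family_Suc[OF n] total_weight_Suc[OF n])
  also have "\<dots> = (\<Sum>T\<in>increasing_trees n. tree_weight (weight_gf c1 c2) T *
       (\<Sum>v\<in>{1..n}. (\<alpha> - (\<alpha> - 1) * real (outdegree (edges T) v)) * F (insert (v, Suc n) (edges T)))) / ?d / total_weight n"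
    using c1_pos by simp
  also have "\<dots> = (\<Sum>T\<in>increasing_trees n. tree_weight (weight_gf c1 c2) T *
       (\<Sum>v\<in>{1..n}. (\<alpha> - (\<alpha> - 1) * real (outdegree (edges T) v)) / ?d * F (insert (v, Suc n) (edges T)))) / total_weight n"
  proof -
    have "(\<Sum>v\<in>{1..n}. (\<alpha> - (\<alpha> - 1) * real (outdegree (edges T) v)) / ?d * F (insert (v, Suc n) (edges T))) =
      (\<Sum>v\<in>{1..n}. (\<alpha> - (\<alpha> - 1) * real (outdegree (edges T) v)) * F (insert (v, Suc n) (edges T))) / ?d" for T
      by (simp add: sum_divide_distrib)
    then show ?thesis by (simp only: times_divide_eq_right sum_divide_distrib[symmetric])
  qed
  also have "\<dots> = measure_pmf.expectation (random_tree c1 c2 n) (\<lambda>T. \<Sum>v\<in>{1..n}.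
       (\<alpha> - (\<alpha> - 1) * real (outdegree (edges T) v)) / ?d * F (insert (v, Suc n) (edges T)))"
    by (simp only: expectation_random_tree[OF n])
  finally show "measure_pmf.expectation (map_pmf edges (random_tree c1 c2 (Suc n))) F =
      measure_pmf.expectation (map_pmf edges (random_tree c1 c2 n)) (\<lambda>E. \<Sum>v\<in>{1..n}.
       (\<alpha> - (\<alpha> - 1) * real (outdegree E v)) / ?d * F (insert (v, Suc n) E))"
    by simp
qed

interpretation growing_tree \<alpha> "\<lambda>n. map_pmf edges (random_tree c1 c2 n)"
  by (rule growing_tree_random_tree)

lemma expectation_centroid_label:
  assumes n: "n \<ge> 1"
  shows "measure_pmf.expectation (random_tree c1 c2 n) (\<lambda>T. f (centroid_label T)) = expect n (\<lambda>E. f (centre n E))"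
proof -
  have "centroid_label T = centre n (edges T)" if "T \<in> set_pmf (random_tree c1 c2 n)" for T
    using that set_random_tree[OF n] centre_eq[OF recursive_tree_edges[OF n] last_heavy_centroid_label[OF n]] by auto
  then have "measure_pmf.expectation (random_tree c1 c2 n) (\<lambda>T. f (centroid_label T)) =
     measure_pmf.expectation (random_tree c1 c2 n) (\<lambda>T. f (centre n (edges T)))"
    by (intro integral_cong_AE) (auto simp: AE_measure_pmf_iff)
  then show ?thesis by simp
qed

text \<open>
  As a limit of probabilities the closed form is nonnegative, and it sums to \<open>1\<close> because no mass escapes.
\<close>
lemma pmf_limit_label: "pmf (limit_label \<alpha>) k = label_limit k"
proof -
  have "limit_prob \<alpha> = label_limit" by (rule ext) (rule limit_prob_eq)
  moreover have "(\<integral>\<^sup>+k. ennreal (label_limit k) \<partial>count_space UNIV) = 1"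
  proof -
    have "(\<integral>\<^sup>+k. ennreal (label_limit k) \<partial>count_space UNIV) = (\<Sum>k. ennreal (label_limit k))"
      by (rule nn_integral_count_space_nat)
    also have "\<dots> = ennreal (suminf label_limit)"
      using label_limit_sums_1 label_limit_nonneg by (intro suminf_ennreal2) (auto simp: sums_iff)
    finally show ?thesis using label_limit_sums_1 by (simp add: sums_iff)
  qed
  ultimately show ?thesis
    unfolding limit_label_def using label_limit_nonneg by (simp add: pmf_embed_pmf)
qed

lemma limit_label_expectation:
  assumes "summable (\<lambda>k. norm (f k * label_limit k))"
  shows "integrable (measure_pmf (limit_label \<alpha>)) (f :: nat \<Rightarrow> real)"
    and "measure_pmf.expectation (limit_label \<alpha>) f = (\<Sum>k. f k * label_limit k)"
proof -
  have int: "integrable (count_space UNIV) (\<lambda>k. label_limit k * f k)"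
    using assms by (simp add: integrable_count_space_nat_iff mult.commute)
  show "integrable (measure_pmf (limit_label \<alpha>)) f"
    unfolding measure_pmf_eq_density using int
    by (subst integrable_real_density) (auto simp: pmf_limit_label label_limit_nonneg)
  have "measure_pmf.expectation (limit_label \<alpha>) f = (\<integral>k. label_limit k * f k \<partial>count_space UNIV)"
    unfolding measure_pmf_eq_density by (subst integral_real_density) (auto simp: pmf_limit_label label_limit_nonneg)
  also have "\<dots> = (\<Sum>k. label_limit k * f k)" using int by (rule integral_count_space_nat)
  finally show "measure_pmf.expectation (limit_label \<alpha>) f = (\<Sum>k. f k * label_limit k)"
    by (simp add: mult.commute)
qed

lemma polynomial_moment:
  assumes f: "\<And>k. \<bar>f k\<bar> \<le> K * real k ^ p"
  shows "integrable (measure_pmf (limit_label \<alpha>)) f"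
    and "measure_pmf.expectation (limit_label \<alpha>) f = (\<Sum>k. f k * label_limit k)"
    and "(\<lambda>n. measure_pmf.expectation (random_tree c1 c2 n) (\<lambda>T. f (centroid_label T)))
           \<longlonglongrightarrow> measure_pmf.expectation (limit_label \<alpha>) f"
proof -
  note lim = expect_centre_tendsto[where f = f and K = K and p = p, OF f]
  show "integrable (measure_pmf (limit_label \<alpha>)) f" and E: "measure_pmf.expectation (limit_label \<alpha>) f = (\<Sum>k. f k * label_limit k)"
    using limit_label_expectation[OF lim(1)] by auto
  have "\<forall>\<^sub>F n in sequentially. expect n (\<lambda>E. f (centre n E)) = measure_pmf.expectation (random_tree c1 c2 n) (\<lambda>T. f (centroid_label T))"
    using eventually_ge_at_top[of 1] by eventually_elim (simp only: expectation_centroid_label)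
  from Lim_transform_eventually[OF lim(2) this]
  show "(\<lambda>n. measure_pmf.expectation (random_tree c1 c2 n) (\<lambda>T. f (centroid_label T)))
           \<longlonglongrightarrow> measure_pmf.expectation (limit_label \<alpha>) f" by (simp only: E)
qed

lemma factorial_moment:
  shows "(\<lambda>n. measure_pmf.expectation (random_tree c1 c2 n) (\<lambda>T. falling_factorial (real (centroid_label T)) m))
           \<longlonglongrightarrow> measure_pmf.expectation (limit_label \<alpha>) (\<lambda>k. falling_factorial (real k) m)"
    and "m \<ge> 1 \<Longrightarrow> measure_pmf.expectation (limit_label \<alpha>) (\<lambda>k. falling_factorial (real k) m) =
      (4 * real m ^ 2 + 2 * \<alpha> * real m + \<alpha> - 2) / (real m + 1) * pochhammer \<alpha> (m - 1)"
proof -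
  have b: "\<bar>falling_factorial (real k) m\<bar> \<le> 1 * real k ^ m" for k
    using falling_factorial_nonneg[of k m] falling_factorial_le_power[of k m] by simp
  show "(\<lambda>n. measure_pmf.expectation (random_tree c1 c2 n) (\<lambda>T. falling_factorial (real (centroid_label T)) m))
           \<longlonglongrightarrow> measure_pmf.expectation (limit_label \<alpha>) (\<lambda>k. falling_factorial (real k) m)"
    by (rule polynomial_moment(3)[OF b])
  note E = polynomial_moment(2)[OF b]
  assume "m \<ge> 1"
  then obtain m' where m': "m = Suc m'" by (cases m) auto
  have "(\<lambda>k. falling_factorial (real k) (Suc m') * label_limit k) sums
     ((4 * real (Suc m') ^ 2 + 2 * \<alpha> * real (Suc m') + \<alpha> - 2) / (real (Suc m') + 1) * pochhammer \<alpha> m')"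
    by (cases "\<alpha> = 1") (rule factorial_moment_1 factorial_moment_neq_1; assumption)+
  then show "measure_pmf.expectation (limit_label \<alpha>) (\<lambda>k. falling_factorial (real k) m) =
      (4 * real m ^ 2 + 2 * \<alpha> * real m + \<alpha> - 2) / (real m + 1) * pochhammer \<alpha> (m - 1)"
    unfolding E unfolding m' diff_Suc_1 by (rule sums_unique[symmetric])
qed

lemma mean_and_variance:
  shows "(\<lambda>n. measure_pmf.expectation (random_tree c1 c2 n) (\<lambda>T. real (centroid_label T)))
           \<longlonglongrightarrow> measure_pmf.expectation (limit_label \<alpha>) real"
    and "measure_pmf.expectation (limit_label \<alpha>) real = 1 + 3 / 2 * \<alpha>"
    and "(\<lambda>n. measure_pmf.variance (random_tree c1 c2 n) (\<lambda>T. real (centroid_label T)))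
           \<longlonglongrightarrow> measure_pmf.variance (limit_label \<alpha>) real"
    and "measure_pmf.variance (limit_label \<alpha>) real = - (7 / 12) * \<alpha> ^ 2 + 19 / 6 * \<alpha>"
proof -
  let ?E = "\<lambda>n. measure_pmf.expectation (random_tree c1 c2 n)" and ?L = "measure_pmf.expectation (limit_label \<alpha>)"
  have b1: "\<bar>real k\<bar> \<le> 1 * real k ^ 1" for k by simp
  have b2: "\<bar>(real k)\<^sup>2\<bar> \<le> 1 * real k ^ 2" for k by simp
  note first = polynomial_moment[OF b1] and second = polynomial_moment[OF b2]
  show mean_lim: "(\<lambda>n. ?E n (\<lambda>T. real (centroid_label T))) \<longlonglongrightarrow> ?L real" by (rule first(3))
  show mean: "?L real = 1 + 3 / 2 * \<alpha>"
    using factorial_moment(2)[of 1] by (simp add: falling_factorial_def algebra_simps)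
  have "?L (\<lambda>k. falling_factorial (real k) 2) = ?L (\<lambda>k. (real k)\<^sup>2 - real k)"
    by (simp add: falling_factorial_def numeral_2_eq_2 power2_eq_square algebra_simps)
  also have "\<dots> = ?L (\<lambda>k. (real k)\<^sup>2) - ?L real"
    by (rule Bochner_Integration.integral_diff) (rule first(1) second(1))+
  finally have "?L (\<lambda>k. (real k)\<^sup>2) = (14 + 5 * \<alpha>) / 3 * \<alpha> + (1 + 3 / 2 * \<alpha>)"
    using factorial_moment(2)[of 2] mean by (simp add: algebra_simps)
  moreover have limit_variance: "measure_pmf.variance (limit_label \<alpha>) real = ?L (\<lambda>k. (real k)\<^sup>2) - (?L real)\<^sup>2"
    by (rule measure_pmf.variance_eq) (rule first(1) second(1))+
  ultimately show "measure_pmf.variance (limit_label \<alpha>) real = - (7 / 12) * \<alpha> ^ 2 + 19 / 6 * \<alpha>"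
    unfolding mean by (simp add: power2_eq_square field_simps)
  have "\<forall>\<^sub>F n in sequentially. ?E n (\<lambda>T. (real (centroid_label T))\<^sup>2) - (?E n (\<lambda>T. real (centroid_label T)))\<^sup>2 =
      measure_pmf.variance (random_tree c1 c2 n) (\<lambda>T. real (centroid_label T))"
    using eventually_ge_at_top[of 1]
  proof eventually_elim
    case (elim n)
    have "finite (set_pmf (random_tree c1 c2 n))"
      using finite_subset[OF set_random_tree[OF elim] finite_increasing_trees[OF elim]] .
    then have "integrable (measure_pmf (random_tree c1 c2 n)) (g :: _ \<Rightarrow> real)" for g
      by (rule integrable_measure_pmf_finite)
    then show ?case by (intro measure_pmf.variance_eq[symmetric])
  qed
  from Lim_transform_eventually[OF tendsto_diff[OF second(3) tendsto_power[OF first(3), of 2]] this]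
  show "(\<lambda>n. measure_pmf.variance (random_tree c1 c2 n) (\<lambda>T. real (centroid_label T)))
           \<longlonglongrightarrow> measure_pmf.variance (limit_label \<alpha>) real"
    unfolding limit_variance .
qed

end

theorem theorem14:
  fixes c1 c2 \<alpha> :: real
  assumes "very_simple_family c1 c2" and "\<alpha> = tree_alpha c1 c2"
  shows "(\<forall>m::nat. m \<ge> 1 \<longrightarrow>
            (\<lambda>n. measure_pmf.expectation (random_tree c1 c2 n)
                   (\<lambda>T. falling_factorial (real (centroid_label T)) m))
              \<longlonglongrightarrow> measure_pmf.expectation (limit_label \<alpha>) (\<lambda>k. falling_factorial (real k) m) \<and>
            measure_pmf.expectation (limit_label \<alpha>) (\<lambda>k. falling_factorial (real k) m)
              = (4 * real m ^ 2 + 2 * \<alpha> * real m + \<alpha> - 2) / (real m + 1)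
                * pochhammer \<alpha> (m - 1)) \<and>
         (\<lambda>n. measure_pmf.expectation (random_tree c1 c2 n) (\<lambda>T. real (centroid_label T)))
           \<longlonglongrightarrow> measure_pmf.expectation (limit_label \<alpha>) real \<and>
         measure_pmf.expectation (limit_label \<alpha>) real = 1 + 3 / 2 * \<alpha> \<and>
         (\<lambda>n. measure_pmf.variance (random_tree c1 c2 n) (\<lambda>T. real (centroid_label T)))
           \<longlonglongrightarrow> measure_pmf.variance (limit_label \<alpha>) real \<and>
         measure_pmf.variance (limit_label \<alpha>) real = - (7 / 12) * \<alpha> ^ 2 + 19 / 6 * \<alpha>"
  using factorial_moment[OF assms] mean_and_variance[OF assms] by blast

end
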